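(* Let $n\ge 2$ and let $k_n=0<1=k_{n-1}<\cdots<k_1=e-1<k_0=e$ be a sequence of integers. Let $f=(s^{k_0},\,s^{k_1}t^{e-k_1},\dots,\,s^{k_{n-1}}t^{e-k_{n-1}},\,t^{e-k_n}):\mathbb{P}^1\to\mathbb{P}^n$ be the corresponding unramified map whose coordinates are given by monomials. Then $$N_f\cong\bigoplus_{i=1}^{n-1}\mathcal{O}_{\mathbb{P}^1}(e+b_i),\qquad b_i=k_{i-1}-k_{i+1}.$$
   Context: We work over an algebraically closed field of characteristic zero. A morphism $f:\mathbb{P}^1\to\mathbb{P}^n$ is unramified if $f^*\Omega_{\mathbb{P}^n}\to\Omega_{\mathbb{P}^1}$ is surjective; its normal bundle $N_f$ is defined by $0\to T_{\mathbb{P}^1}\to f^*T_{\mathbb{P}^n}\to N_f\to 0$. When $n=2$ the condition on the sequence forces $e=2$. *)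

theory Defs
  imports "HOL-Computational_Algebra.Polynomial"
begin

section \<open>Projective space over an algebraically closed field\<close>

text \<open>
  Over an algebraically closed field, varieties are treated through their closed points.
  A point of \<open>\<bbbP>\<^sup>n\<close> is the set of all its vectors of homogeneous coordinates. Such a vector is a
  function on the natural numbers which vanishes at every index above \<open>n\<close>.
\<close>

type_synonym 'k vec = "nat \<Rightarrow> 'k"
type_synonym 'k pt = "'k vec set"

definition coord_vecs :: "nat \<Rightarrow> 'k::field vec set" where
  "coord_vecs n = {v. (\<forall>i>n. v i = 0) \<and> (\<exists>i\<le>n. v i \<noteq> 0)}"

definition proj_pt :: "'k::field vec \<Rightarrow> 'k pt" where
  "proj_pt v = {\<lambda>i. c * v i | c. c \<noteq> 0}"

definition proj_space :: "nat \<Rightarrow> 'k::field pt set" where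
  "proj_space n = proj_pt ` coord_vecs n"

definition exponents :: "nat \<Rightarrow> nat \<Rightarrow> (nat \<Rightarrow> nat) set" where
  "exponents n d = {\<alpha>. (\<forall>i>n. \<alpha> i = 0) \<and> (\<Sum>i\<le>n. \<alpha> i) = d}"

text \<open>
  Forms of degree \<open>d\<close> in \<open>x\<^sub>0, \<dots>, x\<^sub>n\<close>, as polynomial functions (the field will be infinite).
\<close>

definition forms :: "nat \<Rightarrow> nat \<Rightarrow> ('k::field vec \<Rightarrow> 'k) set" where
  "forms n d = {F. \<exists>c. F = (\<lambda>v. \<Sum>\<alpha>\<in>exponents n d. c \<alpha> * (\<Prod>i\<le>n. v i ^ \<alpha> i))}"

definition zariski_open :: "nat \<Rightarrow> 'k::field pt set \<Rightarrow> bool" where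
  "zariski_open n U \<longleftrightarrow>
     (\<exists>S \<subseteq> (\<Union>d. forms n d). U = {p \<in> proj_space n. \<exists>F\<in>S. \<forall>v\<in>p. F v \<noteq> 0})"

text \<open>
  A germ at \<open>p\<close> of a regular function on \<open>\<bbbP>\<^sup>n\<close> is represented by a total function on points whose
  values away from \<open>p\<close> are irrelevant.
\<close>

definition regular_at :: "nat \<Rightarrow> 'k::field pt \<Rightarrow> ('k pt \<Rightarrow> 'k) \<Rightarrow> bool" where
  "regular_at n p h \<longleftrightarrow>
     (\<exists>V d. zariski_open n V \<and> p \<in> V \<and>
        (\<exists>F\<in>forms n d. \<exists>G\<in>forms n d. \<forall>q\<in>V. \<forall>v\<in>q. G v \<noteq> 0 \<and> h q = F v / G v))"

text \<open>The ring \<open>\<O>(U)\<close>; its elements are extended by zero outside \<open>U\<close>.\<close>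

definition regular_functions :: "nat \<Rightarrow> 'k::field pt set \<Rightarrow> ('k pt \<Rightarrow> 'k) set" where
  "regular_functions n U = {h. (\<forall>p\<in>U. regular_at n p h) \<and> (\<forall>p. p \<notin> U \<longrightarrow> h p = 0)}"

definition proj_morphism :: "nat \<Rightarrow> nat \<Rightarrow> ('k::field pt \<Rightarrow> 'k pt) \<Rightarrow> bool" where
  "proj_morphism m n f \<longleftrightarrow>
     (\<forall>p\<in>proj_space m. f p \<in> proj_space n) \<and>
     (\<forall>W. zariski_open n W \<longrightarrow> zariski_open m {p \<in> proj_space m. f p \<in> W}) \<and>
     (\<forall>p\<in>proj_space m. \<forall>h. regular_at n (f p) h \<longrightarrow> regular_at m p (\<lambda>q. h (f q)))"


section \<open>Sheaves of modules on the projective line\<close>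

text \<open>
  The last two arguments of \<open>restr\<close> are the target open set and the section: \<open>restr F U V s\<close> is the
  restriction to \<open>V \<subseteq> U\<close> of \<open>s \<in> sec F U\<close>. Only the values at open sets matter.
\<close>

record ('k, 's) omod =
  sec :: "'k pt set \<Rightarrow> 's set"
  plus_sec :: "'k pt set \<Rightarrow> 's \<Rightarrow> 's \<Rightarrow> 's"
  smult_sec :: "'k pt set \<Rightarrow> ('k pt \<Rightarrow> 'k) \<Rightarrow> 's \<Rightarrow> 's"
  restr :: "'k pt set \<Rightarrow> 'k pt set \<Rightarrow> 's \<Rightarrow> 's"

definition omod_hom ::
  "('k::field, 's) omod \<Rightarrow> ('k, 't) omod \<Rightarrow> ('k pt set \<Rightarrow> 's \<Rightarrow> 't) \<Rightarrow> bool" where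
  "omod_hom F G \<phi> \<longleftrightarrow>
     (\<forall>U. zariski_open 1 U \<longrightarrow>
        (\<forall>s\<in>sec F U. \<phi> U s \<in> sec G U) \<and>
        (\<forall>s\<in>sec F U. \<forall>t\<in>sec F U. \<phi> U (plus_sec F U s t) = plus_sec G U (\<phi> U s) (\<phi> U t)) \<and>
        (\<forall>a\<in>regular_functions 1 U. \<forall>s\<in>sec F U.
           \<phi> U (smult_sec F U a s) = smult_sec G U a (\<phi> U s)) \<and>
        (\<forall>V. zariski_open 1 V \<and> V \<subseteq> U \<longrightarrow>
           (\<forall>s\<in>sec F U. \<phi> V (restr F U V s) = restr G U V (\<phi> U s))))"

definition omod_iso :: "('k::field, 's) omod \<Rightarrow> ('k, 't) omod \<Rightarrow> bool" where
  "omod_iso F G \<longleftrightarrow>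
     (\<exists>\<phi>. omod_hom F G \<phi> \<and> (\<forall>U. zariski_open 1 U \<longrightarrow> bij_betw (\<phi> U) (sec F U) (sec G U)))"

text \<open>Surjectivity as a map of sheaves, that is, local liftability of sections.\<close>

definition omod_surj ::
  "('k::field, 's) omod \<Rightarrow> ('k, 't) omod \<Rightarrow> ('k pt set \<Rightarrow> 's \<Rightarrow> 't) \<Rightarrow> bool" where
  "omod_surj F G \<phi> \<longleftrightarrow>
     (\<forall>U. zariski_open 1 U \<longrightarrow> (\<forall>t\<in>sec G U. \<forall>p\<in>U.
        \<exists>V. zariski_open 1 V \<and> p \<in> V \<and> V \<subseteq> U \<and> (\<exists>s\<in>sec F V. \<phi> V s = restr G U V t)))"

text \<open>
  The germ at \<open>p\<close> of \<open>s \<in> sec G V\<close> modulo the image of \<open>\<phi>\<close>, as an equivalence class of pairs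
  consisting of an open neighbourhood of \<open>p\<close> and a section of \<open>G\<close> over it. These classes are the
  elements of the stalk at \<open>p\<close> of the presheaf cokernel of \<open>\<phi>\<close>.
\<close>

definition coker_germ ::
  "('k::field, 's) omod \<Rightarrow> ('k, 't) omod \<Rightarrow> ('k pt set \<Rightarrow> 's \<Rightarrow> 't) \<Rightarrow>
     'k pt \<Rightarrow> 'k pt set \<Rightarrow> 't \<Rightarrow> ('k pt set \<times> 't) set" where
  "coker_germ F G \<phi> p V s =
     {(V', s'). zariski_open 1 V' \<and> p \<in> V' \<and> s' \<in> sec G V' \<and>
        (\<exists>W. zariski_open 1 W \<and> p \<in> W \<and> W \<subseteq> V \<inter> V' \<and>
           (\<exists>x\<in>sec F W. restr G V' W s' = plus_sec G W (restr G V W s) (\<phi> W x)))}"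

text \<open>
  The cokernel sheaf: the sheafification of the presheaf cokernel. A section over \<open>U\<close> assigns to
  each point of \<open>U\<close> an element of the stalk, locally coming from sections of \<open>G\<close>.
\<close>

definition coker_sheaf ::
  "('k::field, 's) omod \<Rightarrow> ('k, 't) omod \<Rightarrow> ('k pt set \<Rightarrow> 's \<Rightarrow> 't) \<Rightarrow>
     ('k, 'k pt \<Rightarrow> ('k pt set \<times> 't) set) omod" where
  "coker_sheaf F G \<phi> =
     \<lparr> sec = (\<lambda>U. {\<sigma>. (\<forall>p. p \<notin> U \<longrightarrow> \<sigma> p = {}) \<and>
          (\<forall>p\<in>U. \<exists>V. zariski_open 1 V \<and> p \<in> V \<and> V \<subseteq> U \<and>
             (\<exists>s\<in>sec G V. \<forall>q\<in>V. \<sigma> q = coker_germ F G \<phi> q V s))}),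
       plus_sec = (\<lambda>U \<sigma> \<tau> p. \<Union>(V, s)\<in>\<sigma> p. \<Union>(V', s')\<in>\<tau> p.
          coker_germ F G \<phi> p (V \<inter> V')
            (plus_sec G (V \<inter> V') (restr G V (V \<inter> V') s) (restr G V' (V \<inter> V') s'))),
       smult_sec = (\<lambda>U a \<sigma> p. \<Union>(V, s)\<in>\<sigma> p.
          coker_germ F G \<phi> p (U \<inter> V)
            (smult_sec G (U \<inter> V) (\<lambda>q. if q \<in> U \<inter> V then a q else 0) (restr G V (U \<inter> V) s))),
       restr = (\<lambda>U V \<sigma> p. if p \<in> V then \<sigma> p else {}) \<rparr>"

text \<open>
  \<open>\<O>(d)\<close> on the projective line: a section over \<open>U\<close> is a function on the punctured cone over \<open>U\<close>
  which is locally a quotient of forms whose degrees differ by \<open>d\<close>.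
\<close>

definition twisting_sheaf :: "int \<Rightarrow> ('k::field, 'k vec \<Rightarrow> 'k) omod" where
  "twisting_sheaf d =
     \<lparr> sec = (\<lambda>U. {g. (\<forall>v. v \<notin> \<Union>U \<longrightarrow> g v = 0) \<and>
          (\<forall>p\<in>U. \<exists>V a b. zariski_open 1 V \<and> p \<in> V \<and> V \<subseteq> U \<and> int a = int b + d \<and>
             (\<exists>A\<in>forms 1 a. \<exists>B\<in>forms 1 b. \<forall>v\<in>\<Union>V. B v \<noteq> 0 \<and> g v = A v / B v))}),
       plus_sec = (\<lambda>U g h v. g v + h v),
       smult_sec = (\<lambda>U a g v. a (proj_pt v) * g v),
       restr = (\<lambda>U V g v. if v \<in> \<Union>V then g v else 0) \<rparr>"

definition direct_sum :: "nat set \<Rightarrow> (nat \<Rightarrow> ('k::field, 's) omod) \<Rightarrow> ('k, nat \<Rightarrow> 's) omod" where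
  "direct_sum I F =
     \<lparr> sec = (\<lambda>U. {s. (\<forall>i\<in>I. s i \<in> sec (F i) U) \<and> (\<forall>i. i \<notin> I \<longrightarrow> s i = undefined)}),
       plus_sec = (\<lambda>U s t i. if i \<in> I then plus_sec (F i) U (s i) (t i) else undefined),
       smult_sec = (\<lambda>U a s i. if i \<in> I then smult_sec (F i) U a (s i) else undefined),
       restr = (\<lambda>U V s i. if i \<in> I then restr (F i) U V (s i) else undefined) \<rparr>"


section \<open>Tangent and cotangent sheaves, the normal bundle\<close>

text \<open>
  The Zariski tangent space of \<open>\<bbbP>\<^sup>n\<close> at \<open>p\<close>, as the space of derivations of the local ring at \<open>p\<close>
  with values in the residue field; derivations are extended by zero to functions not regular at \<open>p\<close>.
\<close>

type_synonym 'k tvec = "('k pt \<Rightarrow> 'k) \<Rightarrow> 'k"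

definition tangent_space :: "nat \<Rightarrow> 'k::field pt \<Rightarrow> 'k tvec set" where
  "tangent_space n p = {\<delta>.
     (\<forall>h. \<not> regular_at n p h \<longrightarrow> \<delta> h = 0) \<and>
     (\<forall>g h. regular_at n p g \<and> regular_at n p h \<and>
        (\<exists>V. zariski_open n V \<and> p \<in> V \<and> (\<forall>q\<in>V. g q = h q)) \<longrightarrow> \<delta> g = \<delta> h) \<and>
     (\<forall>g h. regular_at n p g \<and> regular_at n p h \<longrightarrow>
        \<delta> (\<lambda>q. g q + h q) = \<delta> g + \<delta> h \<and>
        \<delta> (\<lambda>q. g q * h q) = g p * \<delta> h + h p * \<delta> g) \<and>
     (\<forall>c h. regular_at n p h \<longrightarrow> \<delta> (\<lambda>q. c * h q) = c * \<delta> h)}"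

definition differential_at :: "nat \<Rightarrow> ('k::field pt \<Rightarrow> 'k pt) \<Rightarrow> 'k pt \<Rightarrow> 'k tvec \<Rightarrow> 'k tvec" where
  "differential_at n f p \<delta> = (\<lambda>h. if regular_at n (f p) h then \<delta> (\<lambda>q. h (f q)) else 0)"

text \<open>
  The pullback of the tangent bundle of \<open>\<bbbP>\<^sup>n\<close> along \<open>f\<close> from the projective line: its fibre at \<open>p\<close> is
  the tangent space at \<open>f p\<close>, and its sections are the vector fields along \<open>f\<close> that carry regular
  functions to regular functions.
\<close>

definition pullback_tangent ::
  "nat \<Rightarrow> ('k::field pt \<Rightarrow> 'k pt) \<Rightarrow> ('k, 'k pt \<Rightarrow> 'k tvec) omod" where
  "pullback_tangent n f =
     \<lparr> sec = (\<lambda>U. {\<xi>. (\<forall>p. p \<notin> U \<longrightarrow> \<xi> p = (\<lambda>h. 0)) \<and>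
          (\<forall>p\<in>U. \<xi> p \<in> tangent_space n (f p) \<and>
             (\<forall>h. regular_at n (f p) h \<longrightarrow> regular_at 1 p (\<lambda>q. \<xi> q h)))}),
       plus_sec = (\<lambda>U \<xi> \<eta> p h. \<xi> p h + \<eta> p h),
       smult_sec = (\<lambda>U a \<xi> p h. a p * \<xi> p h),
       restr = (\<lambda>U V \<xi> p. if p \<in> V then \<xi> p else (\<lambda>h. 0)) \<rparr>"

abbreviation tangent_P1 :: "('k::field, 'k pt \<Rightarrow> 'k tvec) omod" where
  "tangent_P1 \<equiv> pullback_tangent 1 (\<lambda>p. p)"

definition differential ::
  "nat \<Rightarrow> ('k::field pt \<Rightarrow> 'k pt) \<Rightarrow> 'k pt set \<Rightarrow> ('k pt \<Rightarrow> 'k tvec) \<Rightarrow> ('k pt \<Rightarrow> 'k tvec)" where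
  "differential n f U \<xi> = (\<lambda>p. if p \<in> U then differential_at n f p (\<xi> p) else (\<lambda>h. 0))"

text \<open>
  The pullback of the cotangent bundle of \<open>\<bbbP>\<^sup>n\<close> along \<open>f\<close>. A section is given by its values in the
  cotangent spaces at the points \<open>f p\<close>; locally it is a combination \<open>\<Sum>\<^sub>j a\<^sub>j f\<^sup>*(dh\<^sub>j)\<close> with \<open>a\<^sub>j\<close> and
  \<open>h\<^sub>j\<close> regular, where \<open>dh\<close> is the linear form \<open>\<delta> \<mapsto> \<delta> h\<close>.
\<close>

definition pullback_cotangent ::
  "nat \<Rightarrow> ('k::field pt \<Rightarrow> 'k pt) \<Rightarrow> ('k, 'k pt \<Rightarrow> 'k tvec \<Rightarrow> 'k) omod" where
  "pullback_cotangent n f =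
     \<lparr> sec = (\<lambda>U. {\<omega>. (\<forall>p. p \<notin> U \<longrightarrow> \<omega> p = (\<lambda>\<delta>. 0)) \<and>
          (\<forall>p\<in>U. \<exists>V. zariski_open 1 V \<and> p \<in> V \<and> V \<subseteq> U \<and>
             (\<exists>(m::nat) a h. \<forall>q\<in>V.
                (\<forall>j<m. regular_at 1 q (a j) \<and> regular_at n (f q) (h j)) \<and>
                \<omega> q = (\<lambda>\<delta>. if \<delta> \<in> tangent_space n (f q) then \<Sum>j<m. a j q * \<delta> (h j) else 0)))}),
       plus_sec = (\<lambda>U \<omega> \<eta> p \<delta>. \<omega> p \<delta> + \<eta> p \<delta>),
       smult_sec = (\<lambda>U a \<omega> p \<delta>. a p * \<omega> p \<delta>),
       restr = (\<lambda>U V \<omega> p. if p \<in> V then \<omega> p else (\<lambda>\<delta>. 0)) \<rparr>"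

abbreviation cotangent_P1 :: "('k::field, 'k pt \<Rightarrow> 'k tvec \<Rightarrow> 'k) omod" where
  "cotangent_P1 \<equiv> pullback_cotangent 1 (\<lambda>p. p)"

definition codifferential ::
  "nat \<Rightarrow> ('k::field pt \<Rightarrow> 'k pt) \<Rightarrow> 'k pt set \<Rightarrow>
     ('k pt \<Rightarrow> 'k tvec \<Rightarrow> 'k) \<Rightarrow> ('k pt \<Rightarrow> 'k tvec \<Rightarrow> 'k)" where
  "codifferential n f U \<omega> =
     (\<lambda>p \<delta>. if p \<in> U \<and> \<delta> \<in> tangent_space 1 p then \<omega> p (differential_at n f p \<delta>) else 0)"

definition unramified :: "nat \<Rightarrow> ('k::field pt \<Rightarrow> 'k pt) \<Rightarrow> bool" where
  "unramified n f \<longleftrightarrow>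
     proj_morphism 1 n f \<and>
     omod_surj (pullback_cotangent n f) cotangent_P1 (codifferential n f)"

definition normal_bundle ::
  "nat \<Rightarrow> ('k::field pt \<Rightarrow> 'k pt) \<Rightarrow>
     ('k, 'k pt \<Rightarrow> ('k pt set \<times> ('k pt \<Rightarrow> 'k tvec)) set) omod" where
  "normal_bundle n f = coker_sheaf tangent_P1 (pullback_tangent n f) (differential n f)"


section \<open>Monomial maps\<close>

text \<open>The homogeneous coordinates on the projective line are \<open>s = v 0\<close> and \<open>t = v 1\<close>.\<close>

definition monomial_map :: "nat \<Rightarrow> nat \<Rightarrow> (nat \<Rightarrow> nat) \<Rightarrow> 'k::field pt \<Rightarrow> 'k pt" where
  "monomial_map n e k p =
     (\<Union>v\<in>p. proj_pt (\<lambda>i. if i \<le> n then v 0 ^ k i * v 1 ^ (e - k i) else 0))"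

end

theory Submission
  imports Defs
begin

text \<open>
  Write \<open>F\<^sub>i = s^k\<^sub>i t^(e-k\<^sub>i)\<close>. By the Euler sequence a tangent vector of \<open>\<bbbP>\<^sup>n\<close> at \<open>f v\<close> is a vector
  \<open>w\<close> modulo \<open>F v\<close>, and a section of \<open>f\<^sup>*T\<close> is locally a tuple \<open>(w\<^sub>0, \<dots>, w\<^sub>n)\<close> of degree \<open>e\<close> modulo
  \<open>F\<close>. The tangent bundle of the line contributes the span of \<open>\<partial>F/\<partial>s\<close> and \<open>\<partial>F/\<partial>t\<close>, which
  contains \<open>F\<close>; away from \<open>st = 0\<close> this is the span of the vectors \<open>(F\<^sub>i)\<close> and \<open>(k\<^sub>i F\<^sub>i)\<close>. So a linear
  form in \<open>w\<close> descends to the normal bundle if and only if it vanishes on these two vectors, and three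
  consecutive indices suffice to produce such a form: with \<open>a = k\<^sub>i\<^sub>-\<^sub>1 - k\<^sub>i\<close> and \<open>b = k\<^sub>i - k\<^sub>i\<^sub>+\<^sub>1\<close> it is
  \<open>b t^(a+b) w\<^sub>i\<^sub>-\<^sub>1 - (a+b) s^a t^b w\<^sub>i + a s^(a+b) w\<^sub>i\<^sub>+\<^sub>1\<close>. Its coefficients have degree
  \<open>a + b = b\<^sub>i\<close>, so it takes values in \<open>\<O>(e + b\<^sub>i)\<close>.

  Together the \<open>n - 1\<close> forms map \<open>f\<^sup>*T\<close> to \<open>\<Oplus> \<O>(e + b\<^sub>i)\<close>. Where \<open>t \<noteq> 0\<close> the coefficient of
  \<open>w\<^sub>i\<^sub>-\<^sub>1\<close> is a unit and the system is triangular. Normalising \<open>w\<^sub>n = 0\<close>, it can be solved downwards for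
  \<open>w\<^sub>n\<^sub>-\<^sub>2, \<dots>, w\<^sub>0\<close> with \<open>w\<^sub>n\<^sub>-\<^sub>1\<close> chosen freely, so the map is onto; and a solution of the homogeneous
  system is determined by \<open>w\<^sub>n\<^sub>-\<^sub>1\<close>, hence is the image of a vector field on the line
  (\<open>three_term_solution_correct\<close>, \<open>three_term_kernel\<close>). Where \<open>s \<noteq> 0\<close> the same happens with the
  order of the indices reversed. Hence \<open>T \<rightarrow> f\<^sup>*T \<rightarrow> \<Oplus> \<O>(e + b\<^sub>i) \<rightarrow> 0\<close> is exact
  (\<open>normal_map_surj\<close>, \<open>normal_map_differential\<close>, \<open>normal_map_kernel\<close>), and \<open>coker_sheaf_iso\<close>
  identifies the sheafified cokernel with any sheaf that completes a right exact sequence.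

  Tangent vectors are derivations here. The Euler sequence comes from differentiating along the lines
  \<open>x + z w\<close>, and rests on the fact that a derivation is determined by its values on the coordinate
  ratios \<open>x\<^sub>l / x\<^sub>j\<close> (\<open>tangent_space_eqI\<close>, \<open>dir_deriv_tangent\<close>, \<open>tangent_eq_dir_deriv\<close>). Unramifiedness is
  visible in the same charts: as \<open>k\<^sub>n\<^sub>-\<^sub>1 = 1\<close> and \<open>k\<^sub>1 = e - 1\<close>, one of the ratios pulls back to the affine
  coordinate of the line, whose differential generates the cotangent sheaf.
\<close>

section \<open>Forms\<close>

lemma finite_exponents: "finite (exponents n d)"
proof -
  have "exponents n d \<subseteq> {\<alpha>. \<forall>i. (i \<in> {..n} \<longrightarrow> \<alpha> i \<in> {..d}) \<and> (i \<notin> {..n} \<longrightarrow> \<alpha> i = 0)}"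
  proof
    fix \<alpha> assume a: "\<alpha> \<in> exponents n d"
    have "\<alpha> i \<le> d" if "i \<le> n" for i
    proof -
      have "\<alpha> i \<le> (\<Sum>i\<le>n. \<alpha> i)" using that by (intro member_le_sum) auto
      then show ?thesis using a by (simp add: exponents_def)
    qed
    then show "\<alpha> \<in> {\<alpha>. \<forall>i. (i \<in> {..n} \<longrightarrow> \<alpha> i \<in> {..d}) \<and> (i \<notin> {..n} \<longrightarrow> \<alpha> i = 0)}"
      using a by (auto simp: exponents_def)
  qed
  then show ?thesis by (rule finite_subset) (intro finite_set_of_finite_funs finite_atMost)
qed

lemma forms_add: "F \<in> forms n d \<Longrightarrow> G \<in> forms n d \<Longrightarrow> (\<lambda>v. F v + G v) \<in> forms n d"
proof -
  assume "F \<in> forms n d" "G \<in> forms n d"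
  then obtain c c' where "F = (\<lambda>v. \<Sum>\<alpha>\<in>exponents n d. c \<alpha> * (\<Prod>i\<le>n. v i ^ \<alpha> i))"
    "G = (\<lambda>v. \<Sum>\<alpha>\<in>exponents n d. c' \<alpha> * (\<Prod>i\<le>n. v i ^ \<alpha> i))" by (auto simp: forms_def)
  then have "(\<lambda>v. F v + G v) = (\<lambda>v. \<Sum>\<alpha>\<in>exponents n d. (c \<alpha> + c' \<alpha>) * (\<Prod>i\<le>n. v i ^ \<alpha> i))"
    by (simp add: sum.distrib distrib_right)
  then show ?thesis unfolding forms_def mem_Collect_eq by (rule exI[of _ "\<lambda>\<alpha>. c \<alpha> + c' \<alpha>"])
qed

lemma forms_zero: "(\<lambda>v. 0) \<in> forms n d"
  unfolding forms_def by (auto intro!: exI[of _ "\<lambda>_. 0"])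

lemma forms_sum:
  "finite A \<Longrightarrow> (\<And>a. a \<in> A \<Longrightarrow> F a \<in> forms n d) \<Longrightarrow> (\<lambda>v. \<Sum>a\<in>A. F a v) \<in> forms n d"
  by (induction A rule: finite_induct) (auto intro: forms_zero forms_add)

lemma forms_monomial:
  assumes "\<alpha> \<in> exponents n d"
  shows "(\<lambda>v::nat \<Rightarrow> 'k::field. c * (\<Prod>i\<le>n. v i ^ \<alpha> i)) \<in> forms n d"
proof -
  have "(\<lambda>v::nat \<Rightarrow> 'k. c * (\<Prod>i\<le>n. v i ^ \<alpha> i))
      = (\<lambda>v. \<Sum>\<beta>\<in>exponents n d. (if \<beta> = \<alpha> then c else 0) * (\<Prod>i\<le>n. v i ^ \<beta> i))"
  proof
    fix v :: "nat \<Rightarrow> 'k"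
    have "(\<Sum>\<beta>\<in>exponents n d. (if \<beta> = \<alpha> then c else 0) * (\<Prod>i\<le>n. v i ^ \<beta> i))
        = (\<Sum>\<beta>\<in>exponents n d. if \<beta> = \<alpha> then c * (\<Prod>i\<le>n. v i ^ \<beta> i) else 0)"
      by (rule sum.cong) auto
    then show "c * (\<Prod>i\<le>n. v i ^ \<alpha> i) = (\<Sum>\<beta>\<in>exponents n d. (if \<beta> = \<alpha> then c else 0) * (\<Prod>i\<le>n. v i ^ \<beta> i))"
      using assms finite_exponents by simp
  qed
  then show ?thesis unfolding forms_def mem_Collect_eq
    by (rule exI[of _ "\<lambda>\<beta>. if \<beta> = \<alpha> then c else 0"])
qed

lemma forms_mult:
  assumes "F \<in> forms n d" "G \<in> forms n d'"
  shows "(\<lambda>v. F v * G v) \<in> forms n (d + d')"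
proof -
  obtain c c' where F: "F = (\<lambda>v. \<Sum>\<alpha>\<in>exponents n d. c \<alpha> * (\<Prod>i\<le>n. v i ^ \<alpha> i))"
    and G: "G = (\<lambda>v. \<Sum>\<alpha>\<in>exponents n d'. c' \<alpha> * (\<Prod>i\<le>n. v i ^ \<alpha> i))"
    using assms by (auto simp: forms_def)
  have FG: "(\<lambda>v. F v * G v) = (\<lambda>v. \<Sum>\<alpha>\<in>exponents n d. \<Sum>\<beta>\<in>exponents n d'.
      (c \<alpha> * c' \<beta>) * (\<Prod>i\<le>n. v i ^ (\<alpha> i + \<beta> i)))"
    unfolding F G sum_product by (simp add: power_add prod.distrib mult_ac)
  have "(\<lambda>i. \<alpha> i + \<beta> i) \<in> exponents n (d + d')" if "\<alpha> \<in> exponents n d" "\<beta> \<in> exponents n d'" for \<alpha> \<beta>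
    using that by (simp add: exponents_def sum.distrib)
  then show ?thesis unfolding FG by (intro forms_sum finite_exponents forms_monomial)
qed

lemma forms_const: "(\<lambda>v. c) \<in> forms n 0"
  using forms_monomial[of "\<lambda>_. 0" n 0 c] by (simp add: exponents_def)

lemma forms_coord:
  assumes "j \<le> n" shows "(\<lambda>v::nat \<Rightarrow> 'k::field. v j) \<in> forms n 1"
proof -
  let ?\<alpha> = "\<lambda>i. if i = j then 1 else 0::nat"
  have "(\<Prod>i\<le>n. v i ^ ?\<alpha> i) = v j" for v :: "nat \<Rightarrow> 'k"
  proof -
    have "(\<Prod>i\<le>n. v i ^ ?\<alpha> i) = (\<Prod>i\<le>n. if i = j then v i else 1)"
      by (rule prod.cong) auto
    also have "\<dots> = v j" using assms by simp
    finally show ?thesis .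
  qed
  moreover have "?\<alpha> \<in> exponents n 1" using assms by (auto simp: exponents_def)
  ultimately show ?thesis using forms_monomial[of ?\<alpha> n 1 "1::'k"] by (simp only: mult_1_left)
qed

lemma forms_power: "F \<in> forms n d \<Longrightarrow> (\<lambda>v. F v ^ m) \<in> forms n (m * d)"
  by (induction m) (auto intro: forms_const forms_mult)

lemma forms_prod:
  "finite A \<Longrightarrow> (\<And>a. a \<in> A \<Longrightarrow> F a \<in> forms n (d a)) \<Longrightarrow> (\<lambda>v. \<Prod>a\<in>A. F a v) \<in> forms n (\<Sum>a\<in>A. d a)"
  by (induction A rule: finite_induct) (auto intro: forms_const forms_mult)

lemma forms_homogeneous:
  assumes "F \<in> forms n d" shows "F (\<lambda>i. c * v i) = c ^ d * F v"
proof -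
  obtain a where F: "F = (\<lambda>v. \<Sum>\<alpha>\<in>exponents n d. a \<alpha> * (\<Prod>i\<le>n. v i ^ \<alpha> i))"
    using assms by (auto simp: forms_def)
  have "(\<Prod>i\<le>n. (c * v i) ^ \<alpha> i) = c ^ d * (\<Prod>i\<le>n. v i ^ \<alpha> i)" if "\<alpha> \<in> exponents n d" for \<alpha>
    using that by (auto simp: power_mult_distrib prod.distrib exponents_def power_sum)
  then show ?thesis unfolding F by (simp add: sum_distrib_left mult_ac)
qed

text \<open>
  Restricting to a line turns questions about forms into questions about polynomials in one variable.
\<close>

lemma forms_on_line:
  assumes "F \<in> forms n d" obtains P where "\<And>z. F (\<lambda>i. x i + z * w i) = poly P z"
proof -
  obtain a where F: "F = (\<lambda>v. \<Sum>\<alpha>\<in>exponents n d. a \<alpha> * (\<Prod>i\<le>n. v i ^ \<alpha> i))"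
    using assms by (auto simp: forms_def)
  show thesis
    by (rule that[of "\<Sum>\<alpha>\<in>exponents n d. smult (a \<alpha>) (\<Prod>i\<le>n. [:x i, w i:] ^ \<alpha> i)"])
      (simp add: F poly_sum poly_prod poly_power)
qed

section \<open>Points and open sets\<close>

lemma proj_pt_self: "v \<in> proj_pt v"
  by (auto simp: proj_pt_def intro: exI[of _ 1])

lemma proj_pt_scale:
  assumes "c \<noteq> 0" shows "proj_pt (\<lambda>i. c * v i) = proj_pt v"
proof (intro equalityI subsetI)
  fix u assume "u \<in> proj_pt (\<lambda>i. c * v i)"
  then obtain b where "b \<noteq> 0" "u = (\<lambda>i. b * (c * v i))" by (auto simp: proj_pt_def)
  then show "u \<in> proj_pt v" using assms by (auto simp: proj_pt_def intro!: exI[of _ "b * c"])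
next
  fix u assume "u \<in> proj_pt v"
  then obtain b where "b \<noteq> 0" "u = (\<lambda>i. b * v i)" by (auto simp: proj_pt_def)
  then show "u \<in> proj_pt (\<lambda>i. c * v i)" using assms by (auto simp: proj_pt_def intro!: exI[of _ "b / c"])
qed

lemma proj_ptE:
  assumes "v' \<in> proj_pt v" obtains c where "c \<noteq> 0" "v' = (\<lambda>i. c * v i)"
  using assms by (auto simp: proj_pt_def)

lemma proj_pt_eq: "v' \<in> proj_pt v \<Longrightarrow> proj_pt v' = proj_pt v"
  by (elim proj_ptE) (simp add: proj_pt_scale)

lemma coord_vecs_scale: "c \<noteq> 0 \<Longrightarrow> (\<lambda>i. c * v i) \<in> coord_vecs n \<longleftrightarrow> v \<in> coord_vecs n"
  by (simp add: coord_vecs_def)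

lemma proj_space_pt: "v \<in> coord_vecs n \<Longrightarrow> proj_pt v \<in> proj_space n"
  by (simp add: proj_space_def)

lemma proj_spaceE:
  assumes "p \<in> proj_space n" obtains v where "v \<in> coord_vecs n" "p = proj_pt v"
  using assms by (auto simp: proj_space_def)

lemma proj_space_mem:
  assumes "p \<in> proj_space n" "v \<in> p" shows "v \<in> coord_vecs n" "p = proj_pt v"
proof -
  obtain u where u: "u \<in> coord_vecs n" "p = proj_pt u" using assms(1) by (rule proj_spaceE)
  then have v: "v \<in> proj_pt u" using assms(2) by simp
  then show "v \<in> coord_vecs n" using u by (elim proj_ptE) (simp add: coord_vecs_scale)
  show "p = proj_pt v" using proj_pt_eq[OF v] u by simp
qed

lemma forms_nonzero_pt:
  assumes "F \<in> forms n d" shows "(\<forall>v'\<in>proj_pt v. F v' \<noteq> 0) \<longleftrightarrow> F v \<noteq> 0"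
  using proj_pt_self by (auto elim!: proj_ptE simp: forms_homogeneous[OF assms]) blast

lemma zariski_open_subset: "zariski_open n U \<Longrightarrow> U \<subseteq> proj_space n"
  by (auto simp: zariski_open_def)

text \<open>
  The nonvanishing loci of single forms are a basis of the topology. In this shape openness is a
  local condition, tested with one form at a time.
\<close>

lemma zariski_open_iff_basic:
  "zariski_open n U \<longleftrightarrow> U \<subseteq> proj_space n \<and>
     (\<forall>x\<in>coord_vecs n. proj_pt x \<in> U \<longrightarrow>
        (\<exists>d. \<exists>E\<in>forms n d. E x \<noteq> 0 \<and> (\<forall>v\<in>coord_vecs n. E v \<noteq> 0 \<longrightarrow> proj_pt v \<in> U)))"
  (is "?L \<longleftrightarrow> ?R")
proof
  assume L: ?L
  then obtain S where S: "S \<subseteq> (\<Union>d. forms n d)" and U: "U = {p \<in> proj_space n. \<exists>F\<in>S. \<forall>v\<in>p. F v \<noteq> 0}"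
    unfolding zariski_open_def by (elim exE conjE) (rule that)
  have "\<exists>d. \<exists>E\<in>forms n d. E x \<noteq> 0 \<and> (\<forall>v\<in>coord_vecs n. E v \<noteq> 0 \<longrightarrow> proj_pt v \<in> U)"
    if x: "x \<in> coord_vecs n" "proj_pt x \<in> U" for x
  proof -
    obtain E where E: "E \<in> S" "\<forall>v\<in>proj_pt x. E v \<noteq> 0" using x unfolding U by auto
    then obtain d where d: "E \<in> forms n d" using S by blast
    have "proj_pt v \<in> U" if "v \<in> coord_vecs n" "E v \<noteq> 0" for v
      using that E(1) forms_nonzero_pt[OF d, of v] unfolding U by (auto simp: proj_space_pt)
    then show ?thesis using d E proj_pt_self by blast
  qed
  then show ?R using zariski_open_subset[OF L] by blast
next
  assume R: ?R
  define S where "S = {E \<in> (\<Union>d. forms n d). \<forall>v\<in>coord_vecs n. E v \<noteq> 0 \<longrightarrow> proj_pt v \<in> U}"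
  have "U = {p \<in> proj_space n. \<exists>F\<in>S. \<forall>v\<in>p. F v \<noteq> 0}"
  proof (intro equalityI subsetI)
    fix p assume p: "p \<in> U"
    then obtain x where x: "x \<in> coord_vecs n" "p = proj_pt x" using R proj_spaceE by blast
    obtain d E where E: "E \<in> forms n d" "E x \<noteq> 0" "\<forall>v\<in>coord_vecs n. E v \<noteq> 0 \<longrightarrow> proj_pt v \<in> U"
      using R x p by meson
    have "E \<in> S" using E by (auto simp: S_def)
    then show "p \<in> {p \<in> proj_space n. \<exists>F\<in>S. \<forall>v\<in>p. F v \<noteq> 0}"
      using E(2) forms_nonzero_pt[OF E(1), of x] x by (auto simp: proj_space_pt)
  next
    fix p assume "p \<in> {p \<in> proj_space n. \<exists>F\<in>S. \<forall>v\<in>p. F v \<noteq> 0}"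
    then obtain F where F: "p \<in> proj_space n" "F \<in> S" "\<forall>v\<in>p. F v \<noteq> 0" by blast
    obtain x where x: "x \<in> coord_vecs n" "p = proj_pt x" using F(1) by (rule proj_spaceE)
    have "F x \<noteq> 0" using F x proj_pt_self by blast
    then show "p \<in> U" using F(2) x by (simp add: S_def)
  qed
  moreover have "S \<subseteq> (\<Union>d. forms n d)" by (auto simp: S_def)
  ultimately show ?L unfolding zariski_open_def by blast
qed

lemma zariski_open_nonvanishing:
  assumes "F \<in> forms n d" shows "zariski_open n {p \<in> proj_space n. \<forall>v\<in>p. F v \<noteq> 0}"
  using assms unfolding zariski_open_def by (intro exI[of _ "{F}"]) auto

lemma zariski_open_Int:
  assumes "zariski_open n U" "zariski_open n V" shows "zariski_open n (U \<inter> V)"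
  unfolding zariski_open_iff_basic
proof (intro conjI ballI impI)
  show "U \<inter> V \<subseteq> proj_space n" using zariski_open_subset[OF assms(1)] by blast
  fix x :: "nat \<Rightarrow> 'a" assume x: "x \<in> coord_vecs n" "proj_pt x \<in> U \<inter> V"
  obtain d E where E: "E \<in> forms n d" "E x \<noteq> 0" "\<forall>v\<in>coord_vecs n. E v \<noteq> 0 \<longrightarrow> proj_pt v \<in> U"
    using assms(1) x unfolding zariski_open_iff_basic by blast
  obtain d' E' where E': "E' \<in> forms n d'" "E' x \<noteq> 0" "\<forall>v\<in>coord_vecs n. E' v \<noteq> 0 \<longrightarrow> proj_pt v \<in> V"
    using assms(2) x unfolding zariski_open_iff_basic by blast
  show "\<exists>d. \<exists>E\<in>forms n d. E x \<noteq> 0 \<and> (\<forall>v\<in>coord_vecs n. E v \<noteq> 0 \<longrightarrow> proj_pt v \<in> U \<inter> V)"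
    using E E' forms_mult[OF E(1) E'(1)]
    by (intro exI[of _ "d + d'"] bexI[of _ "\<lambda>v. E v * E' v"]) auto
qed

text \<open>
  The predicate \<open>near n p\<close> plays the role that \<open>eventually\<close> has for the filter of Zariski
  neighbourhoods of \<open>p\<close>.
\<close>

definition near :: "nat \<Rightarrow> 'k::field pt \<Rightarrow> ('k pt \<Rightarrow> bool) \<Rightarrow> bool" where
  "near n p P \<longleftrightarrow> (\<exists>V. zariski_open n V \<and> p \<in> V \<and> (\<forall>q\<in>V. P q))"

lemma near_conj: "near n p P \<Longrightarrow> near n p Q \<Longrightarrow> near n p (\<lambda>q. P q \<and> Q q)"
  unfolding near_def by (meson IntD1 IntD2 IntI zariski_open_Int)

lemma near_mono: "near n p P \<Longrightarrow> (\<And>q. q \<in> proj_space n \<Longrightarrow> P q \<Longrightarrow> Q q) \<Longrightarrow> near n p Q"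
  unfolding near_def by (meson zariski_open_subset subsetD)

lemma near_open: "zariski_open n V \<Longrightarrow> p \<in> V \<Longrightarrow> near n p (\<lambda>q. q \<in> V)"
  unfolding near_def by blast

lemma nearD: "near n p P \<Longrightarrow> P p"
  unfolding near_def by blast

lemma near_basic:
  assumes "x \<in> coord_vecs n"
  shows "near n (proj_pt x) P \<longleftrightarrow>
    (\<exists>d. \<exists>E\<in>forms n d. E x \<noteq> 0 \<and> (\<forall>v\<in>coord_vecs n. E v \<noteq> 0 \<longrightarrow> P (proj_pt v)))"
proof
  assume "near n (proj_pt x) P"
  then obtain V where V: "zariski_open n V" "proj_pt x \<in> V" "\<forall>q\<in>V. P q" by (auto simp: near_def)
  obtain d E where E: "E \<in> forms n d" "E x \<noteq> 0" "\<forall>v\<in>coord_vecs n. E v \<noteq> 0 \<longrightarrow> proj_pt v \<in> V"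
    using V assms unfolding zariski_open_iff_basic by blast
  then show "\<exists>d. \<exists>E\<in>forms n d. E x \<noteq> 0 \<and> (\<forall>v\<in>coord_vecs n. E v \<noteq> 0 \<longrightarrow> P (proj_pt v))"
    using V(3) by blast
next
  assume "\<exists>d. \<exists>E\<in>forms n d. E x \<noteq> 0 \<and> (\<forall>v\<in>coord_vecs n. E v \<noteq> 0 \<longrightarrow> P (proj_pt v))"
  then obtain d E where E: "E \<in> forms n d" "E x \<noteq> 0" "\<forall>v\<in>coord_vecs n. E v \<noteq> 0 \<longrightarrow> P (proj_pt v)"
    by blast
  have "\<forall>q\<in>{p \<in> proj_space n. \<forall>v\<in>p. E v \<noteq> 0}. P q"
    using E(3) proj_pt_self by (auto elim!: proj_spaceE)
  then show "near n (proj_pt x) P"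
    using zariski_open_nonvanishing[OF E(1)] forms_nonzero_pt[OF E(1), of x] E(2) assms
    unfolding near_def by (intro exI[of _ "{p \<in> proj_space n. \<forall>v\<in>p. E v \<noteq> 0}"]) (auto simp: proj_space_pt)
qed

section \<open>Regular functions\<close>

text \<open>
  Multiplying numerator and denominator by a form that vanishes off the given neighbourhood makes the
  nonvanishing locus of the new denominator a suitable neighbourhood. No open set has to be carried
  along any more, only the two forms.
\<close>

lemma regular_atE:
  assumes "x \<in> coord_vecs n" "regular_at n (proj_pt x) h"
  obtains d F G where "F \<in> forms n d" "G \<in> forms n d" "G x \<noteq> 0"
    "\<And>v. v \<in> coord_vecs n \<Longrightarrow> G v \<noteq> 0 \<Longrightarrow> h (proj_pt v) = F v / G v"
proof -
  obtain V d F G where V: "zariski_open n V" "proj_pt x \<in> V" "F \<in> forms n d" "G \<in> forms n d"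
    "\<forall>q\<in>V. \<forall>v\<in>q. G v \<noteq> 0 \<and> h q = F v / G v" using assms(2) unfolding regular_at_def by blast
  obtain m E where E: "E \<in> forms n m" "E x \<noteq> 0" "\<forall>v\<in>coord_vecs n. E v \<noteq> 0 \<longrightarrow> proj_pt v \<in> V"
    using V assms unfolding zariski_open_iff_basic by blast
  show thesis
  proof (rule that)
    show "(\<lambda>v. F v * E v) \<in> forms n (d + m)" "(\<lambda>v. G v * E v) \<in> forms n (d + m)"
      using V E by (auto intro: forms_mult)
    show "G x * E x \<noteq> 0" using V(2,5) E proj_pt_self by fastforce
    fix v assume v: "v \<in> coord_vecs n" "G v * E v \<noteq> 0"
    then have "proj_pt v \<in> V" using E by auto
    then have "h (proj_pt v) = F v / G v" using V(5) proj_pt_self by blast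
    then show "h (proj_pt v) = (F v * E v) / (G v * E v)" using v by simp
  qed
qed

lemma regular_atI:
  assumes "x \<in> coord_vecs n" "F \<in> forms n d" "G \<in> forms n d" "G x \<noteq> 0"
    and h: "\<And>v. v \<in> coord_vecs n \<Longrightarrow> G v \<noteq> 0 \<Longrightarrow> h (proj_pt v) = F v / G v"
  shows "regular_at n (proj_pt x) h"
  unfolding regular_at_def
proof (intro exI bexI conjI ballI)
  show "zariski_open n {p \<in> proj_space n. \<forall>v\<in>p. G v \<noteq> 0}"
    by (rule zariski_open_nonvanishing[OF assms(3)])
  show "proj_pt x \<in> {p \<in> proj_space n. \<forall>v\<in>p. G v \<noteq> 0}"
    using forms_nonzero_pt[OF assms(3), of x] assms by (auto simp: proj_space_pt)
  fix q v assume q: "q \<in> {p \<in> proj_space n. \<forall>v\<in>p. G v \<noteq> 0}" "v \<in> q"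
  then show "G v \<noteq> 0" by blast
  then show "h q = F v / G v" using h[of v] q proj_space_mem[of q n v] by auto
qed (use assms in auto)

lemma regular_at_space: "regular_at n p h \<Longrightarrow> p \<in> proj_space n"
  unfolding regular_at_def by (meson zariski_open_subset subsetD)

lemma regular_at_near: "regular_at n p h \<Longrightarrow> near n p (\<lambda>q. regular_at n q h)"
  unfolding regular_at_def near_def by blast

lemma regular_at_cong:
  assumes "regular_at n p g" "near n p (\<lambda>q. h q = g q)" shows "regular_at n p h"
proof -
  obtain V d F G where V: "zariski_open n V" "p \<in> V" "F \<in> forms n d" "G \<in> forms n d"
    "\<forall>q\<in>V. \<forall>v\<in>q. G v \<noteq> 0 \<and> g q = F v / G v" using assms(1) unfolding regular_at_def by blast
  obtain W where W: "zariski_open n W" "p \<in> W" "\<forall>q\<in>W. h q = g q" using assms(2) by (auto simp: near_def)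
  show ?thesis unfolding regular_at_def
    using V W zariski_open_Int[OF V(1) W(1)]
    by (intro exI[of _ "V \<inter> W"] exI[of _ d] conjI bexI[of _ F] bexI[of _ G]) auto
qed

lemma regular_at_const:
  assumes "p \<in> proj_space n" shows "regular_at n p (\<lambda>q. c)"
proof -
  obtain x where "x \<in> coord_vecs n" "p = proj_pt x" using assms by (rule proj_spaceE)
  then show ?thesis using regular_atI[OF _ forms_const[of c n] forms_const[of 1 n]] by simp
qed

lemma regular_at_add:
  assumes "regular_at n p g" "regular_at n p h" shows "regular_at n p (\<lambda>q. g q + h q)"
proof -
  obtain x where x: "x \<in> coord_vecs n" "p = proj_pt x"
    using regular_at_space[OF assms(1)] by (rule proj_spaceE)
  obtain d F G where g: "F \<in> forms n d" "G \<in> forms n d" "G x \<noteq> 0"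
    "\<And>v. v \<in> coord_vecs n \<Longrightarrow> G v \<noteq> 0 \<Longrightarrow> g (proj_pt v) = F v / G v"
    by (rule regular_atE[OF x(1) assms(1)[unfolded x(2)]]) (rule that)
  obtain d' F' G' where h: "F' \<in> forms n d'" "G' \<in> forms n d'" "G' x \<noteq> 0"
    "\<And>v. v \<in> coord_vecs n \<Longrightarrow> G' v \<noteq> 0 \<Longrightarrow> h (proj_pt v) = F' v / G' v"
    by (rule regular_atE[OF x(1) assms(2)[unfolded x(2)]]) (rule that)
  have fm: "(\<lambda>v. F v * G' v + G v * F' v) \<in> forms n (d + d')" "(\<lambda>v. G v * G' v) \<in> forms n (d + d')"
    using g h by (auto intro: forms_add forms_mult)
  show ?thesis unfolding x(2)
    by (rule regular_atI[OF x(1) fm]) (use g h in \<open>auto simp: add_divide_distrib\<close>)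
qed

lemma regular_at_mult:
  assumes "regular_at n p g" "regular_at n p h" shows "regular_at n p (\<lambda>q. g q * h q)"
proof -
  obtain x where x: "x \<in> coord_vecs n" "p = proj_pt x"
    using regular_at_space[OF assms(1)] by (rule proj_spaceE)
  obtain d F G where g: "F \<in> forms n d" "G \<in> forms n d" "G x \<noteq> 0"
    "\<And>v. v \<in> coord_vecs n \<Longrightarrow> G v \<noteq> 0 \<Longrightarrow> g (proj_pt v) = F v / G v"
    by (rule regular_atE[OF x(1) assms(1)[unfolded x(2)]]) (rule that)
  obtain d' F' G' where h: "F' \<in> forms n d'" "G' \<in> forms n d'" "G' x \<noteq> 0"
    "\<And>v. v \<in> coord_vecs n \<Longrightarrow> G' v \<noteq> 0 \<Longrightarrow> h (proj_pt v) = F' v / G' v"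
    by (rule regular_atE[OF x(1) assms(2)[unfolded x(2)]]) (rule that)
  have fm: "(\<lambda>v. F v * F' v) \<in> forms n (d + d')" "(\<lambda>v. G v * G' v) \<in> forms n (d + d')"
    using g h by (auto intro: forms_mult)
  show ?thesis unfolding x(2) by (rule regular_atI[OF x(1) fm]) (use g h in auto)
qed

lemma regular_at_inverse:
  assumes "regular_at n p h" "h p \<noteq> 0" shows "regular_at n p (\<lambda>q. 1 / h q)"
proof -
  obtain x where x: "x \<in> coord_vecs n" "p = proj_pt x"
    using regular_at_space[OF assms(1)] by (rule proj_spaceE)
  obtain d F G where h: "F \<in> forms n d" "G \<in> forms n d" "G x \<noteq> 0"
    "\<And>v. v \<in> coord_vecs n \<Longrightarrow> G v \<noteq> 0 \<Longrightarrow> h (proj_pt v) = F v / G v"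
    by (rule regular_atE[OF x(1) assms(1)[unfolded x(2)]]) (rule that)
  have Fx: "F x \<noteq> 0" using h x assms(2) by auto
  have fm: "(\<lambda>v. G v * G v) \<in> forms n (d + d)" "(\<lambda>v. F v * G v) \<in> forms n (d + d)"
    using h by (auto intro: forms_mult)
  show ?thesis unfolding x(2) by (rule regular_atI[OF x(1) fm]) (use Fx h in auto)
qed

lemma regular_at_nonzero_near:
  assumes "regular_at n p h" "h p \<noteq> 0" shows "near n p (\<lambda>q. h q \<noteq> 0)"
proof -
  obtain x where x: "x \<in> coord_vecs n" "p = proj_pt x"
    using regular_at_space[OF assms(1)] by (rule proj_spaceE)
  obtain d F G where h: "F \<in> forms n d" "G \<in> forms n d" "G x \<noteq> 0"
    "\<And>v. v \<in> coord_vecs n \<Longrightarrow> G v \<noteq> 0 \<Longrightarrow> h (proj_pt v) = F v / G v"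
    by (rule regular_atE[OF x(1) assms(1)[unfolded x(2)]]) (rule that)
  have "F x \<noteq> 0" using h x assms(2) by auto
  then show ?thesis unfolding x(2) near_basic[OF x(1)] using h forms_mult[OF h(1,2)]
    by (intro exI[of _ "d + d"] bexI[of _ "\<lambda>v. F v * G v"]) auto
qed

lemma regular_at_diff:
  assumes "regular_at n p g" "regular_at n p h" shows "regular_at n p (\<lambda>q. g q - h q)"
  using regular_at_add[OF assms(1) regular_at_mult[OF regular_at_const[OF regular_at_space[OF assms(2)], of "-1"] assms(2)]]
  by simp

lemma regular_at_divide:
  assumes "regular_at n p g" "regular_at n p h" "h p \<noteq> 0" shows "regular_at n p (\<lambda>q. g q / h q)"
  using regular_at_mult[OF assms(1) regular_at_inverse[OF assms(2,3)]] by simp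

lemma regular_at_power: "regular_at n p h \<Longrightarrow> regular_at n p (\<lambda>q. h q ^ m)"
  by (induction m) (auto intro: regular_at_mult regular_at_const regular_at_space)

lemma regular_at_sum:
  assumes "p \<in> proj_space n" "finite A" "\<And>a. a \<in> A \<Longrightarrow> regular_at n p (h a)"
  shows "regular_at n p (\<lambda>q. \<Sum>a\<in>A. h a q)"
  using assms(2,3)
  by (induction A rule: finite_induct) (simp_all add: regular_at_const[OF assms(1)] regular_at_add)

text \<open>
  The affine coordinate \<open>x\<^sub>l / x\<^sub>j\<close>; the next lemma shows that the choice of homogeneous coordinates
  has no influence.
\<close>

definition ratio :: "nat \<Rightarrow> nat \<Rightarrow> 'k::field pt \<Rightarrow> 'k" where
  "ratio l j q = (SOME v. v \<in> q) l / (SOME v. v \<in> q) j"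

lemma ratio_proj_pt [simp]: "ratio l j (proj_pt v) = v l / v j"
proof -
  have "(SOME v'. v' \<in> proj_pt v) \<in> proj_pt v" using someI[of "\<lambda>v'. v' \<in> proj_pt v"] proj_pt_self by blast
  then obtain c where "c \<noteq> 0" "(SOME v'. v' \<in> proj_pt v) = (\<lambda>i. c * v i)" by (rule proj_ptE)
  then show ?thesis by (simp add: ratio_def)
qed

lemma regular_at_ratio:
  assumes "x \<in> coord_vecs n" "j \<le> n" "x j \<noteq> 0" "l \<le> n"
  shows "regular_at n (proj_pt x) (ratio l j)"
  using assms forms_coord[of j n] forms_coord[of l n] by (intro regular_atI) auto

lemma near_coord_nonzero:
  assumes "x \<in> coord_vecs n" "j \<le> n" "x j \<noteq> 0"
  shows "near n (proj_pt x) (\<lambda>q. \<forall>v\<in>q. v j \<noteq> 0)"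
  using assms forms_coord[of j n] forms_nonzero_pt[OF forms_coord[of j n]]
  by (auto simp: near_basic intro!: exI[of _ 1] bexI[of _ "\<lambda>v. v j"])

text \<open>
  Dividing numerator and denominator by a power of \<open>x\<^sub>j\<close> shows that the local ring at a point with
  \<open>x\<^sub>j \<noteq> 0\<close> arises from the constants and the ratios \<open>x\<^sub>l / x\<^sub>j\<close> by sums, products and quotients. Whatever
  obeys rules for these operations, such as a derivation, is controlled by the ratios.
\<close>

lemma regular_at_induct:
  fixes h :: "'k::field pt \<Rightarrow> 'k"
  assumes x: "x \<in> coord_vecs n" "j \<le> n" "x j \<noteq> 0" and h: "regular_at n (proj_pt x) h"
    and const: "\<And>c. P (\<lambda>q. c)"
    and ratio: "\<And>l. l \<le> n \<Longrightarrow> P (ratio l j)"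
    and add: "\<And>g h. regular_at n (proj_pt x) g \<Longrightarrow> P g \<Longrightarrow> regular_at n (proj_pt x) h \<Longrightarrow> P h \<Longrightarrow>
       P (\<lambda>q. g q + h q)"
    and mult: "\<And>g h. regular_at n (proj_pt x) g \<Longrightarrow> P g \<Longrightarrow> regular_at n (proj_pt x) h \<Longrightarrow> P h \<Longrightarrow>
       P (\<lambda>q. g q * h q)"
    and quot: "\<And>a b h. regular_at n (proj_pt x) a \<Longrightarrow> P a \<Longrightarrow> regular_at n (proj_pt x) b \<Longrightarrow> P b \<Longrightarrow>
       regular_at n (proj_pt x) h \<Longrightarrow> b (proj_pt x) \<noteq> 0 \<Longrightarrow>
       near n (proj_pt x) (\<lambda>q. b q * h q = a q) \<Longrightarrow> P h"
  shows "P h"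
proof -
  let ?R = "\<lambda>h. regular_at n (proj_pt x) h \<and> P h"
  have R_const: "?R (\<lambda>q. c)" for c using const x by (simp add: regular_at_const proj_space_pt)
  have R_add: "?R (\<lambda>q. g q + h q)" if "?R g" "?R h" for g h
    using that add by (auto intro: regular_at_add)
  have R_mult: "?R (\<lambda>q. g q * h q)" if "?R g" "?R h" for g h
    using that mult by (auto intro: regular_at_mult)
  have R_ratio: "?R (ratio l j)" if "l \<le> n" for l using that ratio x by (auto intro: regular_at_ratio)
  have R_power: "?R (\<lambda>q. g q ^ m)" if g: "?R g" for g m
  proof (induction m)
    case 0 show ?case using R_const[of 1] by simp
  next
    case (Suc m) show ?case using R_mult[OF g Suc] by simp
  qed
  have R_prod: "?R (\<lambda>q. \<Prod>i\<in>A. g i q)" if "finite A" "\<And>i. i \<in> A \<Longrightarrow> ?R (g i)" for A :: "nat set" and g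
    using that
  proof (induction A rule: finite_induct)
    case empty show ?case using R_const[of 1] by simp
  next
    case (insert i A)
    show ?case using R_mult[OF insert.prems[of i] insert.IH] insert by simp
  qed
  have R_sum: "?R (\<lambda>q. \<Sum>i\<in>A. g i q)" if "finite A" "\<And>i. i \<in> A \<Longrightarrow> ?R (g i)" for A :: "(nat \<Rightarrow> nat) set" and g
    using that
  proof (induction A rule: finite_induct)
    case empty show ?case using R_const[of 0] by simp
  next
    case (insert i A)
    show ?case using R_add[OF insert.prems[of i] insert.IH] insert by simp
  qed
  \<comment> \<open>The dehomogenisation of a form is a polynomial in the ratios.\<close>
  have dehom: "\<exists>a. ?R a \<and> (\<forall>v. v j \<noteq> 0 \<longrightarrow> a (proj_pt v) = F v / v j ^ d)" if F: "F \<in> forms n d" for F d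
  proof -
    obtain c where c: "F = (\<lambda>v. \<Sum>\<alpha>\<in>exponents n d. c \<alpha> * (\<Prod>i\<le>n. v i ^ \<alpha> i))"
      using F by (auto simp: forms_def)
    let ?a = "\<lambda>q. \<Sum>\<alpha>\<in>exponents n d. c \<alpha> * (\<Prod>i\<in>{..n}. ratio i j q ^ \<alpha> i)"
    have "?R ?a" by (intro R_sum R_mult R_const R_prod R_power R_ratio finite_exponents) auto
    moreover have "?a (proj_pt v) = F v / v j ^ d" for v
    proof -
      have "(\<Prod>i\<le>n. (v i / v j) ^ \<alpha> i) = (\<Prod>i\<le>n. v i ^ \<alpha> i) / v j ^ d" if "\<alpha> \<in> exponents n d" for \<alpha>
        using that by (auto simp: power_divide prod_dividef exponents_def power_sum)
      then show ?thesis unfolding c by (simp add: sum_divide_distrib)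
    qed
    ultimately show ?thesis by blast
  qed
  obtain d F G where FG: "F \<in> forms n d" "G \<in> forms n d" "G x \<noteq> 0"
    "\<And>v. v \<in> coord_vecs n \<Longrightarrow> G v \<noteq> 0 \<Longrightarrow> h (proj_pt v) = F v / G v"
    by (rule regular_atE[OF x(1) h]) (rule that)
  obtain a where a: "?R a" "\<forall>v. v j \<noteq> 0 \<longrightarrow> a (proj_pt v) = F v / v j ^ d" using dehom[OF FG(1)] by blast
  obtain b where b: "?R b" "\<forall>v. v j \<noteq> 0 \<longrightarrow> b (proj_pt v) = G v / v j ^ d" using dehom[OF FG(2)] by blast
  have "near n (proj_pt x) (\<lambda>q. b q * h q = a q)" unfolding near_basic[OF x(1)]
  proof (intro exI bexI conjI ballI impI)
    show "(\<lambda>v. G v * v j) \<in> forms n (d + 1)" using FG forms_coord[OF x(2)] by (intro forms_mult) auto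
    show "G x * x j \<noteq> 0" using FG x by simp
    fix v assume "v \<in> coord_vecs n" "G v * v j \<noteq> 0"
    then show "b (proj_pt v) * h (proj_pt v) = a (proj_pt v)" using a b FG by auto
  qed
  moreover have "b (proj_pt x) \<noteq> 0" using b x FG by simp
  ultimately show ?thesis using a b h quot by blast
qed

section \<open>Tangent vectors as derivations\<close>

context
  fixes n :: nat and p :: "'k::field_char_0 pt" and \<delta> :: "'k tvec"
  assumes \<delta>: "\<delta> \<in> tangent_space n p"
begin

lemma tangent_nonregular: "\<not> regular_at n p h \<Longrightarrow> \<delta> h = 0"
  using \<delta> by (simp add: tangent_space_def)

lemma tangent_near_eq:
  assumes "regular_at n p h" "near n p (\<lambda>q. g q = h q)" shows "\<delta> g = \<delta> h"
  using \<delta> assms(2) regular_at_cong[OF assms] assms(1) unfolding tangent_space_def near_def by blast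

lemma tangent_add:
  "regular_at n p g \<Longrightarrow> regular_at n p h \<Longrightarrow> \<delta> (\<lambda>q. g q + h q) = \<delta> g + \<delta> h"
  using \<delta> by (simp add: tangent_space_def)

lemma tangent_mult:
  "regular_at n p g \<Longrightarrow> regular_at n p h \<Longrightarrow> \<delta> (\<lambda>q. g q * h q) = g p * \<delta> h + h p * \<delta> g"
  using \<delta> by (simp add: tangent_space_def)

lemma tangent_scale: "regular_at n p h \<Longrightarrow> \<delta> (\<lambda>q. c * h q) = c * \<delta> h"
  using \<delta> by (simp add: tangent_space_def)

lemma tangent_const: "\<delta> (\<lambda>q. c) = 0"
proof (cases "p \<in> proj_space n")
  case True
  have r: "regular_at n p (\<lambda>q. 1)" using True by (rule regular_at_const)
  have "\<delta> (\<lambda>q. 1) = 0" using tangent_mult[OF r r] by simp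
  then show ?thesis using tangent_scale[OF r, of c] by simp
next
  case False
  then show ?thesis using tangent_nonregular regular_at_space by blast
qed

lemma tangent_power:
  assumes "regular_at n p h" shows "\<delta> (\<lambda>q. h q ^ m) = of_nat m * h p ^ (m - 1) * \<delta> h"
proof (induction m)
  case 0 show ?case using tangent_const[of 1] by simp
next
  case (Suc m)
  have "\<delta> (\<lambda>q. h q ^ Suc m) = h p * \<delta> (\<lambda>q. h q ^ m) + h p ^ m * \<delta> h"
    using tangent_mult[OF assms regular_at_power[OF assms, of m]] by simp
  also have "\<dots> = of_nat (Suc m) * h p ^ m * \<delta> h"
    unfolding Suc by (cases m) (simp_all add: algebra_simps)
  finally show ?case by simp
qed

lemma tangent_quotient:
  assumes "regular_at n p a" "regular_at n p b" "regular_at n p h" "b p \<noteq> 0"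
    and "near n p (\<lambda>q. b q * h q = a q)"
  shows "\<delta> h = (\<delta> a - h p * \<delta> b) / b p"
proof -
  have "\<delta> (\<lambda>q. b q * h q) = \<delta> a" by (rule tangent_near_eq) (use assms in auto)
  then show ?thesis using tangent_mult[OF assms(2,3)] assms(4) by (simp add: field_simps)
qed

end

lemma tangent_spaceI:
  assumes "\<And>h. \<not> regular_at n p h \<Longrightarrow> \<delta> h = 0"
    and "\<And>g h. regular_at n p g \<Longrightarrow> regular_at n p h \<Longrightarrow> near n p (\<lambda>q. g q = h q) \<Longrightarrow> \<delta> g = \<delta> h"
    and "\<And>g h. regular_at n p g \<Longrightarrow> regular_at n p h \<Longrightarrow> \<delta> (\<lambda>q. g q + h q) = \<delta> g + \<delta> h"
    and "\<And>g h. regular_at n p g \<Longrightarrow> regular_at n p h \<Longrightarrow> \<delta> (\<lambda>q. g q * h q) = g p * \<delta> h + h p * \<delta> g"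
    and "\<And>c h. regular_at n p h \<Longrightarrow> \<delta> (\<lambda>q. c * h q) = c * \<delta> h"
  shows "\<delta> \<in> tangent_space n p"
  unfolding tangent_space_def mem_Collect_eq using assms unfolding near_def by blast

lemma tangent_space_add:
  assumes \<delta>: "\<delta> \<in> tangent_space n (p :: 'k::field_char_0 pt)" and \<epsilon>: "\<epsilon> \<in> tangent_space n p"
  shows "(\<lambda>h. \<delta> h + \<epsilon> h) \<in> tangent_space n p"
proof (rule tangent_spaceI, goal_cases)
  case (2 g h)
  then show ?case using tangent_near_eq[OF \<delta>, of h g] tangent_near_eq[OF \<epsilon>, of h g] by simp
qed (simp_all add: tangent_nonregular[OF \<delta>] tangent_nonregular[OF \<epsilon>] tangent_add[OF \<delta>] tangent_add[OF \<epsilon>]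
    tangent_mult[OF \<delta>] tangent_mult[OF \<epsilon>] tangent_scale[OF \<delta>] tangent_scale[OF \<epsilon>] algebra_simps)

lemma tangent_space_scale:
  assumes \<delta>: "\<delta> \<in> tangent_space n (p :: 'k::field_char_0 pt)"
  shows "(\<lambda>h. c * \<delta> h) \<in> tangent_space n p"
proof (rule tangent_spaceI, goal_cases)
  case (2 g h)
  then show ?case using tangent_near_eq[OF \<delta>, of h g] by simp
qed (simp_all add: tangent_nonregular[OF \<delta>] tangent_add[OF \<delta>] tangent_mult[OF \<delta>]
    tangent_scale[OF \<delta>] algebra_simps)

text \<open>
  By the Leibniz rule and the quotient rule the functions on which two tangent vectors agree are closed
  under the operations of the local ring, which the ratios generate.
\<close>

lemma tangent_space_eqI:
  fixes x :: "'k::field_char_0 vec"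
  assumes \<delta>: "\<delta> \<in> tangent_space n (proj_pt x)" and \<epsilon>: "\<epsilon> \<in> tangent_space n (proj_pt x)"
    and x: "x \<in> coord_vecs n" "j \<le> n" "x j \<noteq> 0"
    and eq: "\<And>l. l \<le> n \<Longrightarrow> \<delta> (ratio l j) = \<epsilon> (ratio l j)"
  shows "\<delta> = \<epsilon>"
proof
  fix h
  show "\<delta> h = \<epsilon> h"
  proof (cases "regular_at n (proj_pt x) h")
    case True
    show ?thesis
    proof (rule regular_at_induct[OF x True, where P = "\<lambda>h. \<delta> h = \<epsilon> h"], goal_cases)
      case (1 c) show ?case using tangent_const[OF \<delta>] tangent_const[OF \<epsilon>] by simp
    next
      case (2 l) then show ?case by (rule eq)
    next
      case (3 g h) then show ?case by (simp add: tangent_add[OF \<delta>] tangent_add[OF \<epsilon>])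
    next
      case (4 g h) then show ?case by (simp add: tangent_mult[OF \<delta>] tangent_mult[OF \<epsilon>])
    next
      case (5 a b h) then show ?case by (simp add: tangent_quotient[OF \<delta>, of a b h] tangent_quotient[OF \<epsilon>, of a b h])
    qed
  next
    case False
    then show ?thesis using tangent_nonregular[OF \<delta>] tangent_nonregular[OF \<epsilon>] by simp
  qed
qed

section \<open>Derivatives along lines\<close>

text \<open>
  On the line \<open>z \<mapsto> x + z w\<close> the function \<open>h\<close> is the fraction \<open>P / Q\<close>, and \<open>d\<close> is the derivative of
  that fraction at \<open>0\<close>. The finitely many points where \<open>h\<close> might differ from the fraction can be put
  among the zeros of \<open>Q\<close>, which is what the next lemma does.
\<close>

definition line_deriv :: "'k::field vec \<Rightarrow> 'k vec \<Rightarrow> ('k pt \<Rightarrow> 'k) \<Rightarrow> 'k \<Rightarrow> bool" where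
  "line_deriv x w h d \<longleftrightarrow> (\<exists>P Q. poly Q 0 \<noteq> 0 \<and>
     (\<forall>z. poly Q z \<noteq> 0 \<longrightarrow> h (proj_pt (\<lambda>i. x i + z * w i)) = poly P z / poly Q z) \<and>
     d = (poly (pderiv P) 0 * poly Q 0 - poly P 0 * poly (pderiv Q) 0) / poly Q 0 ^ 2)"

lemma line_derivI:
  assumes Q: "poly Q 0 \<noteq> 0" and E: "poly E 0 \<noteq> 0"
    and h: "\<And>z. poly E z \<noteq> 0 \<Longrightarrow> poly Q z \<noteq> 0 \<Longrightarrow> h (proj_pt (\<lambda>i. x i + z * w i)) = poly P z / poly Q z"
    and d: "d = (poly (pderiv P) 0 * poly Q 0 - poly P 0 * poly (pderiv Q) 0) / poly Q 0 ^ 2"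
  shows "line_deriv x w h d"
  unfolding line_deriv_def
proof (intro exI conjI allI impI)
  show "poly (Q * E) 0 \<noteq> 0" using Q E by simp
  show "h (proj_pt (\<lambda>i. x i + z * w i)) = poly (P * E) z / poly (Q * E) z" if "poly (Q * E) z \<noteq> 0" for z
    using that h[of z] by simp
  show "d = (poly (pderiv (P * E)) 0 * poly (Q * E) 0 - poly (P * E) 0 * poly (pderiv (Q * E)) 0)
      / poly (Q * E) 0 ^ 2"
    using Q E unfolding d by (simp add: pderiv_mult field_simps power2_eq_square)
qed

text \<open>
  Two fractions that agree at all but finitely many points of an infinite field are equal as fractions
  of polynomials, so they have the same derivative.
\<close>

lemma line_deriv_unique:
  fixes x :: "'k::field_char_0 vec"
  assumes "line_deriv x w h d" "line_deriv x w h d'" shows "d = d'"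
proof -
  obtain P Q where 1: "poly Q 0 \<noteq> 0"
    "\<And>z. poly Q z \<noteq> 0 \<Longrightarrow> h (proj_pt (\<lambda>i. x i + z * w i)) = poly P z / poly Q z"
    "d = (poly (pderiv P) 0 * poly Q 0 - poly P 0 * poly (pderiv Q) 0) / poly Q 0 ^ 2"
    using assms(1) by (auto simp: line_deriv_def)
  obtain R S where 2: "poly S 0 \<noteq> 0"
    "\<And>z. poly S z \<noteq> 0 \<Longrightarrow> h (proj_pt (\<lambda>i. x i + z * w i)) = poly R z / poly S z"
    "d' = (poly (pderiv R) 0 * poly S 0 - poly R 0 * poly (pderiv S) 0) / poly S 0 ^ 2"
    using assms(2) by (auto simp: line_deriv_def)
  have "poly ((P * S - R * Q) * (Q * S)) z = 0" for z
    using 1(2)[of z] 2(2)[of z] by (cases "poly Q z = 0"; cases "poly S z = 0") (auto simp: field_simps)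
  then have "(P * S - R * Q) * (Q * S) = 0" using poly_all_0_iff_0 by blast
  moreover have "Q \<noteq> 0" "S \<noteq> 0" using 1(1) 2(1) by auto
  ultimately have eq: "P * S = R * Q" by simp
  have v: "poly P 0 * poly S 0 = poly R 0 * poly Q 0" using arg_cong[OF eq, of "\<lambda>F. poly F 0"] by simp
  have "poly (pderiv (P * S)) 0 = poly (pderiv (R * Q)) 0" using eq by simp
  then have dv: "poly P 0 * poly (pderiv S) 0 + poly S 0 * poly (pderiv P) 0
      = poly R 0 * poly (pderiv Q) 0 + poly Q 0 * poly (pderiv R) 0" by (simp add: pderiv_mult)
  define p q r s where pq: "p = poly P 0" "q = poly Q 0" "r = poly R 0" "s = poly S 0"
  define p' q' r' s' where pq': "p' = poly (pderiv P) 0" "q' = poly (pderiv Q) 0"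
    "r' = poly (pderiv R) 0" "s' = poly (pderiv S) 0"
  have q: "q \<noteq> 0" "s \<noteq> 0" using 1 2 pq by auto
  have pv: "p = r * q / s" using v q unfolding pq by (simp add: field_simps)
  have "p * s' + s * p' = r * q' + q * r'" using dv unfolding pq pq' by simp
  then have p'v: "p' = (r * q' + q * r' - p * s') / s" using q by (simp add: field_simps)
  have "(p' * q - p * q') / q ^ 2 = (r' * s - r * s') / s ^ 2"
    unfolding p'v pv using q by (simp add: field_simps power2_eq_square)
  then show ?thesis using 1(3) 2(3) unfolding pq pq' by simp
qed

text \<open>
  A Zariski neighbourhood of \<open>x\<close> contains all but finitely many points of each line through \<open>x\<close>. The
  factor \<open>x\<^sub>j + z w\<^sub>j\<close> in the witness excludes the value of \<open>z\<close> at which \<open>x + z w\<close> could be the zero vector.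
\<close>

lemma near_on_line:
  assumes x: "x \<in> coord_vecs n" and w: "\<forall>i>n. w i = 0" and near: "near n (proj_pt x) R"
  obtains E where "poly E 0 \<noteq> 0" "\<And>z. poly E z \<noteq> 0 \<Longrightarrow> R (proj_pt (\<lambda>i. x i + z * w i))"
proof -
  obtain d E where E: "E \<in> forms n d" "E x \<noteq> 0" "\<forall>v\<in>coord_vecs n. E v \<noteq> 0 \<longrightarrow> R (proj_pt v)"
    using near x by (auto simp: near_basic)
  obtain j where j: "j \<le> n" "x j \<noteq> 0" using x by (auto simp: coord_vecs_def)
  obtain P where P: "\<And>z. E (\<lambda>i. x i + z * w i) = poly P z" by (rule forms_on_line[OF E(1)]) (rule that)
  show thesis
  proof (rule that)
    show "poly (P * [:x j, w j:]) 0 \<noteq> 0" using P[of 0] E j by simp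
    fix z assume z: "poly (P * [:x j, w j:]) z \<noteq> 0"
    have "x j + z * w j \<noteq> 0" using z unfolding poly_mult by auto
    then have "(\<lambda>i. x i + z * w i) \<in> coord_vecs n"
      using x w j unfolding coord_vecs_def by auto
    then show "R (proj_pt (\<lambda>i. x i + z * w i))" using E(3) P[of z] z by auto
  qed
qed

lemma line_deriv_exists:
  assumes x: "x \<in> coord_vecs n" and w: "\<forall>i>n. w i = 0" and h: "regular_at n (proj_pt x) h"
  shows "\<exists>d. line_deriv x w h d"
proof -
  obtain d F G where FG: "F \<in> forms n d" "G \<in> forms n d" "G x \<noteq> 0"
    "\<And>v. v \<in> coord_vecs n \<Longrightarrow> G v \<noteq> 0 \<Longrightarrow> h (proj_pt v) = F v / G v"
    by (rule regular_atE[OF x h]) (rule that)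
  obtain j where j: "j \<le> n" "x j \<noteq> 0" using x by (auto simp: coord_vecs_def)
  obtain P where P: "\<And>z. F (\<lambda>i. x i + z * w i) = poly P z" by (rule forms_on_line[OF FG(1)]) (rule that)
  obtain Q where Q: "\<And>z. G (\<lambda>i. x i + z * w i) = poly Q z" by (rule forms_on_line[OF FG(2)]) (rule that)
  have c: "(\<lambda>i. x i + z * w i) \<in> coord_vecs n" if "poly [:x j, w j:] z \<noteq> 0" for z
    using x w j that by (auto simp: coord_vecs_def)
  have "line_deriv x w h ((poly (pderiv P) 0 * poly Q 0 - poly P 0 * poly (pderiv Q) 0) / poly Q 0 ^ 2)"
    by (rule line_derivI[of Q "[:x j, w j:]"])
      (use j FG(3,4) c P Q Q[of 0] in auto)
  then show ?thesis by blast
qed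

lemma line_deriv_add:
  assumes "line_deriv x w g a" "line_deriv x w h b" shows "line_deriv x w (\<lambda>q. g q + h q) (a + b)"
proof -
  obtain P Q where 1: "poly Q 0 \<noteq> 0"
    "\<And>z. poly Q z \<noteq> 0 \<Longrightarrow> g (proj_pt (\<lambda>i. x i + z * w i)) = poly P z / poly Q z"
    "a = (poly (pderiv P) 0 * poly Q 0 - poly P 0 * poly (pderiv Q) 0) / poly Q 0 ^ 2"
    using assms(1) by (auto simp: line_deriv_def)
  obtain R S where 2: "poly S 0 \<noteq> 0"
    "\<And>z. poly S z \<noteq> 0 \<Longrightarrow> h (proj_pt (\<lambda>i. x i + z * w i)) = poly R z / poly S z"
    "b = (poly (pderiv R) 0 * poly S 0 - poly R 0 * poly (pderiv S) 0) / poly S 0 ^ 2"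
    using assms(2) by (auto simp: line_deriv_def)
  show ?thesis
  proof (rule line_derivI[of "Q * S" 1 _ _ _ "P * S + R * Q"])
    show "a + b = (poly (pderiv (P * S + R * Q)) 0 * poly (Q * S) 0
        - poly (P * S + R * Q) 0 * poly (pderiv (Q * S)) 0) / poly (Q * S) 0 ^ 2"
      unfolding 1(3) 2(3) using 1(1) 2(1)
      by (simp add: pderiv_mult pderiv_add divide_simps) (simp add: algebra_simps power2_eq_square)
  qed (use 1 2 in \<open>auto simp: add_divide_distrib\<close>)
qed

lemma line_deriv_mult:
  assumes "line_deriv x w g a" "line_deriv x w h b"
  shows "line_deriv x w (\<lambda>q. g q * h q) (g (proj_pt x) * b + h (proj_pt x) * a)"
proof -
  obtain P Q where 1: "poly Q 0 \<noteq> 0"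
    "\<And>z. poly Q z \<noteq> 0 \<Longrightarrow> g (proj_pt (\<lambda>i. x i + z * w i)) = poly P z / poly Q z"
    "a = (poly (pderiv P) 0 * poly Q 0 - poly P 0 * poly (pderiv Q) 0) / poly Q 0 ^ 2"
    using assms(1) by (auto simp: line_deriv_def)
  obtain R S where 2: "poly S 0 \<noteq> 0"
    "\<And>z. poly S z \<noteq> 0 \<Longrightarrow> h (proj_pt (\<lambda>i. x i + z * w i)) = poly R z / poly S z"
    "b = (poly (pderiv R) 0 * poly S 0 - poly R 0 * poly (pderiv S) 0) / poly S 0 ^ 2"
    using assms(2) by (auto simp: line_deriv_def)
  have gh: "g (proj_pt x) = poly P 0 / poly Q 0" "h (proj_pt x) = poly R 0 / poly S 0"
    using 1(1) 1(2)[of 0] 2(1) 2(2)[of 0] by auto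
  show ?thesis
  proof (rule line_derivI[of "Q * S" 1 _ _ _ "P * R"])
    show "g (proj_pt x) * b + h (proj_pt x) * a = (poly (pderiv (P * R)) 0 * poly (Q * S) 0
        - poly (P * R) 0 * poly (pderiv (Q * S)) 0) / poly (Q * S) 0 ^ 2"
      unfolding gh 1(3) 2(3) using 1(1) 2(1)
      by (simp add: pderiv_mult divide_simps) (simp add: algebra_simps power2_eq_square)
  qed (use 1 2 in auto)
qed

lemma line_deriv_const: "line_deriv x w (\<lambda>q. c) 0"
  by (rule line_derivI[of 1 1 _ _ _ "[:c:]"]) auto

lemma line_deriv_ratio:
  assumes "x j \<noteq> 0" shows "line_deriv x w (ratio l j) ((w l * x j - x l * w j) / x j ^ 2)"
  by (rule line_derivI[of "[:x j, w j:]" 1 _ _ _ "[:x l, w l:]"])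
    (use assms in \<open>auto simp: pderiv_pCons\<close>)

lemma line_deriv_cong:
  assumes x: "x \<in> coord_vecs n" and w: "\<forall>i>n. w i = 0"
    and near: "near n (proj_pt x) (\<lambda>q. g q = h q)" and h: "line_deriv x w h d"
  shows "line_deriv x w g d"
proof -
  obtain E where E: "poly E 0 \<noteq> 0"
    "\<And>z. poly E z \<noteq> 0 \<Longrightarrow> g (proj_pt (\<lambda>i. x i + z * w i)) = h (proj_pt (\<lambda>i. x i + z * w i))"
    by (rule near_on_line[OF x w near]) (rule that)
  obtain P Q where 1: "poly Q 0 \<noteq> 0"
    "\<And>z. poly Q z \<noteq> 0 \<Longrightarrow> h (proj_pt (\<lambda>i. x i + z * w i)) = poly P z / poly Q z"
    "d = (poly (pderiv P) 0 * poly Q 0 - poly P 0 * poly (pderiv Q) 0) / poly Q 0 ^ 2"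
    using h by (auto simp: line_deriv_def)
  show ?thesis by (rule line_derivI[of Q E _ _ _ P]) (use 1 E in auto)
qed

text \<open>
  The map \<open>w \<mapsto> dir_deriv n x w\<close> is the surjection from \<open>k^(n+1)\<close> to the tangent space in the Euler
  sequence. The lemmas \<open>tangent_eq_dir_deriv\<close> and \<open>dir_deriv_eqD\<close> give its surjectivity and its kernel,
  the multiples of \<open>x\<close>.
\<close>

definition dir_deriv :: "nat \<Rightarrow> 'k::field vec \<Rightarrow> 'k vec \<Rightarrow> 'k tvec" where
  "dir_deriv n x w h = (if regular_at n (proj_pt x) h then THE d. line_deriv x w h d else 0)"

context
  fixes n :: nat and x w :: "'k::field_char_0 vec"
  assumes x: "x \<in> coord_vecs n" and w: "\<forall>i>n. w i = 0"
begin

lemma dir_deriv_eq: "regular_at n (proj_pt x) h \<Longrightarrow> line_deriv x w h d \<Longrightarrow> dir_deriv n x w h = d"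
  unfolding dir_deriv_def by (auto intro!: the_equality intro: line_deriv_unique)

lemma line_deriv_dir_deriv: "regular_at n (proj_pt x) h \<Longrightarrow> line_deriv x w h (dir_deriv n x w h)"
  using line_deriv_exists[OF x w] dir_deriv_eq by metis

lemma dir_deriv_tangent: "dir_deriv n x w \<in> tangent_space n (proj_pt x)"
proof (rule tangent_spaceI)
  show "dir_deriv n x w h = 0" if "\<not> regular_at n (proj_pt x) h" for h
    using that by (simp add: dir_deriv_def)
  fix g h assume gh: "regular_at n (proj_pt x) g" "regular_at n (proj_pt x) h"
  show "dir_deriv n x w g = dir_deriv n x w h" if "near n (proj_pt x) (\<lambda>q. g q = h q)"
    by (intro dir_deriv_eq line_deriv_cong[OF x w that] line_deriv_dir_deriv gh)
  show "dir_deriv n x w (\<lambda>q. g q + h q) = dir_deriv n x w g + dir_deriv n x w h"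
    by (intro dir_deriv_eq regular_at_add line_deriv_add line_deriv_dir_deriv gh)
  show "dir_deriv n x w (\<lambda>q. g q * h q) = g (proj_pt x) * dir_deriv n x w h + h (proj_pt x) * dir_deriv n x w g"
    by (intro dir_deriv_eq regular_at_mult line_deriv_mult line_deriv_dir_deriv gh)
next
  fix c h assume h: "regular_at n (proj_pt x) h"
  have "line_deriv x w (\<lambda>q. c * h q) (c * dir_deriv n x w h)"
    using line_deriv_mult[OF line_deriv_const[of x w c] line_deriv_dir_deriv[OF h]] by simp
  then show "dir_deriv n x w (\<lambda>q. c * h q) = c * dir_deriv n x w h"
    by (intro dir_deriv_eq regular_at_mult regular_at_const proj_space_pt x h)
qed

lemma dir_deriv_ratio:
  assumes "j \<le> n" "x j \<noteq> 0" "l \<le> n"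
  shows "dir_deriv n x w (ratio l j) = (w l * x j - x l * w j) / x j ^ 2"
  by (intro dir_deriv_eq regular_at_ratio line_deriv_ratio x assms)

end

lemma tangent_ratio_self:
  assumes "\<delta> \<in> tangent_space n (proj_pt x)" "x \<in> coord_vecs n" "j \<le> n" "x j \<noteq> (0::'k::field_char_0)"
  shows "\<delta> (ratio j j) = 0"
proof -
  have "near n (proj_pt x) (\<lambda>q. ratio j j q = 1)"
    by (rule near_mono[OF near_coord_nonzero[OF assms(2-4)]]) (use proj_pt_self in \<open>fastforce elim!: proj_spaceE\<close>)
  then have "\<delta> (ratio j j) = \<delta> (\<lambda>q. 1)"
    by (rule tangent_near_eq[OF assms(1) regular_at_const[OF proj_space_pt[OF assms(2)]]])
  then show ?thesis using tangent_const[OF assms(1)] by simp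
qed

text \<open>
  The preimage constructed here is the one with \<open>w\<^sub>j = 0\<close>: both sides agree on all ratios \<open>x\<^sub>l / x\<^sub>j\<close>.
\<close>

lemma tangent_eq_dir_deriv:
  assumes \<delta>: "\<delta> \<in> tangent_space n (proj_pt x)"
    and x: "x \<in> coord_vecs n" "j \<le> n" "x j \<noteq> (0::'k::field_char_0)"
  shows "\<delta> = dir_deriv n x (\<lambda>l. if l \<le> n then x j * \<delta> (ratio l j) else 0)"
proof -
  let ?w = "\<lambda>l. if l \<le> n then x j * \<delta> (ratio l j) else 0"
  have w: "\<forall>i>n. ?w i = 0" by simp
  show ?thesis
    by (rule tangent_space_eqI[OF \<delta> dir_deriv_tangent[OF x(1) w] x])
      (use x in \<open>simp_all add: dir_deriv_ratio[OF x(1) w] tangent_ratio_self[OF \<delta>] power2_eq_square\<close>)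
qed

lemma dir_deriv_scale:
  assumes x: "x \<in> coord_vecs n" and w: "\<forall>i>n. w i = 0" and c: "c \<noteq> (0::'k::field_char_0)"
  shows "dir_deriv n (\<lambda>i. c * x i) (\<lambda>i. c * w i) = dir_deriv n x w"
proof -
  obtain j where j: "j \<le> n" "x j \<noteq> 0" using x by (auto simp: coord_vecs_def)
  have cx: "(\<lambda>i. c * x i) \<in> coord_vecs n" using x c by (simp add: coord_vecs_scale)
  have cw: "\<forall>i>n. c * w i = 0" using w by simp
  show ?thesis
  proof (rule tangent_space_eqI[OF _ dir_deriv_tangent[OF x w] x j])
    show "dir_deriv n (\<lambda>i. c * x i) (\<lambda>i. c * w i) \<in> tangent_space n (proj_pt x)"
      using dir_deriv_tangent[OF cx cw] c by (simp add: proj_pt_scale)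
    show "dir_deriv n (\<lambda>i. c * x i) (\<lambda>i. c * w i) (ratio l j) = dir_deriv n x w (ratio l j)" if "l \<le> n" for l
    proof -
      have cj: "c * x j \<noteq> 0" using c j by simp
      show ?thesis unfolding dir_deriv_ratio[OF cx cw j(1) cj that] dir_deriv_ratio[OF x w j that]
        using c by (simp add: divide_simps) (simp add: algebra_simps power2_eq_square)
    qed
  qed
qed

lemma dir_deriv_eqD:
  assumes x: "x \<in> coord_vecs n" and w: "\<forall>i>n. w i = 0" and w': "\<forall>i>n. w' i = 0"
    and eq: "dir_deriv n x w = dir_deriv n x (w' :: 'k::field_char_0 vec)"
  obtains c where "\<And>l. w' l = w l + c * x l"
proof -
  obtain j where j: "j \<le> n" "x j \<noteq> 0" using x by (auto simp: coord_vecs_def)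
  show thesis
  proof (rule that)
    fix l
    show "w' l = w l + (w' j - w j) / x j * x l"
    proof (cases "l \<le> n")
      case True
      have "(w l * x j - x l * w j) / x j ^ 2 = (w' l * x j - x l * w' j) / x j ^ 2"
        using dir_deriv_ratio[OF x w j True] dir_deriv_ratio[OF x w' j True] unfolding eq by (rule trans[OF sym])
      then have "w l * x j - x l * w j = w' l * x j - x l * w' j" using j(2) by (metis divide_cancel_right power_not_zero)
      then show ?thesis using j by (simp add: field_simps)
    next
      case False
      then show ?thesis using w w' x by (simp add: coord_vecs_def)
    qed
  qed
qed

section \<open>Morphisms and vector fields\<close>

lemma proj_morphism_near:
  assumes f: "proj_morphism m n f" and p: "p \<in> proj_space m" and R: "near n (f p) R"
  shows "near m p (\<lambda>q. R (f q))"
proof -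
  obtain W where W: "zariski_open n W" "f p \<in> W" "\<forall>q\<in>W. R q" using R by (auto simp: near_def)
  then have "zariski_open m {q \<in> proj_space m. f q \<in> W}" using f by (simp add: proj_morphism_def)
  then show ?thesis using W p unfolding near_def by blast
qed

lemma proj_morphism_id: "proj_morphism n n (\<lambda>p. p)"
proof -
  have "{p \<in> proj_space n. p \<in> W} = W" if "zariski_open n W" for W :: "'a pt set"
    using zariski_open_subset[OF that] by blast
  then show ?thesis by (simp add: proj_morphism_def)
qed

lemma differential_at_tangent:
  assumes f: "proj_morphism m n f" and p: "p \<in> proj_space m" and \<delta>: "\<delta> \<in> tangent_space m (p :: 'k::field_char_0 pt)"
  shows "differential_at n f p \<delta> \<in> tangent_space n (f p)"
proof -
  have r: "regular_at m p (\<lambda>q. h (f q))" if "regular_at n (f p) h" for h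
    using f p that by (simp add: proj_morphism_def)
  have cong: "\<delta> (\<lambda>q. g (f q)) = \<delta> (\<lambda>q. h (f q))"
    if "regular_at n (f p) h" "near n (f p) (\<lambda>q. g q = h q)" for g h
    by (rule tangent_near_eq[OF \<delta> r[OF that(1)] proj_morphism_near[OF f p that(2)]])
  have fp: "f p \<in> proj_space n" using f p by (simp add: proj_morphism_def)
  show ?thesis
  proof (rule tangent_spaceI, goal_cases)
    case (2 g h)
    then show ?case using cong[of h g] by (simp add: differential_at_def)
  qed (simp_all add: differential_at_def regular_at_add regular_at_mult regular_at_const fp r
      tangent_add[OF \<delta>] tangent_mult[OF \<delta>] tangent_scale[OF \<delta>])
qed

text \<open>
  A vector field along \<open>f\<close> is regular as soon as it is regular on the ratios, again because these
  generate the local ring.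
\<close>

lemma vector_field_regular:
  fixes \<xi> :: "'k::field_char_0 pt \<Rightarrow> 'k tvec"
  assumes f: "proj_morphism m n f" and p: "p \<in> proj_space m"
    and \<xi>: "near m p (\<lambda>q. \<xi> q \<in> tangent_space n (f q))"
    and x: "x \<in> coord_vecs n" "f p = proj_pt x" "j \<le> n" "x j \<noteq> 0"
    and ratio: "\<And>l. l \<le> n \<Longrightarrow> regular_at m p (\<lambda>q. \<xi> q (ratio l j))"
    and h: "regular_at n (f p) h"
  shows "regular_at m p (\<lambda>q. \<xi> q h)"
proof -
  have r: "regular_at m p (\<lambda>q. h (f q))" if "regular_at n (proj_pt x) h" for h
    using f p that x by (simp add: proj_morphism_def)
  have rn: "near m p (\<lambda>q. regular_at n (f q) h)" if "regular_at n (proj_pt x) h" for h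
    using proj_morphism_near[OF f p regular_at_near] that x by simp
  show ?thesis
  proof (rule regular_at_induct[OF x(1,3,4) h[unfolded x(2)], where P = "\<lambda>h. regular_at m p (\<lambda>q. \<xi> q h)"], goal_cases)
    case (1 c)
    show ?case by (rule regular_at_cong[OF regular_at_const[OF p, of 0] near_mono[OF \<xi>]]) (simp add: tangent_const)
  next
    case (2 l) then show ?case by (rule ratio)
  next
    case (3 g h)
    show ?case
      by (rule regular_at_cong[OF regular_at_add[OF 3(2,4)] near_mono[OF near_conj[OF \<xi> near_conj[OF rn[OF 3(1)] rn[OF 3(3)]]]]])
        (auto simp: tangent_add)
  next
    case (4 g h)
    show ?case
      by (rule regular_at_cong[OF regular_at_add[OF regular_at_mult[OF r[OF 4(1)] 4(4)] regular_at_mult[OF r[OF 4(3)] 4(2)]]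
            near_mono[OF near_conj[OF \<xi> near_conj[OF rn[OF 4(1)] rn[OF 4(3)]]]]])
        (auto simp: tangent_mult)
  next
    case (5 a b h)
    obtain V where V: "zariski_open n V" "proj_pt x \<in> V" "\<forall>q\<in>V. b q * h q = a q"
      using 5 by (auto simp: near_def)
    have b: "near m p (\<lambda>q. b (f q) \<noteq> 0)"
      using r[OF 5(3)] 5(6) x by (intro regular_at_nonzero_near) auto
    have V': "near m p (\<lambda>q. f q \<in> V)"
      by (rule proj_morphism_near[OF f p near_open[OF V(1)]]) (use V x in simp)
    have eq: "\<xi> q h = (\<xi> q a - h (f q) * \<xi> q b) / b (f q)"
      if "\<xi> q \<in> tangent_space n (f q)" "b (f q) \<noteq> 0" "f q \<in> V"
        "regular_at n (f q) a" "regular_at n (f q) b" "regular_at n (f q) h" for q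
      using tangent_quotient[OF that(1,4-6,2)] V that(3) by (auto simp: near_def)
    have "near m p (\<lambda>q. \<xi> q h = (\<xi> q a - h (f q) * \<xi> q b) / b (f q))"
      by (rule near_mono[OF near_conj[OF near_conj[OF near_conj[OF \<xi> b] V']
            near_conj[OF near_conj[OF rn[OF 5(1)] rn[OF 5(3)]] rn[OF 5(5)]]]]) (use eq in blast)
    moreover have "regular_at m p (\<lambda>q. (\<xi> q a - h (f q) * \<xi> q b) / b (f q))"
      using 5(2,4) r[OF 5(5)] r[OF 5(3)] 5(6) x
      by (intro regular_at_divide regular_at_diff regular_at_mult) auto
    ultimately show ?case using regular_at_cong[of m p _ "\<lambda>q. \<xi> q h"] by simp
  qed
qed

section \<open>Cokernels of sheaves of modules\<close>

text \<open>
  The record type of sheaves of modules carries no axioms. The two locales collect the ones that the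
  comparison of cokernels uses.
\<close>

locale omod_presheaf =
  fixes F :: "('k::field, 's) omod"
  assumes restr_sec: "zariski_open 1 U \<Longrightarrow> zariski_open 1 V \<Longrightarrow> V \<subseteq> U \<Longrightarrow> s \<in> sec F U \<Longrightarrow> restr F U V s \<in> sec F V"
    and restr_id: "zariski_open 1 U \<Longrightarrow> s \<in> sec F U \<Longrightarrow> restr F U U s = s"
    and restr_restr: "zariski_open 1 U \<Longrightarrow> zariski_open 1 V \<Longrightarrow> zariski_open 1 W \<Longrightarrow> W \<subseteq> V \<Longrightarrow> V \<subseteq> U \<Longrightarrow>
      s \<in> sec F U \<Longrightarrow> restr F V W (restr F U V s) = restr F U W s"
    and plus_sec: "zariski_open 1 U \<Longrightarrow> s \<in> sec F U \<Longrightarrow> t \<in> sec F U \<Longrightarrow> plus_sec F U s t \<in> sec F U"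
    and restr_plus: "zariski_open 1 U \<Longrightarrow> zariski_open 1 V \<Longrightarrow> V \<subseteq> U \<Longrightarrow> s \<in> sec F U \<Longrightarrow> t \<in> sec F U \<Longrightarrow>
      restr F U V (plus_sec F U s t) = plus_sec F V (restr F U V s) (restr F U V t)"
    and smult_sec: "zariski_open 1 U \<Longrightarrow> a \<in> regular_functions 1 U \<Longrightarrow> s \<in> sec F U \<Longrightarrow> smult_sec F U a s \<in> sec F U"
    and restr_smult: "zariski_open 1 U \<Longrightarrow> zariski_open 1 V \<Longrightarrow> V \<subseteq> U \<Longrightarrow> a \<in> regular_functions 1 U \<Longrightarrow> s \<in> sec F U \<Longrightarrow>
      restr F U V (smult_sec F U a s) = smult_sec F V (\<lambda>q. if q \<in> V then a q else 0) (restr F U V s)"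

locale omod_sheaf = omod_presheaf +
  assumes separated: "zariski_open 1 U \<Longrightarrow> s \<in> sec F U \<Longrightarrow> t \<in> sec F U \<Longrightarrow>
      (\<And>p. p \<in> U \<Longrightarrow> \<exists>W. zariski_open 1 W \<and> p \<in> W \<and> W \<subseteq> U \<and> restr F U W s = restr F U W t) \<Longrightarrow> s = t"
    and glue: "zariski_open 1 U \<Longrightarrow>
      (\<And>p. p \<in> U \<Longrightarrow> zariski_open 1 (W p) \<and> p \<in> W p \<and> W p \<subseteq> U \<and> h p \<in> sec F (W p)) \<Longrightarrow>
      (\<And>p q. p \<in> U \<Longrightarrow> q \<in> U \<Longrightarrow> restr F (W p) (W p \<inter> W q) (h p) = restr F (W q) (W p \<inter> W q) (h q)) \<Longrightarrow>
      \<exists>s\<in>sec F U. \<forall>p\<in>U. restr F U (W p) s = h p"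

definition same_germ :: "('k::field, 's) omod \<Rightarrow> 'k pt \<Rightarrow> 'k pt set \<Rightarrow> 's \<Rightarrow> 'k pt set \<Rightarrow> 's \<Rightarrow> bool" where
  "same_germ F p U s V t \<longleftrightarrow>
     (\<exists>W. zariski_open 1 W \<and> p \<in> W \<and> W \<subseteq> U \<inter> V \<and> restr F U W s = restr F V W t)"

lemma same_germ_sym: "same_germ F p U s V t \<Longrightarrow> same_germ F p V t U s"
  unfolding same_germ_def by (metis Int_commute)

lemma regular_functions_restr:
  assumes "zariski_open n V" "V \<subseteq> U" "a \<in> regular_functions n U"
  shows "(\<lambda>q. if q \<in> V then a q else 0) \<in> regular_functions n V"
proof -
  have "regular_at n p (\<lambda>q. if q \<in> V then a q else 0)" if "p \<in> V" for p
    by (rule regular_at_cong[of n p a, OF _ near_mono[OF near_open[OF assms(1) that]]])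
      (use assms that in \<open>auto simp: regular_functions_def\<close>)
  then show ?thesis by (auto simp: regular_functions_def)
qed

context omod_presheaf
begin

lemma same_germ_restr:
  assumes "zariski_open 1 U" "zariski_open 1 V" "V \<subseteq> U" "p \<in> V" "s \<in> sec F U"
  shows "same_germ F p V (restr F U V s) U s"
  unfolding same_germ_def using assms restr_restr[OF assms(1,2,2)] restr_id[OF assms(2)] restr_sec
  by (intro exI[of _ V]) auto

lemma same_germ_common:
  assumes "zariski_open 1 U" "zariski_open 1 V" "s \<in> sec F U" "t \<in> sec F V" "same_germ F p U s V t"
  obtains W where "zariski_open 1 W" "p \<in> W" "W \<subseteq> U \<inter> V"
    "\<And>W'. zariski_open 1 W' \<Longrightarrow> W' \<subseteq> W \<Longrightarrow> restr F U W' s = restr F V W' t"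
proof -
  obtain W where W: "zariski_open 1 W" "p \<in> W" "W \<subseteq> U \<inter> V" "restr F U W s = restr F V W t"
    using assms(5) by (auto simp: same_germ_def)
  have "restr F U W' s = restr F V W' t" if "zariski_open 1 W'" "W' \<subseteq> W" for W'
    using restr_restr[OF assms(1) W(1) that _ assms(3)] restr_restr[OF assms(2) W(1) that _ assms(4)] W by simp
  then show thesis using that W by blast
qed

lemma same_germ_trans:
  assumes o: "zariski_open 1 U" "zariski_open 1 V" "zariski_open 1 X"
    and s: "s \<in> sec F U" "t \<in> sec F V" "r \<in> sec F X"
    and g: "same_germ F p U s V t" "same_germ F p V t X r"
  shows "same_germ F p U s X r"
proof -
  obtain W where W: "zariski_open 1 W" "p \<in> W" "W \<subseteq> U \<inter> V"
    "\<And>W'. zariski_open 1 W' \<Longrightarrow> W' \<subseteq> W \<Longrightarrow> restr F U W' s = restr F V W' t"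
    by (rule same_germ_common[OF o(1,2) s(1,2) g(1)]) (rule that)
  obtain W' where W': "zariski_open 1 W'" "p \<in> W'" "W' \<subseteq> V \<inter> X"
    "\<And>W''. zariski_open 1 W'' \<Longrightarrow> W'' \<subseteq> W' \<Longrightarrow> restr F V W'' t = restr F X W'' r"
    by (rule same_germ_common[OF o(2,3) s(2,3) g(2)]) (rule that)
  have i: "zariski_open 1 (W \<inter> W')" using W W' by (simp add: zariski_open_Int)
  show ?thesis unfolding same_germ_def using W(2,3) W'(2,3) W(4)[OF i] W'(4)[OF i] i by auto
qed

lemma same_germ_plus:
  assumes o: "zariski_open 1 U" "zariski_open 1 V"
    and s: "s \<in> sec F U" "s' \<in> sec F U" "t \<in> sec F V" "t' \<in> sec F V"
    and g: "same_germ F p U s V t" "same_germ F p U s' V t'"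
  shows "same_germ F p U (plus_sec F U s s') V (plus_sec F V t t')"
proof -
  obtain W where W: "zariski_open 1 W" "p \<in> W" "W \<subseteq> U \<inter> V"
    "\<And>W'. zariski_open 1 W' \<Longrightarrow> W' \<subseteq> W \<Longrightarrow> restr F U W' s = restr F V W' t"
    by (rule same_germ_common[OF o s(1,3) g(1)]) (rule that)
  obtain W' where W': "zariski_open 1 W'" "p \<in> W'" "W' \<subseteq> U \<inter> V"
    "\<And>W''. zariski_open 1 W'' \<Longrightarrow> W'' \<subseteq> W' \<Longrightarrow> restr F U W'' s' = restr F V W'' t'"
    by (rule same_germ_common[OF o s(2,4) g(2)]) (rule that)
  have i: "zariski_open 1 (W \<inter> W')" using W W' by (simp add: zariski_open_Int)
  have "restr F U (W \<inter> W') (plus_sec F U s s') = restr F V (W \<inter> W') (plus_sec F V t t')"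
    using restr_plus[OF o(1) i _ s(1,2)] restr_plus[OF o(2) i _ s(3,4)] W(3) W(4)[OF i] W'(4)[OF i]
    by (simp add: le_infI1)
  then show ?thesis unfolding same_germ_def using W(2,3) W'(2,3) i by (intro exI[of _ "W \<inter> W'"]) auto
qed

lemma same_germ_smult:
  assumes o: "zariski_open 1 U" "zariski_open 1 V"
    and s: "s \<in> sec F U" "t \<in> sec F V"
    and a: "a \<in> regular_functions 1 U" "b \<in> regular_functions 1 V" "\<And>q. q \<in> U \<inter> V \<Longrightarrow> a q = b q"
    and g: "same_germ F p U s V t"
  shows "same_germ F p U (smult_sec F U a s) V (smult_sec F V b t)"
proof -
  obtain W where W: "zariski_open 1 W" "p \<in> W" "W \<subseteq> U \<inter> V"
    "\<And>W'. zariski_open 1 W' \<Longrightarrow> W' \<subseteq> W \<Longrightarrow> restr F U W' s = restr F V W' t"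
    by (rule same_germ_common[OF o s g]) (rule that)
  have ab: "(\<lambda>q. if q \<in> W then a q else 0) = (\<lambda>q. if q \<in> W then b q else 0)" by (rule ext) (use a(3) W(3) in auto)
  have "restr F U W (smult_sec F U a s) = restr F V W (smult_sec F V b t)"
    using restr_smult[OF o(1) W(1) _ a(1) s(1)] restr_smult[OF o(2) W(1) _ a(2) s(2)] W(3) W(4)[OF W(1)] ab
    by simp
  then show ?thesis unfolding same_germ_def using W by blast
qed

end

lemma omod_homD:
  assumes "omod_hom F G \<phi>" "zariski_open 1 U"
  shows "s \<in> sec F U \<Longrightarrow> \<phi> U s \<in> sec G U"
    and "s \<in> sec F U \<Longrightarrow> t \<in> sec F U \<Longrightarrow> \<phi> U (plus_sec F U s t) = plus_sec G U (\<phi> U s) (\<phi> U t)"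
    and "a \<in> regular_functions 1 U \<Longrightarrow> s \<in> sec F U \<Longrightarrow> \<phi> U (smult_sec F U a s) = smult_sec G U a (\<phi> U s)"
    and "zariski_open 1 V \<Longrightarrow> V \<subseteq> U \<Longrightarrow> s \<in> sec F U \<Longrightarrow> \<phi> V (restr F U V s) = restr G U V (\<phi> U s)"
  using assms unfolding omod_hom_def by blast+

text \<open>
  The inverse of a bijective homomorphism is a homomorphism. This allows an isomorphism to be built in
  the direction in which it has an explicit formula.
\<close>

lemma omod_iso_sym:
  assumes F: "omod_presheaf F" and hom: "omod_hom F G \<phi>"
    and bij: "\<And>U. zariski_open 1 U \<Longrightarrow> bij_betw (\<phi> U) (sec F U) (sec G U)"
  shows "omod_iso G F"
proof -
  interpret F: omod_presheaf F by fact
  let ?\<psi> = "\<lambda>U. the_inv_into (sec F U) (\<phi> U)"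
  have inj: "inj_on (\<phi> U) (sec F U)" if "zariski_open 1 U" for U using bij[OF that] by (rule bij_betw_imp_inj_on)
  have bij': "bij_betw (?\<psi> U) (sec G U) (sec F U)" if "zariski_open 1 U" for U
    using bij[OF that] by (rule bij_betw_the_inv_into)
  have in_F: "?\<psi> U t \<in> sec F U" if "zariski_open 1 U" "t \<in> sec G U" for U t
    using bij'[OF that(1)] that(2) by (rule bij_betw_apply)
  have \<phi>\<psi>: "\<phi> U (?\<psi> U t) = t" if "zariski_open 1 U" "t \<in> sec G U" for U t
    using bij[OF that(1)] that(2) by (simp add: bij_betw_def f_the_inv_into_f)
  have eqI: "?\<psi> U t = s" if "zariski_open 1 U" "s \<in> sec F U" "\<phi> U s = t" for U s t
    using the_inv_into_f_f[OF inj[OF that(1)] that(2)] that(3) by simp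
  have "omod_hom G F ?\<psi>" unfolding omod_hom_def
  proof (intro allI impI conjI ballI)
    fix U :: "'a pt set" assume U: "zariski_open 1 U"
    fix s assume s: "s \<in> sec G U"
    show "?\<psi> U s \<in> sec F U" by (rule in_F[OF U s])
    show "?\<psi> U (plus_sec G U s t) = plus_sec F U (?\<psi> U s) (?\<psi> U t)" if t: "t \<in> sec G U" for t
      by (rule eqI[OF U F.plus_sec[OF U in_F[OF U s] in_F[OF U t]]])
        (simp add: omod_homD(2)[OF hom U in_F[OF U s] in_F[OF U t]] \<phi>\<psi>[OF U s] \<phi>\<psi>[OF U t])
    show "?\<psi> U (smult_sec G U a s) = smult_sec F U a (?\<psi> U s)" if a: "a \<in> regular_functions 1 U" for a
      by (rule eqI[OF U F.smult_sec[OF U a in_F[OF U s]]])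
        (simp add: omod_homD(3)[OF hom U a in_F[OF U s]] \<phi>\<psi>[OF U s])
    show "?\<psi> V (restr G U V s) = restr F U V (?\<psi> U s)" if V: "zariski_open 1 V \<and> V \<subseteq> U" for V
      using V by (intro eqI F.restr_sec in_F U s) (simp_all add: omod_homD(4)[OF hom U _ _ in_F[OF U s]] \<phi>\<psi>[OF U s])
  qed
  then show ?thesis unfolding omod_iso_def using bij' by blast
qed

text \<open>
  Exactness of \<open>F \<rightarrow> G \<rightarrow> H \<rightarrow> 0\<close>. Sheaves of modules have neither a zero nor a subtraction in their
  signature, so exactness in the middle is stated for two sections with the same image: they differ
  locally by the image of a section of \<open>F\<close>.
\<close>

locale right_exact = G: omod_presheaf G + H: omod_sheaf H
  for G :: "('k::field, 't) omod" and H :: "('k, 'u) omod" +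
  fixes F :: "('k, 's) omod" and \<phi> :: "'k pt set \<Rightarrow> 's \<Rightarrow> 't" and \<psi> :: "'k pt set \<Rightarrow> 't \<Rightarrow> 'u"
  assumes hom: "omod_hom G H \<psi>" and surj: "omod_surj G H \<psi>"
    and image_in_kernel: "\<And>U x s. zariski_open 1 U \<Longrightarrow> x \<in> sec F U \<Longrightarrow> s \<in> sec G U \<Longrightarrow>
      plus_sec G U s (\<phi> U x) \<in> sec G U \<and> \<psi> U (plus_sec G U s (\<phi> U x)) = \<psi> U s"
    and kernel_in_image: "\<And>U p s s'. zariski_open 1 U \<Longrightarrow> p \<in> U \<Longrightarrow> s \<in> sec G U \<Longrightarrow> s' \<in> sec G U \<Longrightarrow>
      \<psi> U s = \<psi> U s' \<Longrightarrow> \<exists>W. zariski_open 1 W \<and> p \<in> W \<and> W \<subseteq> U \<and>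
        (\<exists>x\<in>sec F W. restr G U W s' = plus_sec G W (restr G U W s) (\<phi> W x))"
begin

text \<open>
  The isomorphism from \<open>H\<close> to the cokernel sheaf sends \<open>h\<close> to the class of its local lifts to \<open>G\<close>. In
  this direction no lift has to be chosen, since the class is the set of all of them.
\<close>

definition lift_germs :: "'k pt set \<Rightarrow> 'u \<Rightarrow> 'k pt \<Rightarrow> ('k pt set \<times> 't) set" where
  "lift_germs U h p = (if p \<in> U then
     {(V, s). zariski_open 1 V \<and> p \<in> V \<and> s \<in> sec G V \<and> same_germ H p V (\<psi> V s) U h} else {})"

text \<open>
  The heart of the matter: by exactness two sections of \<open>G\<close> have the same germ modulo the image of \<open>F\<close> if
  and only if their images in \<open>H\<close> have the same germ.
\<close>

lemma coker_germ_eq: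
  assumes V: "zariski_open 1 V" "p \<in> V" "s \<in> sec G V"
  shows "coker_germ F G \<phi> p V s = lift_germs V (\<psi> V s) p"
proof (rule set_eqI)
  fix Vs :: "'k pt set \<times> 't"
  obtain V' s' where Vs: "Vs = (V', s')" by force
  have "(\<exists>W. zariski_open 1 W \<and> p \<in> W \<and> W \<subseteq> V \<inter> V' \<and>
          (\<exists>x\<in>sec F W. restr G V' W s' = plus_sec G W (restr G V W s) (\<phi> W x)))
      \<longleftrightarrow> same_germ H p V' (\<psi> V' s') V (\<psi> V s)" (is "?L \<longleftrightarrow> ?R")
    if V': "zariski_open 1 V'" "p \<in> V'" "s' \<in> sec G V'"
  proof
    assume ?L
    then obtain W x where W: "zariski_open 1 W" "p \<in> W" "W \<subseteq> V" "W \<subseteq> V'" "x \<in> sec F W"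
      "restr G V' W s' = plus_sec G W (restr G V W s) (\<phi> W x)" by auto
    have "\<psi> W (restr G V' W s') = \<psi> W (restr G V W s)"
      using image_in_kernel[OF W(1,5) G.restr_sec[OF V(1) W(1,3) V(3)]] W(6) by simp
    then have "restr H V' W (\<psi> V' s') = restr H V W (\<psi> V s)"
      by (simp add: omod_homD(4)[OF hom V(1) W(1,3) V(3)] omod_homD(4)[OF hom V'(1) W(1,4) V'(3)])
    then show ?R unfolding same_germ_def using W by blast
  next
    assume ?R
    then obtain W where W: "zariski_open 1 W" "p \<in> W" "W \<subseteq> V'" "W \<subseteq> V"
      "restr H V' W (\<psi> V' s') = restr H V W (\<psi> V s)" by (auto simp: same_germ_def)
    have "\<psi> W (restr G V W s) = \<psi> W (restr G V' W s')"
      using W(5) by (simp add: omod_homD(4)[OF hom V(1) W(1,4) V(3)] omod_homD(4)[OF hom V'(1) W(1,3) V'(3)])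
    from kernel_in_image[OF W(1,2) G.restr_sec[OF V(1) W(1,4) V(3)] G.restr_sec[OF V'(1) W(1,3) V'(3)] this]
    obtain W' x where W': "zariski_open 1 W'" "p \<in> W'" "W' \<subseteq> W" "x \<in> sec F W'"
      "restr G W W' (restr G V' W s') = plus_sec G W' (restr G W W' (restr G V W s)) (\<phi> W' x)" by blast
    then have "restr G V' W' s' = plus_sec G W' (restr G V W' s) (\<phi> W' x)"
      by (simp add: G.restr_restr[OF V(1) W(1) W'(1) W'(3) W(4) V(3)]
          G.restr_restr[OF V'(1) W(1) W'(1) W'(3) W(3) V'(3)])
    then show ?L using W W' by blast
  qed
  then show "Vs \<in> coker_germ F G \<phi> p V s \<longleftrightarrow> Vs \<in> lift_germs V (\<psi> V s) p"
    using V(2) unfolding Vs coker_germ_def lift_germs_def by auto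
qed

lemma lift_germs_cong:
  assumes "zariski_open 1 U" "zariski_open 1 V" "h \<in> sec H U" "g \<in> sec H V" "p \<in> U" "p \<in> V"
    and germ: "same_germ H p U h V g"
  shows "lift_germs U h p = lift_germs V g p"
proof -
  have "same_germ H p X (\<psi> X s) U h \<longleftrightarrow> same_germ H p X (\<psi> X s) V g" if "zariski_open 1 X" "s \<in> sec G X" for X s
    using H.same_germ_trans[OF that(1) assms(1,2) omod_homD(1)[OF hom that] assms(3,4) _ germ]
      H.same_germ_trans[OF that(1) assms(2,1) omod_homD(1)[OF hom that] assms(4,3) _ same_germ_sym[OF germ]]
    by blast
  then show ?thesis using assms(5,6) by (auto simp: lift_germs_def)
qed

lemma coker_germ_lift:
  assumes U: "zariski_open 1 U" "h \<in> sec H U" and Vs: "(V, s) \<in> lift_germs U h p"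
  shows "coker_germ F G \<phi> p V s = lift_germs U h p"
proof -
  have V: "zariski_open 1 V" "p \<in> V" "s \<in> sec G V" "same_germ H p V (\<psi> V s) U h" "p \<in> U"
    using Vs by (auto simp: lift_germs_def split: if_splits)
  show ?thesis unfolding coker_germ_eq[OF V(1-3)]
    by (rule lift_germs_cong[OF V(1) U(1) omod_homD(1)[OF hom V(1,3)] U(2) V(2,5,4)])
qed

lemma lift_exists:
  assumes U: "zariski_open 1 U" "h \<in> sec H U" "p \<in> U"
  obtains V s where "zariski_open 1 V" "p \<in> V" "V \<subseteq> U" "s \<in> sec G V" "\<psi> V s = restr H U V h"
    "\<And>q. q \<in> V \<Longrightarrow> (V, s) \<in> lift_germs U h q"
proof -
  obtain V s where V: "zariski_open 1 V" "p \<in> V" "V \<subseteq> U" "s \<in> sec G V" "\<psi> V s = restr H U V h"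
    using surj U unfolding omod_surj_def by blast
  have "(V, s) \<in> lift_germs U h q" if "q \<in> V" for q
    using V H.same_germ_restr[OF U(1) V(1,3) that U(2)] that by (auto simp: lift_germs_def)
  then show thesis using that V by blast
qed

lemma lift_germs_eqD:
  assumes U: "zariski_open 1 U" "h \<in> sec H U" "p \<in> U" and V: "zariski_open 1 V" "g \<in> sec H V"
    and eq: "lift_germs U h p = lift_germs V g p"
  shows "same_germ H p U h V g"
proof -
  obtain X s where X: "zariski_open 1 X" "p \<in> X" "X \<subseteq> U" "s \<in> sec G X" "\<psi> X s = restr H U X h"
    "\<And>q. q \<in> X \<Longrightarrow> (X, s) \<in> lift_germs U h q" by (rule lift_exists[OF U]) (rule that)
  have g: "same_germ H p X (\<psi> X s) U h" "same_germ H p X (\<psi> X s) V g"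
    using X(6)[OF X(2)] eq by (auto simp: lift_germs_def split: if_splits)
  show ?thesis
    by (rule H.same_germ_trans[OF U(1) X(1) V(1) U(2) omod_homD(1)[OF hom X(1,4)] V(2) same_germ_sym[OF g(1)] g(2)])
qed

text \<open>
  Injectivity is separatedness of \<open>H\<close>. For surjectivity, a section of the cokernel sheaf is locally the
  class of some \<open>s\<close>; the sections \<open>\<psi> s\<close> have equal germs where they overlap and are glued in \<open>H\<close>.
\<close>

lemma lift_germs_bij:
  assumes U: "zariski_open 1 U"
  shows "bij_betw (lift_germs U) (sec H U) (sec (coker_sheaf F G \<phi>) U)"
proof (rule bij_betw_imageI)
  show "inj_on (lift_germs U) (sec H U)"
  proof (rule inj_onI)
    fix h g assume h: "h \<in> sec H U" and g: "g \<in> sec H U" and eq: "lift_germs U h = lift_germs U g"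
    show "h = g"
    proof (rule H.separated[OF U h g])
      fix p assume p: "p \<in> U"
      have "same_germ H p U h U g" by (rule lift_germs_eqD[OF U h p U g]) (simp add: eq)
      then show "\<exists>W. zariski_open 1 W \<and> p \<in> W \<and> W \<subseteq> U \<and> restr H U W h = restr H U W g"
        by (simp add: same_germ_def)
    qed
  qed
  show "lift_germs U ` sec H U = sec (coker_sheaf F G \<phi>) U"
  proof (intro equalityI subsetI)
    fix \<sigma> assume "\<sigma> \<in> lift_germs U ` sec H U"
    then obtain h where h: "h \<in> sec H U" "\<sigma> = lift_germs U h" by blast
    have "\<exists>V. zariski_open 1 V \<and> p \<in> V \<and> V \<subseteq> U \<and> (\<exists>s\<in>sec G V. \<forall>q\<in>V. \<sigma> q = coker_germ F G \<phi> q V s)"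
      if p: "p \<in> U" for p
    proof -
      obtain V s where V: "zariski_open 1 V" "p \<in> V" "V \<subseteq> U" "s \<in> sec G V" "\<psi> V s = restr H U V h"
        "\<And>q. q \<in> V \<Longrightarrow> (V, s) \<in> lift_germs U h q" by (rule lift_exists[OF U h(1) p]) (rule that)
      show ?thesis unfolding h(2) using V(1-4) coker_germ_lift[OF U h(1) V(6)] by (intro exI[of _ V] conjI bexI[of _ s] ballI) simp_all
    qed
    then show "\<sigma> \<in> sec (coker_sheaf F G \<phi>) U"
      using h(2) by (simp add: coker_sheaf_def lift_germs_def)
  next
    fix \<sigma> assume \<sigma>: "\<sigma> \<in> sec (coker_sheaf F G \<phi>) U"
    have "\<forall>p. \<exists>V s. p \<in> U \<longrightarrow> zariski_open 1 V \<and> p \<in> V \<and> V \<subseteq> U \<and> s \<in> sec G V \<and> (\<forall>q\<in>V. \<sigma> q = coker_germ F G \<phi> q V s)"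
      using \<sigma> unfolding coker_sheaf_def by simp blast
    then obtain V s where V: "\<And>p. p \<in> U \<Longrightarrow> zariski_open 1 (V p)" "\<And>p. p \<in> U \<Longrightarrow> p \<in> V p"
      "\<And>p. p \<in> U \<Longrightarrow> V p \<subseteq> U" "\<And>p. p \<in> U \<Longrightarrow> s p \<in> sec G (V p)"
      "\<And>p q. p \<in> U \<Longrightarrow> q \<in> V p \<Longrightarrow> \<sigma> q = coker_germ F G \<phi> q (V p) (s p)" by metis
    define h where "h p = \<psi> (V p) (s p)" for p
    have h: "h p \<in> sec H (V p)" if "p \<in> U" for p using omod_homD(1)[OF hom V(1,4)] that by (simp add: h_def)
    have \<sigma>h: "\<sigma> q = lift_germs (V p) (h p) q" if "p \<in> U" "q \<in> V p" for p q
      using V that coker_germ_eq by (simp add: h_def)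
    have "\<exists>g\<in>sec H U. \<forall>p\<in>U. restr H U (V p) g = h p"
    proof (rule H.glue[OF U])
      show "zariski_open 1 (V p) \<and> p \<in> V p \<and> V p \<subseteq> U \<and> h p \<in> sec H (V p)" if "p \<in> U" for p
        using V h that by blast
      fix p q assume p: "p \<in> U" and q: "q \<in> U"
      have i: "zariski_open 1 (V p \<inter> V q)" using V(1) p q by (simp add: zariski_open_Int)
      show "restr H (V p) (V p \<inter> V q) (h p) = restr H (V q) (V p \<inter> V q) (h q)"
      proof (rule H.separated[OF i H.restr_sec[OF V(1)[OF p] i _ h[OF p]] H.restr_sec[OF V(1)[OF q] i _ h[OF q]]])
        fix r assume r: "r \<in> V p \<inter> V q"
        have "lift_germs (V p) (h p) r = lift_germs (V q) (h q) r" using \<sigma>h[OF p] \<sigma>h[OF q] r by auto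
        then have "same_germ H r (V p) (h p) (V q) (h q)"
          using r by (intro lift_germs_eqD V h p q) auto
        then obtain W where W: "zariski_open 1 W" "r \<in> W" "W \<subseteq> V p \<inter> V q"
          "restr H (V p) W (h p) = restr H (V q) W (h q)" by (auto simp: same_germ_def)
        show "\<exists>W. zariski_open 1 W \<and> r \<in> W \<and> W \<subseteq> V p \<inter> V q \<and>
          restr H (V p \<inter> V q) W (restr H (V p) (V p \<inter> V q) (h p)) = restr H (V p \<inter> V q) W (restr H (V q) (V p \<inter> V q) (h q))"
          using W H.restr_restr[OF V(1)[OF p] i W(1,3) _ h[OF p]] H.restr_restr[OF V(1)[OF q] i W(1,3) _ h[OF q]]
          by (intro exI[of _ W]) simp
      qed auto
    qed
    then obtain g where g: "g \<in> sec H U" "\<And>p. p \<in> U \<Longrightarrow> restr H U (V p) g = h p" by blast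
    have "\<sigma> p = lift_germs U g p" for p
    proof (cases "p \<in> U")
      case True
      have "lift_germs (V p) (restr H U (V p) g) p = lift_germs U g p"
        using True V by (intro lift_germs_cong H.same_germ_restr H.restr_sec U g(1)) auto
      then show ?thesis using \<sigma>h[OF True V(2)[OF True]] g(2)[OF True] by simp
    next
      case False
      then show ?thesis using \<sigma> by (simp add: coker_sheaf_def lift_germs_def)
    qed
    then show "\<sigma> \<in> lift_germs U ` sec H U" using g(1) by blast
  qed
qed

lemma lift_germs_hom: "omod_hom H (coker_sheaf F G \<phi>) lift_germs"
  unfolding omod_hom_def
proof (intro allI impI conjI ballI)
  fix U :: "'k pt set" and h assume U: "zariski_open 1 U" and h: "h \<in> sec H U"
  show "lift_germs U h \<in> sec (coker_sheaf F G \<phi>) U" by (rule bij_betw_apply[OF lift_germs_bij[OF U] h])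
  have lift: "zariski_open 1 V" "p \<in> V" "s \<in> sec G V" "same_germ H p V (\<psi> V s) U h" "p \<in> U"
    if "(V, s) \<in> lift_germs U h p" "h \<in> sec H U" for V s p h
    using that by (auto simp: lift_germs_def split: if_splits)
  have ne: "\<exists>V s. (V, s) \<in> lift_germs U h p" if p: "p \<in> U" and h: "h \<in> sec H U" for p h
  proof -
    obtain V s where "p \<in> V" "\<And>q. q \<in> V \<Longrightarrow> (V, s) \<in> lift_germs U h q"
      by (rule lift_exists[OF U h p]) (rule that)
    then show ?thesis by blast
  qed
  show "lift_germs U (plus_sec H U h g) = plus_sec (coker_sheaf F G \<phi>) U (lift_germs U h) (lift_germs U g)"
    if g: "g \<in> sec H U" for g
  proof
    fix p
    \<comment> \<open>Every pair of representatives gives the same class, so the union over all of them is that class.\<close>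
    have step: "coker_germ F G \<phi> p (V \<inter> V')
        (plus_sec G (V \<inter> V') (restr G V (V \<inter> V') s) (restr G V' (V \<inter> V') s')) = lift_germs U (plus_sec H U h g) p"
      if Vs: "(V, s) \<in> lift_germs U h p" and Vs': "(V', s') \<in> lift_germs U g p" for V s V' s'
    proof -
      note a = lift[OF Vs h] and b = lift[OF Vs' g]
      have i: "zariski_open 1 (V \<inter> V')" "p \<in> V \<inter> V'" using a b by (auto simp: zariski_open_Int)
      let ?s = "restr G V (V \<inter> V') s" and ?s' = "restr G V' (V \<inter> V') s'"
      have s: "?s \<in> sec G (V \<inter> V')" "?s' \<in> sec G (V \<inter> V')"
        using G.restr_sec[OF a(1) i(1) _ a(3)] G.restr_sec[OF b(1) i(1) _ b(3)] by auto
      have H1: "\<psi> (V \<inter> V') ?s = restr H V (V \<inter> V') (\<psi> V s)" "\<psi> (V \<inter> V') ?s' = restr H V' (V \<inter> V') (\<psi> V' s')"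
        using omod_homD(4)[OF hom a(1) i(1) _ a(3)] omod_homD(4)[OF hom b(1) i(1) _ b(3)] by auto
      have H2: "\<psi> (V \<inter> V') ?s \<in> sec H (V \<inter> V')" "\<psi> (V \<inter> V') ?s' \<in> sec H (V \<inter> V')"
        using omod_homD(1)[OF hom i(1)] s by auto
      have "same_germ H p (V \<inter> V') (\<psi> (V \<inter> V') ?s) U h"
        unfolding H1 by (rule H.same_germ_trans[OF i(1) a(1) U _ _ h H.same_germ_restr[OF a(1) i(1)] a(4)])
          (use H1 H2 i omod_homD(1)[OF hom a(1,3)] in auto)
      moreover have "same_germ H p (V \<inter> V') (\<psi> (V \<inter> V') ?s') U g"
        unfolding H1 by (rule H.same_germ_trans[OF i(1) b(1) U _ _ g H.same_germ_restr[OF b(1) i(1)] b(4)])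
          (use H1 H2 i omod_homD(1)[OF hom b(1,3)] in auto)
      ultimately have "same_germ H p (V \<inter> V') (\<psi> (V \<inter> V') (plus_sec G (V \<inter> V') ?s ?s')) U (plus_sec H U h g)"
        unfolding omod_homD(2)[OF hom i(1) s] by (rule H.same_germ_plus[OF i(1) U H2 h g])
      then have "(V \<inter> V', plus_sec G (V \<inter> V') ?s ?s') \<in> lift_germs U (plus_sec H U h g) p"
        using i a(5) G.plus_sec[OF i(1) s] by (simp add: lift_germs_def)
      then show ?thesis by (rule coker_germ_lift[OF U H.plus_sec[OF U h g]])
    qed
    show "lift_germs U (plus_sec H U h g) p = plus_sec (coker_sheaf F G \<phi>) U (lift_germs U h) (lift_germs U g) p"
    proof (cases "p \<in> U")
      case True
      then show ?thesis using step ne[OF True h] ne[OF True g] unfolding coker_sheaf_def by (simp, fastforce)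
    qed (simp add: lift_germs_def coker_sheaf_def)
  qed
  show "lift_germs U (smult_sec H U a h) = smult_sec (coker_sheaf F G \<phi>) U a (lift_germs U h)"
    if a: "a \<in> regular_functions 1 U" for a
  proof
    fix p
    have step: "coker_germ F G \<phi> p (U \<inter> V)
        (smult_sec G (U \<inter> V) (\<lambda>q. if q \<in> U \<inter> V then a q else 0) (restr G V (U \<inter> V) s)) = lift_germs U (smult_sec H U a h) p"
      if Vs: "(V, s) \<in> lift_germs U h p" for V s
    proof -
      note b = lift[OF Vs h]
      have i: "zariski_open 1 (U \<inter> V)" "p \<in> U \<inter> V" using b U by (auto simp: zariski_open_Int)
      let ?s = "restr G V (U \<inter> V) s" and ?a = "\<lambda>q. if q \<in> U \<inter> V then a q else 0"
      have s: "?s \<in> sec G (U \<inter> V)" using G.restr_sec[OF b(1) i(1) _ b(3)] by auto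
      have a': "?a \<in> regular_functions 1 (U \<inter> V)" by (rule regular_functions_restr[OF i(1) _ a]) auto
      have H1: "\<psi> (U \<inter> V) ?s = restr H V (U \<inter> V) (\<psi> V s)"
        using omod_homD(4)[OF hom b(1) i(1) _ b(3)] by auto
      have H2: "\<psi> (U \<inter> V) ?s \<in> sec H (U \<inter> V)" using omod_homD(1)[OF hom i(1)] s by auto
      have "same_germ H p (U \<inter> V) (\<psi> (U \<inter> V) ?s) U h"
        unfolding H1 by (rule H.same_germ_trans[OF i(1) b(1) U _ _ h H.same_germ_restr[OF b(1) i(1)] b(4)])
          (use H1 H2 i omod_homD(1)[OF hom b(1,3)] in auto)
      then have "same_germ H p (U \<inter> V) (\<psi> (U \<inter> V) (smult_sec G (U \<inter> V) ?a ?s)) U (smult_sec H U a h)"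
        unfolding omod_homD(3)[OF hom i(1) a' s] by (intro H.same_germ_smult[OF i(1) U H2 h a' a]) auto
      then have "(U \<inter> V, smult_sec G (U \<inter> V) ?a ?s) \<in> lift_germs U (smult_sec H U a h) p"
        using i b(5) G.smult_sec[OF i(1) a' s] by (simp add: lift_germs_def)
      then show ?thesis by (rule coker_germ_lift[OF U H.smult_sec[OF U a h]])
    qed
    show "lift_germs U (smult_sec H U a h) p = smult_sec (coker_sheaf F G \<phi>) U a (lift_germs U h) p"
    proof (cases "p \<in> U")
      case True
      then show ?thesis using step ne[OF True h] unfolding coker_sheaf_def by (simp, fastforce)
    qed (simp add: lift_germs_def coker_sheaf_def)
  qed
  show "lift_germs V (restr H U V h) = restr (coker_sheaf F G \<phi>) U V (lift_germs U h)"
    if V: "zariski_open 1 V \<and> V \<subseteq> U" for V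
  proof
    fix p
    have "lift_germs V (restr H U V h) p = lift_germs U h p" if "p \<in> V"
      using that V by (intro lift_germs_cong H.same_germ_restr H.restr_sec U h) auto
    then show "lift_germs V (restr H U V h) p = restr (coker_sheaf F G \<phi>) U V (lift_germs U h) p"
      by (simp add: coker_sheaf_def) (simp add: lift_germs_def)
  qed
qed

theorem coker_sheaf_iso: "omod_iso (coker_sheaf F G \<phi>) H"
  by (rule omod_iso_sym[OF H.omod_presheaf_axioms lift_germs_hom lift_germs_bij])

end

text \<open>
  Facts about the line are instances at \<open>1\<close> of facts about \<open>\<bbbP>\<^sup>n\<close>; rewriting \<open>1\<close> to \<open>Suc 0\<close> would keep
  them from applying.
\<close>

declare One_nat_def [simp del]

section \<open>Direct sums, twisting sheaves and pulled back tangent sheaves\<close>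

lemma omod_sheaf_direct_sum:
  fixes F :: "nat \<Rightarrow> ('k::field, 's) omod"
  assumes "\<And>i. i \<in> I \<Longrightarrow> omod_sheaf (F i)"
  shows "omod_sheaf (direct_sum I F)"
proof -
  have P: "omod_presheaf (F i)" if "i \<in> I" for i using assms[OF that] by (rule omod_sheaf.axioms(1))
  show ?thesis
  proof (unfold_locales, goal_cases)
    case (1 U V s) then show ?case by (auto simp: direct_sum_def intro: omod_presheaf.restr_sec[OF P])
  next
    case (2 U s) then show ?case by (auto simp: direct_sum_def omod_presheaf.restr_id[OF P])
  next
    case (3 U V W s) then show ?case by (auto simp: direct_sum_def omod_presheaf.restr_restr[OF P])
  next
    case (4 U s t) then show ?case by (auto simp: direct_sum_def intro: omod_presheaf.plus_sec[OF P])
  next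
    case (5 U V s t) then show ?case by (auto simp: direct_sum_def omod_presheaf.restr_plus[OF P])
  next
    case (6 U a s) then show ?case by (auto simp: direct_sum_def intro: omod_presheaf.smult_sec[OF P])
  next
    case (7 U V a s) then show ?case by (auto simp: direct_sum_def omod_presheaf.restr_smult[OF P])
  next
    case (8 U s t)
    show ?case
    proof
      fix i
      show "s i = t i"
      proof (cases "i \<in> I")
        case True
        show ?thesis
        proof (rule omod_sheaf.separated[OF assms[OF True] 8(1)])
          show "s i \<in> sec (F i) U" "t i \<in> sec (F i) U" using 8(2,3) True by (auto simp: direct_sum_def)
          fix p assume "p \<in> U"
          then obtain W where W: "zariski_open 1 W" "p \<in> W" "W \<subseteq> U"
            "restr (direct_sum I F) U W s = restr (direct_sum I F) U W t" using 8(4) by blast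
          from fun_cong[OF W(4), of i] True
          show "\<exists>W. zariski_open 1 W \<and> p \<in> W \<and> W \<subseteq> U \<and> restr (F i) U W (s i) = restr (F i) U W (t i)"
            using W by (auto simp: direct_sum_def)
        qed
      next
        case False
        then show ?thesis using 8(2,3) by (simp add: direct_sum_def)
      qed
    qed
  next
    case (9 U W h)
    have "\<exists>s\<in>sec (F i) U. \<forall>p\<in>U. restr (F i) U (W p) s = h p i" if i: "i \<in> I" for i
    proof (rule omod_sheaf.glue[OF assms[OF i] 9(1)])
      show "zariski_open 1 (W p) \<and> p \<in> W p \<and> W p \<subseteq> U \<and> h p i \<in> sec (F i) (W p)" if "p \<in> U" for p
        using 9(2)[OF that] i by (auto simp: direct_sum_def)
      show "restr (F i) (W p) (W p \<inter> W q) (h p i) = restr (F i) (W q) (W p \<inter> W q) (h q i)"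
        if "p \<in> U" "q \<in> U" for p q
        using fun_cong[OF 9(3)[OF that], of i] i by (auto simp: direct_sum_def)
    qed
    then obtain s where s: "\<And>i. i \<in> I \<Longrightarrow> s i \<in> sec (F i) U"
      "\<And>i p. i \<in> I \<Longrightarrow> p \<in> U \<Longrightarrow> restr (F i) U (W p) (s i) = h p i" by metis
    show ?case
    proof (intro bexI ballI)
      show "(\<lambda>i. if i \<in> I then s i else undefined) \<in> sec (direct_sum I F) U" using s by (simp add: direct_sum_def)
      show "restr (direct_sum I F) U (W p) (\<lambda>i. if i \<in> I then s i else undefined) = h p" if "p \<in> U" for p
        using 9(2)[OF that] s(2)[OF _ that] by (auto simp: direct_sum_def)
    qed
  qed
qed

text \<open>
  The local condition on sections of \<open>\<O>(d)\<close> at a single point, phrased without reference to an open set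
  \<open>U\<close>; shrinking neighbourhoods gives the form in the definition of the sheaf.
\<close>

definition twist_local :: "int \<Rightarrow> 'k::field pt \<Rightarrow> ('k vec \<Rightarrow> 'k) \<Rightarrow> bool" where
  "twist_local d p g \<longleftrightarrow> (\<exists>a b. int a = int b + d \<and> (\<exists>A\<in>forms 1 a. \<exists>B\<in>forms 1 b.
     near 1 p (\<lambda>q. \<forall>v\<in>q. B v \<noteq> 0 \<and> g v = A v / B v)))"

lemma twist_local_quotientI:
  "int a = int b + d \<Longrightarrow> A \<in> forms 1 a \<Longrightarrow> B \<in> forms 1 b \<Longrightarrow>
     near 1 p (\<lambda>q. \<forall>v\<in>q. B v \<noteq> 0 \<and> g v = A v / B v) \<Longrightarrow> twist_local d p g"
  unfolding twist_local_def by blast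

lemma twisting_sheaf_sel:
  "plus_sec (twisting_sheaf d) U g h = (\<lambda>v. g v + h v)"
  "smult_sec (twisting_sheaf d) U a g = (\<lambda>v. a (proj_pt v) * g v)"
  "restr (twisting_sheaf d) U V g = (\<lambda>v. if v \<in> \<Union>V then g v else 0)"
  by (simp_all add: twisting_sheaf_def)

lemma twist_sec_iff:
  assumes U: "zariski_open 1 U"
  shows "g \<in> sec (twisting_sheaf d) U \<longleftrightarrow> (\<forall>v. v \<notin> \<Union>U \<longrightarrow> g v = 0) \<and> (\<forall>p\<in>U. twist_local d p g)"
proof -
  have "(\<exists>V a b. zariski_open 1 V \<and> p \<in> V \<and> V \<subseteq> U \<and> int a = int b + d \<and>
          (\<exists>A\<in>forms 1 a. \<exists>B\<in>forms 1 b. \<forall>v\<in>\<Union>V. B v \<noteq> 0 \<and> g v = A v / B v)) \<longleftrightarrow> twist_local d p g" (is "?L \<longleftrightarrow> ?R")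
    if p: "p \<in> U" for p
  proof
    assume ?L
    then obtain V a b A B where V: "zariski_open 1 V" "p \<in> V" "int a = int b + d" "A \<in> forms 1 a" "B \<in> forms 1 b"
      "\<forall>v\<in>\<Union>V. B v \<noteq> 0 \<and> g v = A v / B v" by blast
    have "near 1 p (\<lambda>q. \<forall>v\<in>q. B v \<noteq> 0 \<and> g v = A v / B v)"
      by (rule near_mono[OF near_open[OF V(1,2)]]) (use V(6) in blast)
    then show ?R using V(3-5) unfolding twist_local_def by blast
  next
    assume ?R
    then obtain a b A B where V: "int a = int b + d" "A \<in> forms 1 a" "B \<in> forms 1 b"
      "near 1 p (\<lambda>q. \<forall>v\<in>q. B v \<noteq> 0 \<and> g v = A v / B v)" unfolding twist_local_def by blast
    obtain V where W: "zariski_open 1 V" "p \<in> V" "\<forall>q\<in>V. \<forall>v\<in>q. B v \<noteq> 0 \<and> g v = A v / B v"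
      using V(4) unfolding near_def by blast
    show ?L
      by (rule exI[of _ "V \<inter> U"], rule exI[of _ a], rule exI[of _ b])
        (use V W zariski_open_Int[OF W(1) U] p in blast)
  qed
  then show ?thesis by (simp add: twisting_sheaf_def)
qed

lemma twist_local_cong:
  assumes "twist_local d p g" "near 1 p (\<lambda>q. \<forall>v\<in>q. g' v = g v)" shows "twist_local d p g'"
proof -
  obtain a b A B where V: "int a = int b + d" "A \<in> forms 1 a" "B \<in> forms 1 b"
    "near 1 p (\<lambda>q. \<forall>v\<in>q. B v \<noteq> 0 \<and> g v = A v / B v)" using assms(1) unfolding twist_local_def by blast
  have "near 1 p (\<lambda>q. \<forall>v\<in>q. B v \<noteq> 0 \<and> g' v = A v / B v)"
    by (rule near_mono[OF near_conj[OF V(4) assms(2)]]) simp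
  then show ?thesis using V(1-3) unfolding twist_local_def by blast
qed

lemma twist_local_add:
  assumes "twist_local d p g" "twist_local d p h" shows "twist_local d p (\<lambda>v. g v + h v)"
proof -
  obtain a b A B where 1: "int a = int b + d" "A \<in> forms 1 a" "B \<in> forms 1 b"
    "near 1 p (\<lambda>q. \<forall>v\<in>q. B v \<noteq> 0 \<and> g v = A v / B v)" using assms(1) unfolding twist_local_def by blast
  obtain a' b' A' B' where 2: "int a' = int b' + d" "A' \<in> forms 1 a'" "B' \<in> forms 1 b'"
    "near 1 p (\<lambda>q. \<forall>v\<in>q. B' v \<noteq> 0 \<and> h v = A' v / B' v)" using assms(2) unfolding twist_local_def by blast
  have ab: "a' + b = a + b'" using 1(1) 2(1) by linarith
  have fm: "(\<lambda>v. A v * B' v) \<in> forms 1 (a + b')" "(\<lambda>v. A' v * B v) \<in> forms 1 (a + b')" "(\<lambda>v. B v * B' v) \<in> forms 1 (b + b')"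
    using forms_mult[OF 1(2) 2(3)] forms_mult[OF 2(2) 1(3)] forms_mult[OF 1(3) 2(3)] ab by auto
  have "near 1 p (\<lambda>q. \<forall>v\<in>q. B v * B' v \<noteq> 0 \<and> g v + h v = (A v * B' v + A' v * B v) / (B v * B' v))"
    by (rule near_mono[OF near_conj[OF 1(4) 2(4)]]) (auto simp: add_divide_distrib)
  then show ?thesis using 1(1) by (intro twist_local_quotientI[OF _ forms_add[OF fm(1,2)] fm(3)]) auto
qed

lemma near_regular_quotient:
  assumes "regular_at n p h"
  obtains d F G where "F \<in> forms n d" "G \<in> forms n d" "near n p (\<lambda>q. \<forall>v\<in>q. G v \<noteq> 0 \<and> h q = F v / G v)"
  using assms unfolding regular_at_def near_def by blast

lemma twist_local_mult:
  assumes "twist_local d p g" "regular_at 1 p h" shows "twist_local d p (\<lambda>v. h (proj_pt v) * g v)"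
proof -
  obtain a b A B where 1: "int a = int b + d" "A \<in> forms 1 a" "B \<in> forms 1 b"
    "near 1 p (\<lambda>q. \<forall>v\<in>q. B v \<noteq> 0 \<and> g v = A v / B v)" using assms(1) unfolding twist_local_def by blast
  obtain m F G where 2: "F \<in> forms 1 m" "G \<in> forms 1 m" "near 1 p (\<lambda>q. \<forall>v\<in>q. G v \<noteq> 0 \<and> h q = F v / G v)"
    by (rule near_regular_quotient[OF assms(2)]) (rule that)
  have "near 1 p (\<lambda>q. \<forall>v\<in>q. G v * B v \<noteq> 0 \<and> h (proj_pt v) * g v = (F v * A v) / (G v * B v))"
    by (rule near_mono[OF near_conj[OF 1(4) 2(3)]]) (auto dest: proj_space_mem(2))
  then show ?thesis
    using 1(1) by (intro twist_local_quotientI[OF _ forms_mult[OF 2(1) 1(2)] forms_mult[OF 2(2) 1(3)]]) auto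
qed

lemma omod_sheaf_twisting: "omod_sheaf (twisting_sheaf d :: ('k::field, 'k vec \<Rightarrow> 'k) omod)"
proof (unfold_locales, goal_cases)
  case (1 U V s)
  have "twist_local d p (\<lambda>v. if v \<in> \<Union>V then s v else 0)" if "p \<in> V" for p
    by (rule twist_local_cong[of d p s, OF _ near_mono[OF near_open[OF 1(2) that]]])
      (use 1 that in \<open>auto simp: twist_sec_iff\<close>)
  then show ?case using 1 by (simp add: twist_sec_iff twisting_sheaf_sel)
next
  case (2 U s) then show ?case by (auto simp: twist_sec_iff twisting_sheaf_sel)
next
  case (3 U V W s) then show ?case by (intro ext) (auto simp: twisting_sheaf_sel)
next
  case (4 U s t) then show ?case by (simp add: twist_sec_iff twisting_sheaf_sel twist_local_add)
next
  case (5 U V s t) then show ?case by (intro ext) (simp add: twisting_sheaf_sel)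
next
  case (6 U a s)
  have "twist_local d p (\<lambda>v. a (proj_pt v) * s v)" if "p \<in> U" for p
    using 6 that by (intro twist_local_mult) (auto simp: twist_sec_iff regular_functions_def)
  then show ?case using 6 by (simp add: twist_sec_iff twisting_sheaf_sel)
next
  case (7 U V a s)
  have "proj_pt v \<in> V" if "v \<in> q" "q \<in> V" for v q
    using proj_space_mem(2)[of q 1 v] zariski_open_subset[OF 7(2)] that by auto
  then show ?case by (intro ext) (auto simp: twisting_sheaf_sel)
next
  case (8 U s t)
  show ?case
  proof
    fix v
    show "s v = t v"
    proof (cases "v \<in> \<Union>U")
      case True
      then obtain p where p: "v \<in> p" "p \<in> U" by blast
      then obtain W where "p \<in> W" "restr (twisting_sheaf d) U W s = restr (twisting_sheaf d) U W t" using 8(4) by blast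
      from fun_cong[OF this(2), of v] this(1) p show ?thesis by (auto simp: twisting_sheaf_def split: if_splits)
    next
      case False then show ?thesis using 8(1-3) by (simp add: twist_sec_iff)
    qed
  qed
next
  case (9 U W h)
  define s where "s v = (if v \<in> \<Union>U then h (proj_pt v) v else 0)" for v
  have s: "s v = h p v" if "p \<in> U" "v \<in> q" "q \<in> W p" for p q v
  proof -
    have q: "q \<in> U" "q = proj_pt v"
      using 9(2)[OF that(1)] that zariski_open_subset[OF 9(1)] proj_space_mem(2)[of q 1 v] by auto
    have "v \<in> \<Union>(W p \<inter> W q)" using that 9(2)[OF q(1)] by blast
    then have "h p v = h q v"
      using fun_cong[OF 9(3)[OF that(1) q(1)], of v] by (simp add: twisting_sheaf_def)
    then show ?thesis using q that by (auto simp: s_def)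
  qed
  show ?case
  proof (intro bexI ballI)
    show "restr (twisting_sheaf d) U (W p) s = h p" if p: "p \<in> U" for p
    proof
      fix v
      have W: "zariski_open 1 (W p)" "h p \<in> sec (twisting_sheaf d) (W p)" using 9(2)[OF p] by auto
      have "h p v = 0" if "v \<notin> \<Union>(W p)" using W(2) that unfolding twist_sec_iff[OF W(1)] by blast
      then show "restr (twisting_sheaf d) U (W p) s v = h p v"
        using s[OF p] by (auto simp: twisting_sheaf_def)
    qed
    have "twist_local d p s" if p: "p \<in> U" for p
    proof (rule twist_local_cong)
      have W: "zariski_open 1 (W p)" "p \<in> W p" "h p \<in> sec (twisting_sheaf d) (W p)" using 9(2)[OF p] by auto
      show "twist_local d p (h p)" using W(2,3) unfolding twist_sec_iff[OF W(1)] by blast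
      show "near 1 p (\<lambda>q. \<forall>v\<in>q. s v = h p v)"
        by (rule near_mono[OF near_open[of 1 "W p"]]) (use 9(2)[OF p] s[OF p] in auto)
    qed
    then show "s \<in> sec (twisting_sheaf d) U" unfolding twist_sec_iff[OF 9(1)] by (simp add: s_def)
  qed
qed

lemma pullback_tangent_secI:
  assumes "\<And>p. p \<notin> U \<Longrightarrow> \<xi> p = (\<lambda>h. 0)" "\<And>p. p \<in> U \<Longrightarrow> \<xi> p \<in> tangent_space n (f p)"
    "\<And>p h. p \<in> U \<Longrightarrow> regular_at n (f p) h \<Longrightarrow> regular_at 1 p (\<lambda>q. \<xi> q h)"
  shows "\<xi> \<in> sec (pullback_tangent n f) U"
  using assms by (simp add: pullback_tangent_def)

lemma pullback_tangent_secD: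
  assumes "\<xi> \<in> sec (pullback_tangent n f) U"
  shows "p \<notin> U \<Longrightarrow> \<xi> p = (\<lambda>h. 0)" "p \<in> U \<Longrightarrow> \<xi> p \<in> tangent_space n (f p)"
    "p \<in> U \<Longrightarrow> regular_at n (f p) h \<Longrightarrow> regular_at 1 p (\<lambda>q. \<xi> q h)"
  using assms by (simp_all add: pullback_tangent_def)

lemma pullback_tangent_sel:
  "plus_sec (pullback_tangent n f) U \<xi> \<eta> = (\<lambda>p h. \<xi> p h + \<eta> p h)"
  "smult_sec (pullback_tangent n f) U a \<xi> = (\<lambda>p h. a p * \<xi> p h)"
  "restr (pullback_tangent n f) U V \<xi> = (\<lambda>p. if p \<in> V then \<xi> p else (\<lambda>h. 0))"
  by (simp_all add: pullback_tangent_def)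

lemma omod_presheaf_pullback_tangent:
  "omod_presheaf (pullback_tangent n f :: ('k::field_char_0, _) omod)"
proof (unfold_locales, goal_cases)
  case (1 U V s)
  show ?case unfolding pullback_tangent_sel
  proof (rule pullback_tangent_secI)
    show "regular_at 1 p (\<lambda>q. (if q \<in> V then s q else (\<lambda>h. 0)) h)" if "p \<in> V" "regular_at n (f p) h" for p h
      by (rule regular_at_cong[OF pullback_tangent_secD(3)[OF 1(4) _ that(2)] near_mono[OF near_open[OF 1(2) that(1)]]])
        (use 1(3) that in auto)
    show "(if p \<in> V then s p else (\<lambda>h. 0)) \<in> tangent_space n (f p)" if "p \<in> V" for p
      using pullback_tangent_secD(2)[OF 1(4), of p] 1(3) that by auto
  qed simp
next
  case (2 U s) then show ?case unfolding pullback_tangent_sel by (intro ext) (simp add: pullback_tangent_secD(1)[OF 2(2)])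
next
  case (3 U V W s) then show ?case unfolding pullback_tangent_sel by (intro ext) auto
next
  case (4 U s t)
  show ?case unfolding pullback_tangent_sel
    by (rule pullback_tangent_secI)
      (simp_all add: pullback_tangent_secD[OF 4(2)] pullback_tangent_secD[OF 4(3)] tangent_space_add
        regular_at_add[where g = "\<lambda>q. s q _" and h = "\<lambda>q. t q _"])
next
  case (5 U V s t) then show ?case unfolding pullback_tangent_sel by (intro ext) auto
next
  case (6 U a s)
  show ?case unfolding pullback_tangent_sel
    by (rule pullback_tangent_secI)
      (use 6(2) in \<open>simp_all add: pullback_tangent_secD[OF 6(3)] tangent_space_scale regular_at_mult regular_functions_def\<close>)
next
  case (7 U V a s) then show ?case unfolding pullback_tangent_sel by (intro ext) auto
qed

section \<open>The standard charts of the projective line\<close>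

definition chart :: "nat \<Rightarrow> 'k::field pt set" where
  "chart c = {q \<in> proj_space 1. \<forall>v\<in>q. v c \<noteq> 0}"

text \<open>
  The representative of \<open>q\<close> whose coordinate with index \<open>c\<close> is \<open>1\<close>.
\<close>

definition chart_vec :: "nat \<Rightarrow> 'k::field pt \<Rightarrow> 'k vec" where
  "chart_vec c q = (\<lambda>i. ratio i c q)"

lemma chart_open: "c \<le> 1 \<Longrightarrow> zariski_open 1 (chart c)"
  unfolding chart_def by (rule zariski_open_nonvanishing[OF forms_coord])

lemma chart_cover:
  assumes "p \<in> proj_space 1" obtains c where "c \<le> 1" "p \<in> chart c"
proof -
  obtain v where v: "v \<in> coord_vecs 1" "p = proj_pt v" using assms by (rule proj_spaceE)
  then obtain c where c: "c \<le> 1" "v c \<noteq> 0" by (auto simp: coord_vecs_def)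
  have "u c \<noteq> 0" if "u \<in> p" for u using that c v by (auto elim!: proj_ptE)
  then show thesis using that[of c] c assms by (simp add: chart_def)
qed

lemma chart_vec_scale:
  assumes "q \<in> chart c" "v \<in> q" shows "v = (\<lambda>i. v c * chart_vec c q i)"
proof -
  have "q = proj_pt v" "v c \<noteq> 0" using assms proj_space_mem(2)[of q 1 v] by (auto simp: chart_def)
  then show ?thesis by (simp add: chart_vec_def)
qed

lemma chart_vec:
  assumes q: "q \<in> chart c"
  shows "chart_vec c q \<in> q" "chart_vec c q \<in> coord_vecs 1" "proj_pt (chart_vec c q) = q" "chart_vec c q c = 1"
proof -
  obtain v where v: "v \<in> coord_vecs 1" "q = proj_pt v" using q by (auto simp: chart_def elim: proj_spaceE)
  have c: "v c \<noteq> 0" using q v proj_pt_self by (auto simp: chart_def)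
  have e: "chart_vec c q = (\<lambda>i. (1 / v c) * v i)" by (simp add: chart_vec_def v)
  show m: "chart_vec c q \<in> q" unfolding e unfolding v(2) proj_pt_def using c by (intro CollectI exI[of _ "1 / v c"]) simp
  show "chart_vec c q \<in> coord_vecs 1" "proj_pt (chart_vec c q) = q"
    using proj_space_mem[OF _ m, of 1] q by (auto simp: chart_def)
  show "chart_vec c q c = 1" using c by (simp add: e)
qed

lemma chart_vec_regular:
  assumes "q \<in> chart c" "c \<le> 1" "l \<le> 1" shows "regular_at 1 q (ratio l c)"
  using regular_at_ratio[OF chart_vec(2)[OF assms(1)] assms(2) _ assms(3)] chart_vec[OF assms(1)] by simp

text \<open>
  This lemma and the next two trivialise \<open>\<O>(d)\<close> on a chart: its sections are the functions
  \<open>x\<^sub>c^d h\<close> with \<open>h\<close> regular.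
\<close>

lemma twist_homogeneous:
  assumes U: "zariski_open 1 U" and g: "g \<in> sec (twisting_sheaf (int d)) U" and v: "v \<in> p" "p \<in> U" and c: "c \<noteq> 0"
  shows "g (\<lambda>i. c * v i) = c ^ d * g v"
proof -
  have "twist_local (int d) p g" using g v U by (simp add: twist_sec_iff)
  then obtain a b A B where V: "int a = int b + int d" "A \<in> forms 1 a" "B \<in> forms 1 b"
    "near 1 p (\<lambda>q. \<forall>v\<in>q. B v \<noteq> 0 \<and> g v = A v / B v)" unfolding twist_local_def by blast
  have p: "p = proj_pt v" using v U zariski_open_subset proj_space_mem(2) by blast
  have "(\<lambda>i. c * v i) \<in> p" using c unfolding p by (auto simp: proj_pt_def)
  then have "g (\<lambda>i. c * v i) = A (\<lambda>i. c * v i) / B (\<lambda>i. c * v i)" "g v = A v / B v" "B v \<noteq> 0"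
    using nearD[OF V(4)] v by auto
  moreover have "a = b + d" using V(1) by linarith
  ultimately show ?thesis using c by (simp add: forms_homogeneous[OF V(2)] forms_homogeneous[OF V(3)] power_add)
qed

lemma twist_localI:
  assumes h: "regular_at 1 p h" and c: "c \<le> 1" and g: "near 1 p (\<lambda>q. \<forall>v\<in>q. g v = v c ^ d * h q)"
  shows "twist_local (int d) p g"
proof -
  obtain m F G where 2: "F \<in> forms 1 m" "G \<in> forms 1 m" "near 1 p (\<lambda>q. \<forall>v\<in>q. G v \<noteq> 0 \<and> h q = F v / G v)"
    by (rule near_regular_quotient[OF h]) (rule that)
  have "near 1 p (\<lambda>q. \<forall>v\<in>q. G v \<noteq> 0 \<and> g v = (v c ^ d * F v) / G v)"
    by (rule near_mono[OF near_conj[OF g 2(3)]]) auto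
  moreover have "(\<lambda>v. v c ^ d * F v) \<in> forms 1 (d + m)"
    using forms_mult[OF forms_power[OF forms_coord[OF c], of d] 2(1)] by simp
  ultimately show ?thesis by (intro twist_local_quotientI[OF _ _ 2(2)]) auto
qed

lemma twist_sec_regular:
  assumes U: "zariski_open 1 U" and g: "g \<in> sec (twisting_sheaf (int d)) U" and p: "p \<in> U" "p \<in> chart c" and c: "c \<le> 1"
  shows "regular_at 1 p (\<lambda>q. g (chart_vec c q))"
proof -
  have "twist_local (int d) p g" using g p U by (simp add: twist_sec_iff)
  then obtain a b A B where V: "int a = int b + int d" "A \<in> forms 1 a" "B \<in> forms 1 b"
    "near 1 p (\<lambda>q. \<forall>v\<in>q. B v \<noteq> 0 \<and> g v = A v / B v)" unfolding twist_local_def by blast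
  have a: "a = b + d" using V(1) by linarith
  have fm: "(\<lambda>v. B v * v c ^ d) \<in> forms 1 a"
    using forms_mult[OF V(3) forms_power[OF forms_coord[OF c], of d]] a by simp
  let ?x = "chart_vec c p"
  have x: "?x \<in> coord_vecs 1" "proj_pt ?x = p" "?x c = 1" "?x \<in> p" using chart_vec[OF p(2)] by auto
  have "regular_at 1 p (\<lambda>q. A (SOME v. v \<in> q) / (B (SOME v. v \<in> q) * (SOME v. v \<in> q) c ^ d))"
  proof (subst x(2)[symmetric], rule regular_atI[OF x(1) V(2) fm])
    show "B ?x * ?x c ^ d \<noteq> 0" using nearD[OF V(4)] x by simp
    fix v :: "nat \<Rightarrow> 'a" assume v: "v \<in> coord_vecs 1" "B v * v c ^ d \<noteq> 0"
    let ?u = "SOME u. u \<in> proj_pt v"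
    have "?u \<in> proj_pt v" using someI[of "\<lambda>u. u \<in> proj_pt v"] proj_pt_self by blast
    then obtain r where r: "r \<noteq> 0" "?u = (\<lambda>i. r * v i)" by (rule proj_ptE)
    show "A ?u / (B ?u * ?u c ^ d) = A v / (B v * v c ^ d)"
      unfolding r(2) forms_homogeneous[OF V(2)] forms_homogeneous[OF V(3)] a
      using r v by (simp add: power_add power_mult_distrib)
  qed
  moreover have "near 1 p (\<lambda>q. g (chart_vec c q) = A (SOME v. v \<in> q) / (B (SOME v. v \<in> q) * (SOME v. v \<in> q) c ^ d))"
  proof (rule near_mono[OF near_conj[OF V(4) near_open[OF chart_open[OF c] p(2)]]])
    fix q :: "'a pt" assume q: "(\<forall>v\<in>q. B v \<noteq> 0 \<and> g v = A v / B v) \<and> q \<in> chart c"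
    let ?u = "SOME u. u \<in> q"
    have u: "?u \<in> q" using someI[of "\<lambda>u. u \<in> q"] chart_vec(1) q by blast
    then have uc: "?u c \<noteq> 0" using q by (auto simp: chart_def)
    have Bu: "B ?u \<noteq> 0" using q u by blast
    have e: "A ?u = ?u c ^ a * A (chart_vec c q)" "B ?u = ?u c ^ b * B (chart_vec c q)"
      using chart_vec_scale[OF conjunct2[OF q] u] forms_homogeneous[OF V(2), of "?u c" "chart_vec c q"]
        forms_homogeneous[OF V(3), of "?u c" "chart_vec c q"] by metis+
    have "g (chart_vec c q) = A (chart_vec c q) / B (chart_vec c q)" using q chart_vec(1) by blast
    then show "g (chart_vec c q) = A ?u / (B ?u * ?u c ^ d)" unfolding e a using uc by (simp add: power_add)
  qed
  ultimately show ?thesis by (rule regular_at_cong)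
qed

section \<open>The three-term relations\<close>

text \<open>
  The linear form of the introduction in the affine coordinate \<open>z\<close> of a chart. The exponents \<open>m\<close>
  decrease to \<open>m n = 0\<close>, and \<open>y\<close> is a tangent vector along the curve \<open>l \<mapsto> z^(m l)\<close>.
\<close>

definition three_term :: "(nat \<Rightarrow> nat) \<Rightarrow> 'k::field \<Rightarrow> (nat \<Rightarrow> 'k) \<Rightarrow> nat \<Rightarrow> 'k" where
  "three_term m z y i = of_nat (m i - m (Suc i)) * y (i - 1)
     - of_nat (m (i - 1) - m (Suc i)) * z ^ (m (i - 1) - m i) * y i
     + of_nat (m (i - 1) - m i) * z ^ (m (i - 1) - m (Suc i)) * y (Suc i)"

lemma three_term_add: "three_term m z (\<lambda>l. x l + y l) i = three_term m z x i + three_term m z y i"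
  by (simp add: three_term_def algebra_simps)

lemma three_term_diff: "three_term m z (\<lambda>l. x l - y l) i = three_term m z x i - three_term m z y i"
  by (simp add: three_term_def algebra_simps)

lemma three_term_scale: "three_term m z (\<lambda>l. c * y l) i = c * three_term m z y i"
  by (simp add: three_term_def algebra_simps)

text \<open>
  The vectors tangent to the curve itself are in the kernel. With \<open>r, r + b + 1, r + a + b + 2\<close> for the
  three exponents, the coefficient of the monomial is
  \<open>(b+1)(r+a+b+2) - (a+b+2)(r+b+1) + (a+1) r = 0\<close>.
\<close>

lemma three_term_derivative:
  assumes "m i < m (i - 1)" "m (Suc i) < m i"
  shows "three_term m z (\<lambda>l. of_nat (m l) * z ^ (m l - 1) * \<mu>) i = (0 :: 'k::field)"
proof -
  define r a b where "r = m (Suc i)" and "a = m (i - 1) - m i - 1" and "b = m i - m (Suc i) - 1"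
  have m: "m (Suc i) = r" "m i = r + b + 1" "m (i - 1) = r + b + a + 2"
    using assms by (auto simp: r_def a_def b_def)
  have d: "m i - m (Suc i) = b + 1" "m (i - 1) - m i = a + 1" "m (i - 1) - m (Suc i) = a + b + 2"
    unfolding m by auto
  have e: "m (Suc i) - 1 = r - 1" "m i - 1 = r + b" "m (i - 1) - 1 = r + b + a + 1" unfolding m by auto
  \<comment> \<open>For \<open>r\<close> = 0 the truncated exponent is harmless, because the coefficient vanishes.\<close>
  have r: "of_nat r * z ^ (r - 1) * z ^ (a + b + 2) = of_nat r * z ^ (r + b + a + 1)"
    by (cases r) (simp_all add: power_add mult_ac)
  have p: "z ^ (a + 1) * z ^ (r + b) = z ^ (r + b + a + 1)" by (simp add: power_add)
  have "three_term m z (\<lambda>l. of_nat (m l) * z ^ (m l - 1) * \<mu>) i =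
     of_nat (b + 1) * (of_nat (r + b + a + 2) * z ^ (r + b + a + 1) * \<mu>)
     - of_nat (a + b + 2) * z ^ (a + 1) * (of_nat (r + b + 1) * z ^ (r + b) * \<mu>)
     + of_nat (a + 1) * (of_nat r * z ^ (r - 1) * z ^ (a + b + 2)) * \<mu>"
    unfolding three_term_def d e unfolding m by (simp only: mult_ac)
  also have "\<dots> = (of_nat (b + 1) * of_nat (r + b + a + 2) - of_nat (a + b + 2) * of_nat (r + b + 1)
      + of_nat (a + 1) * of_nat r) * z ^ (r + b + a + 1) * \<mu>"
    unfolding r p[symmetric] by (simp add: ring_distribs mult_ac)
  also have "\<dots> = 0" by (simp add: algebra_simps)
  finally show ?thesis .
qed

text \<open>
  The coefficient of \<open>y (i - 1)\<close> is a nonzero constant, so the values of \<open>y\<close> are determined downwards by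
  the last two.
\<close>

lemma three_term_zero:
  fixes y :: "nat \<Rightarrow> 'k::field_char_0"
  assumes m: "\<And>i. i < n \<Longrightarrow> m (Suc i) < m i"
    and y: "y n = 0" "y (n - 1) = 0" and three_term: "\<And>i. 1 \<le> i \<Longrightarrow> i < n \<Longrightarrow> three_term m z y i = 0"
    and l: "l \<le> n"
  shows "y l = 0"
  using l
proof (induction "n - l" arbitrary: l rule: less_induct)
  case less
  show ?case
  proof (cases "l = n \<or> l = n - 1")
    case True then show ?thesis using y by auto
  next
    case False
    then have l: "Suc (Suc l) \<le> n" using less.prems by linarith
    have "y (Suc l) = 0" "y (Suc (Suc l)) = 0" using less.hyps[of "Suc l"] less.hyps[of "Suc (Suc l)"] l by auto
    then have "of_nat (m (Suc l) - m (Suc (Suc l))) * y l = 0" using three_term[of "Suc l"] l by (simp add: three_term_def)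
    moreover have "m (Suc (Suc l)) < m (Suc l)" using m[of "Suc l"] l by simp
    ultimately show ?thesis by simp
  qed
qed

text \<open>
  The difference of \<open>y\<close> and the tangent vector of the curve with the same entry at \<open>n - 1\<close> vanishes at
  \<open>n\<close> and \<open>n - 1\<close>, hence everywhere.
\<close>

lemma three_term_kernel:
  fixes y :: "nat \<Rightarrow> 'k::field_char_0"
  assumes m: "\<And>i. i < n \<Longrightarrow> m (Suc i) < m i" "m n = 0" "m (n - 1) = 1"
    and y: "y n = 0" and three_term: "\<And>i. 1 \<le> i \<Longrightarrow> i < n \<Longrightarrow> three_term m z y i = 0"
    and l: "l \<le> n"
  shows "y l = of_nat (m l) * z ^ (m l - 1) * y (n - 1)"
proof -
  let ?d = "\<lambda>l. of_nat (m l) * z ^ (m l - 1) * y (n - 1)"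
  have "(\<lambda>l. y l - ?d l) l = 0"
  proof (rule three_term_zero[where m = m and z = z, OF _ _ _ _ l])
    show "three_term m z (\<lambda>l. y l - ?d l) i = 0" if "1 \<le> i" "i < n" for i
      using three_term[OF that] three_term_derivative[of m i z "y (n - 1)"] m(1)[of i] m(1)[of "i - 1"] that
      by (simp add: three_term_diff)
    show "m (Suc i) < m i" if "i < n" for i using that by (rule m(1))
  qed (use y m in simp_all)
  then show ?thesis by simp
qed

text \<open>
  The recursion runs upwards in \<open>r = n - l\<close>: it solves the equation with index \<open>i = l + 1\<close> for its first
  entry \<open>y l\<close>, starting from \<open>y n = y (n - 1) = 0\<close>. Only constants are divided by, so solutions of
  equations with regular data are regular.
\<close>

fun three_term_solution :: "nat \<Rightarrow> (nat \<Rightarrow> nat) \<Rightarrow> 'k::field \<Rightarrow> (nat \<Rightarrow> 'k) \<Rightarrow> nat \<Rightarrow> 'k" where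
  "three_term_solution n m z g 0 = 0"
| "three_term_solution n m z g (Suc 0) = 0"
| "three_term_solution n m z g (Suc (Suc r)) = (let i = n - Suc r in
     (g i + of_nat (m (i - 1) - m (Suc i)) * z ^ (m (i - 1) - m i) * three_term_solution n m z g (Suc r)
      - of_nat (m (i - 1) - m i) * z ^ (m (i - 1) - m (Suc i)) * three_term_solution n m z g r)
     / of_nat (m i - m (Suc i)))"

lemma three_term_solution_correct:
  fixes z :: "'k::field_char_0"
  assumes m: "\<And>i. i < n \<Longrightarrow> m (Suc i) < m i" and i: "1 \<le> i" "i < n"
  shows "three_term m z (\<lambda>l. three_term_solution n m z g (n - l)) i = g i"
proof -
  define r where "r = n - i - 1"
  have e: "n - (i - 1) = Suc (Suc r)" "n - i = Suc r" "n - (Suc i) = r" "n - Suc r = i"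
    using i by (auto simp: r_def)
  have "m (Suc i) < m i" using m[OF i(2)] by simp
  then have "of_nat (m i - m (Suc i)) \<noteq> (0::'k)" by simp
  then show ?thesis unfolding three_term_def e by (simp add: Let_def e(4))
qed

lemma three_term_solution_regular:
  fixes z :: "'k::field_char_0 pt \<Rightarrow> 'k"
  assumes m: "\<And>i. i < n \<Longrightarrow> m (Suc i) < m i" and z: "regular_at 1 p z"
    and g: "\<And>i. 1 \<le> i \<Longrightarrow> i < n \<Longrightarrow> regular_at 1 p (g i)" and r: "r \<le> n"
  shows "regular_at 1 p (\<lambda>q. three_term_solution n m (z q) (\<lambda>i. g i q) r)"
  using r
proof (induction r rule: less_induct)
  case (less r)
  note p = regular_at_space[OF z]
  consider "r = 0" | "r = Suc 0" | s where "r = Suc (Suc s)" by (metis not0_implies_Suc)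
  then show ?case
  proof cases
    case (3 s)
    let ?i = "n - Suc s"
    have i: "1 \<le> ?i" "?i < n" using less.prems 3 by auto
    have "m (Suc ?i) < m ?i" using m[OF i(2)] by simp
    then have ne: "of_nat (m ?i - m (Suc ?i)) \<noteq> (0::'k)" by simp
    show ?thesis unfolding 3 three_term_solution.simps Let_def
      by (intro regular_at_divide regular_at_diff regular_at_add regular_at_mult regular_at_power
          regular_at_const p z g i less.IH ne) (use less.prems 3 in auto)
  qed (simp_all add: regular_at_const p)
qed

lemma three_term_regular:
  assumes "regular_at 1 p z" "\<And>l. l \<le> n \<Longrightarrow> regular_at 1 p (y l)" "1 \<le> i" "i < n"
  shows "regular_at 1 p (\<lambda>q. three_term m (z q) (\<lambda>l. y l q) i)"
  unfolding three_term_def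
  by (intro regular_at_diff regular_at_add regular_at_mult regular_at_power regular_at_const assms
      regular_at_space[OF assms(1)]) (use assms in auto)

section \<open>Monomial curves\<close>

locale monomial_curve =
  fixes n e :: nat and k :: "nat \<Rightarrow> nat" and f :: "'k::field_char_0 pt \<Rightarrow> 'k pt"
  assumes n: "n \<ge> 2"
    and k: "k n = 0" "k (n - 1) = 1" "k 1 = e - 1" "k 0 = e"
    and k_dec: "\<And>i. i < n \<Longrightarrow> k (Suc i) < k i"
    and f: "f = monomial_map n e k"
begin

lemma k_le: "i \<le> n \<Longrightarrow> k i \<le> e"
proof (induction i)
  case (Suc i) then show ?case using k_dec[of i] by simp
qed (simp add: k)

lemma e_pos: "e > 0"
  using k_dec[of 0] n k by simp

text \<open>
  The map on the punctured cones that induces \<open>f\<close>.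
\<close>

definition lift :: "'k vec \<Rightarrow> 'k vec" where
  "lift v = (\<lambda>i. if i \<le> n then v 0 ^ k i * v 1 ^ (e - k i) else 0)"

lemma lift_scale: "lift (\<lambda>i. c * v i) = (\<lambda>i. c ^ e * lift v i)"
proof
  fix i
  show "lift (\<lambda>i. c * v i) i = c ^ e * lift v i"
  proof (cases "i \<le> n")
    case True
    then have "c ^ e = c ^ k i * c ^ (e - k i)" using k_le by (simp flip: power_add)
    then show ?thesis using True by (simp add: lift_def power_mult_distrib mult_ac)
  qed (simp add: lift_def)
qed

lemma lift_coord_vecs:
  assumes "v \<in> coord_vecs 1" shows "lift v \<in> coord_vecs n"
proof -
  obtain c where "c \<le> 1" "v c \<noteq> 0" using assms by (auto simp: coord_vecs_def)
  then consider "v 0 \<noteq> 0" | "v 1 \<noteq> 0" by (cases "c = 0") (auto simp: One_nat_def le_Suc_eq)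
  then have "\<exists>i\<le>n. lift v i \<noteq> 0"
  proof cases
    case 1 then show ?thesis using k by (intro exI[of _ 0]) (simp add: lift_def)
  next
    case 2 then show ?thesis using k by (intro exI[of _ n]) (simp add: lift_def)
  qed
  then show ?thesis by (auto simp: coord_vecs_def lift_def)
qed

lemma f_proj_pt: "f (proj_pt v) = proj_pt (lift v)"
proof -
  have "proj_pt (lift u) = proj_pt (lift v)" if "u \<in> proj_pt v" for u
    using that by (elim proj_ptE) (simp add: lift_scale proj_pt_scale)
  then have "(\<Union>u\<in>proj_pt v. proj_pt (lift u)) = proj_pt (lift v)" using proj_pt_self by blast
  then show ?thesis unfolding f monomial_map_def lift_def .
qed

lemma forms_lift:
  assumes "F \<in> forms n d" shows "(\<lambda>v. F (lift v)) \<in> forms 1 (e * d)"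
proof -
  obtain c where F: "F = (\<lambda>v. \<Sum>\<alpha>\<in>exponents n d. c \<alpha> * (\<Prod>i\<le>n. v i ^ \<alpha> i))"
    using assms by (auto simp: forms_def)
  have l: "(\<lambda>v. lift v i) \<in> forms 1 e" if "i \<le> n" for i
  proof -
    have "(\<lambda>v. v 0 ^ k i * v 1 ^ (e - k i)) \<in> forms 1 (k i * 1 + (e - k i) * 1)"
      by (intro forms_mult forms_power forms_coord) auto
    then show ?thesis using that k_le[OF that] by (simp add: lift_def)
  qed
  have "(\<lambda>v. c \<alpha> * (\<Prod>i\<in>{..n}. lift v i ^ \<alpha> i)) \<in> forms 1 (e * d)" if \<alpha>: "\<alpha> \<in> exponents n d" for \<alpha>
  proof -
    have "(\<lambda>v. c \<alpha> * (\<Prod>i\<in>{..n}. lift v i ^ \<alpha> i)) \<in> forms 1 (0 + (\<Sum>i\<in>{..n}. \<alpha> i * e))"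
      by (intro forms_mult forms_const forms_prod forms_power l) auto
    moreover have "(\<Sum>i\<in>{..n}. \<alpha> i * e) = e * d" using \<alpha> by (simp add: exponents_def mult.commute flip: sum_distrib_left)
    ultimately show ?thesis by simp
  qed
  then show ?thesis unfolding F by (intro forms_sum finite_exponents)
qed

lemma morphism: "proj_morphism 1 n f"
  unfolding proj_morphism_def
proof (intro conjI ballI allI impI)
  show "f p \<in> proj_space n" if "p \<in> proj_space 1" for p
    using that by (elim proj_spaceE) (simp add: f_proj_pt proj_space_pt lift_coord_vecs)
  fix W :: "'k pt set" assume W: "zariski_open n W"
  show "zariski_open 1 {p \<in> proj_space 1. f p \<in> W}" unfolding zariski_open_iff_basic
  proof (intro conjI ballI impI)
    fix x assume x: "x \<in> coord_vecs 1" "proj_pt x \<in> {p \<in> proj_space 1. f p \<in> W}"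
    then have "proj_pt (lift x) \<in> W" by (simp add: f_proj_pt)
    then obtain d E where E: "E \<in> forms n d" "E (lift x) \<noteq> 0" "\<forall>v\<in>coord_vecs n. E v \<noteq> 0 \<longrightarrow> proj_pt v \<in> W"
      using W lift_coord_vecs[OF x(1)] unfolding zariski_open_iff_basic by blast
    show "\<exists>d. \<exists>E\<in>forms 1 d. E x \<noteq> 0 \<and> (\<forall>v\<in>coord_vecs 1. E v \<noteq> 0 \<longrightarrow> proj_pt v \<in> {p \<in> proj_space 1. f p \<in> W})"
      using E(2,3) forms_lift[OF E(1)]
      by (intro exI[of _ "e * d"] bexI[of _ "\<lambda>v. E (lift v)"]) (auto simp: f_proj_pt proj_space_pt lift_coord_vecs)
  qed auto
next
  fix p :: "'k pt" and h assume p: "p \<in> proj_space 1" and h: "regular_at n (f p) h"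
  obtain x where x: "x \<in> coord_vecs 1" "p = proj_pt x" using p by (rule proj_spaceE)
  obtain d F G where FG: "F \<in> forms n d" "G \<in> forms n d" "G (lift x) \<noteq> 0"
    "\<And>v. v \<in> coord_vecs n \<Longrightarrow> G v \<noteq> 0 \<Longrightarrow> h (proj_pt v) = F v / G v"
    by (rule regular_atE[OF lift_coord_vecs[OF x(1)] h[unfolded x(2) f_proj_pt]]) (rule that)
  show "regular_at 1 p (\<lambda>q. h (f q))" unfolding x(2)
    by (rule regular_atI[OF x(1) forms_lift[OF FG(1)] forms_lift[OF FG(2)] FG(3)])
      (simp add: f_proj_pt FG(4) lift_coord_vecs)
qed

subsection \<open>Charts\<close>

text \<open>
  The chart \<open>c = 1\<close> is \<open>t \<noteq> 0\<close>, with coordinate \<open>s / t\<close>; the chart \<open>c = 0\<close> is \<open>s \<noteq> 0\<close>, with coordinate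
  \<open>t / s\<close>. Reversing the indices in the second one makes the exponents of the coordinate decrease to \<open>0\<close> at
  the index \<open>n\<close> in both, and lets one argument serve for both charts.
\<close>

definition chart_index :: "nat \<Rightarrow> nat \<Rightarrow> nat" where
  "chart_index c l = (if c = 1 then l else n - l)"

definition chart_exp :: "nat \<Rightarrow> nat \<Rightarrow> nat" where
  "chart_exp c l = (if c = 1 then k l else e - k (n - l))"

abbreviation chart_coord :: "nat \<Rightarrow> 'k pt \<Rightarrow> 'k" where
  "chart_coord c \<equiv> ratio (1 - c) c"

lemma chart_index_le: "l \<le> n \<Longrightarrow> chart_index c l \<le> n"
  by (simp add: chart_index_def)

lemma chart_index_involution: "l \<le> n \<Longrightarrow> chart_index c (chart_index c l) = l"
  by (simp add: chart_index_def)

lemma chart_index_interior: "1 \<le> i \<Longrightarrow> i < n \<Longrightarrow> 1 \<le> chart_index c i \<and> chart_index c i < n"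
  by (auto simp: chart_index_def)

lemma chart_exp_dec: "i < n \<Longrightarrow> chart_exp c (Suc i) < chart_exp c i"
proof -
  assume i: "i < n"
  have "k (n - i) < k (n - Suc i)" using k_dec[of "n - Suc i"] i by (simp add: Suc_diff_Suc)
  moreover have "k (n - Suc i) \<le> e" by (rule k_le) simp
  ultimately show ?thesis using k_dec[OF i] by (auto simp: chart_exp_def)
qed

lemma chart_exp_ends: "chart_exp c n = 0" "chart_exp c (n - 1) = 1"
  using k n e_pos by (auto simp: chart_exp_def)

lemma lift_chart:
  assumes q: "q \<in> chart c" and c: "c \<le> 1" and l: "l \<le> n"
  shows "lift (chart_vec c q) (chart_index c l) = chart_coord c q ^ chart_exp c l"
proof -
  have "chart_vec c q c = 1" using q by (rule chart_vec)
  moreover have "chart_vec c q (1 - c) = chart_coord c q" by (simp add: chart_vec_def)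
  moreover have "c = 0 \<or> c = 1" using c by linarith
  ultimately show ?thesis using l k_le[of "n - l"] by (auto simp: lift_def chart_index_def chart_exp_def)
qed

lemma lift_chart_ref: "q \<in> chart c \<Longrightarrow> c \<le> 1 \<Longrightarrow> lift (chart_vec c q) (chart_index c n) = 1"
  using lift_chart[of q c n] by (simp add: chart_exp_ends)

lemma f_chart: "q \<in> chart c \<Longrightarrow> f q = proj_pt (lift (chart_vec c q))"
  using f_proj_pt[of "chart_vec c q"] chart_vec(3)[of q c] by simp

lemma lift_chart_coord: "q \<in> chart c \<Longrightarrow> lift (chart_vec c q) \<in> coord_vecs n"
  by (intro lift_coord_vecs chart_vec)

lemma ratio_f_chart:
  "q \<in> chart c \<Longrightarrow> c \<le> 1 \<Longrightarrow> l \<le> n \<Longrightarrow> ratio (chart_index c l) (chart_index c n) (f q) = chart_coord c q ^ chart_exp c l"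
  by (simp add: f_chart lift_chart chart_exp_ends)

lemma ratio_f_regular:
  assumes "q \<in> chart c" "c \<le> 1" "l \<le> n"
  shows "regular_at n (f q) (ratio l (chart_index c n))"
  unfolding f_chart[OF assms(1)] using assms
  by (intro regular_at_ratio lift_chart_coord chart_index_le) (simp_all add: lift_chart_ref)

text \<open>
  The coordinates of a tangent vector of \<open>\<bbbP>\<^sup>n\<close> in the affine chart around the curve, where the
  homogeneous coordinate with index \<open>chart_index c n\<close> is the denominator.
\<close>

definition tangent_coord :: "nat \<Rightarrow> 'k tvec \<Rightarrow> nat \<Rightarrow> 'k" where
  "tangent_coord c \<delta> l = \<delta> (ratio (chart_index c l) (chart_index c n))"

lemma tangent_coord_eqI:
  assumes q: "q \<in> chart c" "c \<le> 1" and \<delta>: "\<delta> \<in> tangent_space n (f q)" and \<epsilon>: "\<epsilon> \<in> tangent_space n (f q)"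
    and eq: "\<And>l. l \<le> n \<Longrightarrow> tangent_coord c \<delta> l = tangent_coord c \<epsilon> l"
  shows "\<delta> = \<epsilon>"
proof (rule tangent_space_eqI[OF \<delta>[unfolded f_chart[OF q(1)]] \<epsilon>[unfolded f_chart[OF q(1)]] lift_chart_coord[OF q(1)]])
  show "\<delta> (ratio l (chart_index c n)) = \<epsilon> (ratio l (chart_index c n))" if "l \<le> n" for l
    using eq[OF chart_index_le[OF that, of c]] chart_index_involution[OF that, of c] by (simp add: tangent_coord_def)
qed (use q in \<open>simp_all add: chart_index_le lift_chart_ref\<close>)

lemma tangent_coord_ref:
  assumes q: "q \<in> chart c" "c \<le> 1" and \<delta>: "\<delta> \<in> tangent_space n (f q)"
  shows "tangent_coord c \<delta> n = 0"
  unfolding tangent_coord_def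
  by (rule tangent_ratio_self[OF \<delta>[unfolded f_chart[OF q(1)]] lift_chart_coord[OF q(1)] chart_index_le])
    (use q in \<open>simp_all add: lift_chart_ref\<close>)

lemma dir_deriv_chart:
  assumes q: "q \<in> chart c" "c \<le> 1" and w: "\<forall>i>n. w i = 0" "w (chart_index c n) = 0"
  shows "dir_deriv n (lift (chart_vec c q)) w \<in> tangent_space n (f q)"
    and "l \<le> n \<Longrightarrow> tangent_coord c (dir_deriv n (lift (chart_vec c q)) w) l = w (chart_index c l)"
  using dir_deriv_tangent[OF lift_chart_coord[OF q(1)] w(1)]
    dir_deriv_ratio[OF lift_chart_coord[OF q(1)] w(1), of "chart_index c n" "chart_index c l"] q w(2)
  by (simp_all add: f_chart tangent_coord_def lift_chart_ref chart_index_le)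

lemma tangent_eq_dir_deriv_chart:
  assumes q: "q \<in> chart c" "c \<le> 1" and \<delta>: "\<delta> \<in> tangent_space n (f q)"
  shows "\<delta> = dir_deriv n (lift (chart_vec c q)) (\<lambda>l. if l \<le> n then tangent_coord c \<delta> (chart_index c l) else 0)"
proof -
  have "\<delta> = dir_deriv n (lift (chart_vec c q))
      (\<lambda>l. if l \<le> n then lift (chart_vec c q) (chart_index c n) * \<delta> (ratio l (chart_index c n)) else 0)"
    by (rule tangent_eq_dir_deriv[OF \<delta>[unfolded f_chart[OF q(1)]] lift_chart_coord[OF q(1)] chart_index_le])
      (use q in \<open>simp_all add: lift_chart_ref\<close>)
  also have "(\<lambda>l. if l \<le> n then lift (chart_vec c q) (chart_index c n) * \<delta> (ratio l (chart_index c n)) else 0)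
      = (\<lambda>l. if l \<le> n then tangent_coord c \<delta> (chart_index c l) else 0)"
    using q by (auto simp: lift_chart_ref tangent_coord_def chart_index_involution)
  finally show ?thesis .
qed

text \<open>
  In the chart the map \<open>f\<close> is \<open>z \<mapsto> (z^m)\<close> with varying \<open>m\<close>, so this is the rule for the
  derivative of a power.
\<close>

lemma tangent_coord_differential:
  assumes q: "q \<in> chart c" "c \<le> 1" and \<delta>: "\<delta> \<in> tangent_space 1 q" and l: "l \<le> n"
  shows "tangent_coord c (differential_at n f q \<delta>) l = of_nat (chart_exp c l) * chart_coord c q ^ (chart_exp c l - 1) * \<delta> (chart_coord c)"
proof -
  have z: "regular_at 1 q (chart_coord c)" by (rule chart_vec_regular[OF q]) (use q in simp)
  have "tangent_coord c (differential_at n f q \<delta>) l = \<delta> (\<lambda>q'. ratio (chart_index c l) (chart_index c n) (f q'))"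
    using ratio_f_regular[OF q chart_index_le[OF l]] by (simp add: tangent_coord_def differential_at_def)
  also have "\<dots> = \<delta> (\<lambda>q'. chart_coord c q' ^ chart_exp c l)"
    by (rule tangent_near_eq[OF \<delta> regular_at_power[OF z] near_mono[OF near_open[OF chart_open[OF q(2)] q(1)]]])
      (use q l in \<open>simp add: ratio_f_chart\<close>)
  also have "\<dots> = of_nat (chart_exp c l) * chart_coord c q ^ (chart_exp c l - 1) * \<delta> (chart_coord c)"
    by (rule tangent_power[OF \<delta> z])
  finally show ?thesis .
qed

subsection \<open>The map to the twisting sheaves\<close>

definition twist :: "nat \<Rightarrow> nat" where
  "twist i = k (i - 1) - k (Suc i)"

text \<open>
  The linear form of the introduction, in homogeneous coordinates.
\<close>

definition relation :: "nat \<Rightarrow> 'k vec \<Rightarrow> 'k vec \<Rightarrow> 'k" where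
  "relation i v w = of_nat (k i - k (Suc i)) * v 1 ^ twist i * w (i - 1)
     - of_nat (twist i) * v 0 ^ (k (i - 1) - k i) * v 1 ^ (k i - k (Suc i)) * w i
     + of_nat (k (i - 1) - k i) * v 0 ^ twist i * w (Suc i)"

lemma k_interior:
  assumes "1 \<le> i" "i < n"
  shows "k (Suc i) < k i" "k i < k (i - 1)" "twist i = (k (i - 1) - k i) + (k i - k (Suc i))" "k (i - 1) \<le> e"
proof -
  have "Suc (i - 1) = i" using assms by simp
  then show *: "k (Suc i) < k i" "k i < k (i - 1)" "k (i - 1) \<le> e"
    using k_dec[of i] k_dec[of "i - 1"] k_le[of "i - 1"] assms by auto
  then show "twist i = (k (i - 1) - k i) + (k i - k (Suc i))" by (simp add: twist_def)
qed

lemma relation_scale: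
  assumes "1 \<le> i" "i < n"
  shows "relation i (\<lambda>l. c * v l) (\<lambda>l. c ^ e * w l) = c ^ (e + twist i) * relation i v w"
  unfolding relation_def k_interior(3)[OF assms] by (simp add: power_mult_distrib power_add algebra_simps)

lemma relation_lift:
  assumes i: "1 \<le> i" "i < n" shows "relation i v (lift v) = 0"
proof -
  define r a b' s where "r = k (Suc i)" and "a = k (i - 1) - k i" and "b' = k i - k (Suc i)" and "s = e - k (i - 1)"
  have kk: "k (Suc i) = r" "k i = r + b'" "k (i - 1) = r + b' + a" "e = r + b' + a + s"
    using k_interior[OF i] by (auto simp: r_def a_def b'_def s_def)
  have ee: "e - k (Suc i) = b' + a + s" "e - k i = a + s" "e - k (i - 1) = s" unfolding kk by auto
  have dd: "k i - k (Suc i) = b'" "k (i - 1) - k i = a" "twist i = a + b'"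
    using k_interior(3)[OF i] unfolding kk by auto
  show ?thesis unfolding relation_def lift_def dd ee using i unfolding kk(1-3)
    by (simp add: power_add algebra_simps)
qed

lemma relation_add_scale: "relation i v (\<lambda>l. w l + c * x l) = relation i v w + c * relation i v x"
  by (simp add: relation_def algebra_simps)

lemma relation_chart:
  assumes q: "q \<in> chart c" "c \<le> 1" and i: "1 \<le> i" "i < n"
  shows "relation (chart_index c i) (chart_vec c q) w = three_term (chart_exp c) (chart_coord c q) (\<lambda>l. w (chart_index c l)) i"
proof -
  have 1: "chart_vec c q c = 1" using q by (intro chart_vec)
  have z: "chart_vec c q (1 - c) = chart_coord c q" by (simp add: chart_vec_def)
  have "c = 0 \<or> c = 1" using q by linarith
  then show ?thesis
  proof
    assume c: "c = 1"
    show ?thesis using 1 z unfolding c by (simp add: relation_def three_term_def chart_index_def chart_exp_def twist_def)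
  next
    assume c: "c = 0"
    define j where "j = n - i"
    have j: "n - i = j" "n - (i - 1) = Suc j" "n - (Suc i) = j - 1" "1 \<le> j" "j < n" using i by (auto simp: j_def)
    note kj = k_interior[OF j(4,5)]
    have d: "e - k j - (e - k (j - 1)) = k (j - 1) - k j" "e - k (Suc j) - (e - k j) = k j - k (Suc j)"
      "e - k (Suc j) - (e - k (j - 1)) = k (j - 1) - k (Suc j)"
      using kj by auto
    have ex: "chart_exp 0 i = e - k j" "chart_exp 0 (i - 1) = e - k (Suc j)" "chart_exp 0 (Suc i) = e - k (j - 1)"
      "chart_index 0 i = j" "chart_index 0 (i - 1) = Suc j" "chart_index 0 (Suc i) = j - 1"
      by (simp_all add: chart_exp_def chart_index_def j(1-3))
    show ?thesis using 1 z unfolding c relation_def three_term_def ex d twist_def by (simp add: algebra_simps)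
  qed
qed

text \<open>
  By \<open>relation_lift\<close> the form vanishes on \<open>lift v\<close>, so all vectors \<open>w\<close> that represent \<open>\<delta>\<close> give
  the same value, whichever of them is selected. As no chart enters, the formulas in the two charts are
  consistent without a computation on their overlap.
\<close>

definition normal_component :: "nat \<Rightarrow> 'k tvec \<Rightarrow> 'k vec \<Rightarrow> 'k" where
  "normal_component i \<delta> v = relation i v (SOME w. (\<forall>l>n. w l = 0) \<and> \<delta> = dir_deriv n (lift v) w)"

lemma normal_component_dir_deriv:
  assumes v: "v \<in> coord_vecs 1" and w: "\<forall>l>n. w l = 0" and i: "1 \<le> i" "i < n"
  shows "normal_component i (dir_deriv n (lift v) w) v = relation i v w"
proof -
  let ?P = "\<lambda>w'. (\<forall>l>n. w' l = 0) \<and> dir_deriv n (lift v) w = dir_deriv n (lift v) w'"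
  have P: "?P (SOME w'. ?P w')" by (rule someI[of ?P w]) (use w in simp)
  obtain c where c: "\<And>l. (SOME w'. ?P w') l = w l + c * lift v l"
    by (rule dir_deriv_eqD[OF lift_coord_vecs[OF v] w conjunct1[OF P] conjunct2[OF P]]) (rule that)
  have "(SOME w'. ?P w') = (\<lambda>l. w l + c * lift v l)" by (rule ext) (rule c)
  then show ?thesis unfolding normal_component_def by (simp add: relation_add_scale relation_lift[OF i])
qed

text \<open>
  Comparison of the homogeneous description with the one in a chart. The power of \<open>v c\<close> says that the
  value has the degree of a section of \<open>\<O>(e + b\<^sub>i)\<close>.
\<close>

lemma normal_component_chart:
  assumes q: "q \<in> chart c" "c \<le> 1" and v: "v \<in> q" and \<delta>: "\<delta> \<in> tangent_space n (f q)" and i: "1 \<le> i" "i < n"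
  shows "normal_component (chart_index c i) \<delta> v = v c ^ (e + twist (chart_index c i)) * three_term (chart_exp c) (chart_coord c q) (tangent_coord c \<delta>) i"
proof -
  let ?u = "chart_vec c q" and ?w = "\<lambda>l. if l \<le> n then tangent_coord c \<delta> (chart_index c l) else 0"
  have vc: "v c \<noteq> 0" using q v by (simp add: chart_def)
  have vu: "v = (\<lambda>i. v c * ?u i)" by (rule chart_vec_scale[OF q(1) v])
  have vv: "v \<in> coord_vecs 1" using q v by (auto simp: chart_def dest: proj_space_mem)
  have w: "\<forall>i>n. ?w i = 0" by simp
  have lv: "lift v = (\<lambda>i. v c ^ e * lift ?u i)" by (subst vu) (rule lift_scale)
  have "\<delta> = dir_deriv n (lift v) (\<lambda>l. v c ^ e * ?w l)"
    unfolding lv by (subst dir_deriv_scale[OF lift_chart_coord[OF q(1)] w])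
      (use vc tangent_eq_dir_deriv_chart[OF q \<delta>] in simp_all)
  then have "normal_component (chart_index c i) \<delta> v = relation (chart_index c i) v (\<lambda>l. v c ^ e * ?w l)"
    using normal_component_dir_deriv[OF vv, of "\<lambda>l. v c ^ e * ?w l" "chart_index c i"] chart_index_interior[OF i] by simp
  also have "\<dots> = v c ^ (e + twist (chart_index c i)) * relation (chart_index c i) ?u ?w"
    by (subst vu) (use relation_scale[of "chart_index c i" "v c" ?u ?w] chart_index_interior[OF i] in simp)
  also have "relation (chart_index c i) ?u ?w = three_term (chart_exp c) (chart_coord c q) (\<lambda>l. ?w (chart_index c l)) i"
    by (rule relation_chart[OF q i])
  also have "\<dots> = three_term (chart_exp c) (chart_coord c q) (tangent_coord c \<delta>) i"
    using i by (simp add: three_term_def chart_index_le chart_index_involution)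
  finally show ?thesis .
qed

abbreviation target :: "('k, nat \<Rightarrow> 'k vec \<Rightarrow> 'k) omod" where
  "target \<equiv> direct_sum {1..n - 1} (\<lambda>i. twisting_sheaf (int (e + twist i)))"

definition normal_map :: "'k pt set \<Rightarrow> ('k pt \<Rightarrow> 'k tvec) \<Rightarrow> nat \<Rightarrow> 'k vec \<Rightarrow> 'k" where
  "normal_map U \<xi> i = (if i \<in> {1..n - 1}
     then (\<lambda>v. if v \<in> \<Union>U then normal_component i (\<xi> (proj_pt v)) v else 0) else undefined)"

lemma interior: "i \<in> {1..n - 1} \<longleftrightarrow> 1 \<le> i \<and> i < n"
  using n by auto

lemma normal_map_eqI:
  assumes U: "zariski_open 1 U"
    and eq: "\<And>c q i. c \<le> 1 \<Longrightarrow> q \<in> chart c \<Longrightarrow> q \<in> U \<Longrightarrow> 1 \<le> i \<Longrightarrow> i < n \<Longrightarrow>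
       three_term (chart_exp c) (chart_coord c q) (tangent_coord c (\<xi> q)) i = three_term (chart_exp c) (chart_coord c q) (tangent_coord c (\<eta> q)) i"
    and \<xi>: "\<And>q. q \<in> U \<Longrightarrow> \<xi> q \<in> tangent_space n (f q)" and \<eta>: "\<And>q. q \<in> U \<Longrightarrow> \<eta> q \<in> tangent_space n (f q)"
  shows "normal_map U \<xi> = normal_map U \<eta>"
proof -
  have "normal_component i (\<xi> (proj_pt v)) v = normal_component i (\<eta> (proj_pt v)) v" if i: "1 \<le> i" "i < n" and v: "v \<in> q" "q \<in> U" for i v q
  proof -
    have q: "q \<in> proj_space 1" "q = proj_pt v"
      using v zariski_open_subset[OF U] proj_space_mem(2)[of q 1 v] by auto
    obtain c where c: "c \<le> 1" "q \<in> chart c" using q(1) by (rule chart_cover)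
    have i': "1 \<le> chart_index c i" "chart_index c i < n" "chart_index c (chart_index c i) = i" using chart_index_interior[OF i] chart_index_involution[of i c] i by auto
    show ?thesis
      using normal_component_chart[OF c(2,1) v(1) \<xi>[OF v(2)] i'(1,2)] normal_component_chart[OF c(2,1) v(1) \<eta>[OF v(2)] i'(1,2)]
        eq[OF c v(2) i'(1,2)] i'(3) q(2) by simp
  qed
  then show ?thesis unfolding normal_map_def by (intro ext) (auto simp: interior)
qed

lemma normal_map_chart:
  assumes U: "zariski_open 1 U" and \<xi>: "\<xi> q \<in> tangent_space n (f q)"
    and q: "q \<in> chart c" "c \<le> 1" "q \<in> U" and v: "v \<in> q" and i: "1 \<le> i" "i < n"
  shows "normal_map U \<xi> (chart_index c i) v = v c ^ (e + twist (chart_index c i)) * three_term (chart_exp c) (chart_coord c q) (tangent_coord c (\<xi> q)) i"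
proof -
  have "q = proj_pt v" using q v by (auto simp: chart_def dest: proj_space_mem)
  then show ?thesis unfolding normal_map_def
    using normal_component_chart[OF q(1,2) v \<xi> i] chart_index_interior[OF i, of c] q v by (auto simp: interior)
qed

subsection \<open>Exactness\<close>

lemma tangent_coord_regular:
  assumes \<xi>: "\<xi> \<in> sec (pullback_tangent n f) U" and p: "p \<in> U" "p \<in> chart c" "c \<le> 1" and l: "l \<le> n"
  shows "regular_at 1 p (\<lambda>q. tangent_coord c (\<xi> q) l)"
  unfolding tangent_coord_def by (rule pullback_tangent_secD(3)[OF \<xi> p(1) ratio_f_regular[OF p(2,3) chart_index_le[OF l]]])

lemma chart_coord_regular: "p \<in> chart c \<Longrightarrow> c \<le> 1 \<Longrightarrow> regular_at 1 p (chart_coord c)"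
  by (rule chart_vec_regular) auto

lemma normal_map_sec:
  assumes U: "zariski_open 1 U" and \<xi>: "\<xi> \<in> sec (pullback_tangent n f) U"
  shows "normal_map U \<xi> \<in> sec target U"
proof -
  have "normal_map U \<xi> i \<in> sec (twisting_sheaf (int (e + twist i))) U" if i: "1 \<le> i" "i < n" for i
    unfolding twist_sec_iff[OF U]
  proof (intro conjI ballI allI impI)
    show "normal_map U \<xi> i v = 0" if "v \<notin> \<Union>U" for v using that i by (simp add: normal_map_def interior)
    fix p assume p: "p \<in> U"
    obtain c where c: "c \<le> 1" "p \<in> chart c" using chart_cover p zariski_open_subset[OF U] by blast
    have i': "1 \<le> chart_index c i" "chart_index c i < n" "chart_index c (chart_index c i) = i" using chart_index_interior[OF i] chart_index_involution[of i c] i by auto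
    show "twist_local (int (e + twist i)) p (normal_map U \<xi> i)"
    proof (rule twist_localI[OF _ c(1)])
      show "regular_at 1 p (\<lambda>q. three_term (chart_exp c) (chart_coord c q) (tangent_coord c (\<xi> q)) (chart_index c i))"
        using three_term_regular[where y = "\<lambda>l q. tangent_coord c (\<xi> q) l", OF chart_coord_regular[OF c(2,1)] tangent_coord_regular[OF \<xi> p c(2,1)] i'(1,2)] .
      show "near 1 p (\<lambda>q. \<forall>v\<in>q. normal_map U \<xi> i v =
          v c ^ (e + twist i) * three_term (chart_exp c) (chart_coord c q) (tangent_coord c (\<xi> q)) (chart_index c i))"
        by (rule near_mono[OF near_conj[OF near_open[OF U p] near_open[OF chart_open[OF c(1)] c(2)]]])
          (use normal_map_chart[where \<xi> = \<xi>, OF U pullback_tangent_secD(2)[OF \<xi>] _ c(1) _ _ i'(1,2)] i'(3) in auto)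
    qed
  qed
  then have "\<forall>i\<in>{1..n - 1}. normal_map U \<xi> i \<in> sec (twisting_sheaf (int (e + twist i))) U"
    by (intro ballI) (unfold interior, blast)
  moreover have "\<forall>i. i \<notin> {1..n - 1} \<longrightarrow> normal_map U \<xi> i = undefined" by (simp add: normal_map_def)
  ultimately show ?thesis unfolding direct_sum_def by simp
qed

lemma target_sel:
  "plus_sec target U s t = (\<lambda>i. if i \<in> {1..n - 1} then \<lambda>v. s i v + t i v else undefined)"
  "smult_sec target U a s = (\<lambda>i. if i \<in> {1..n - 1} then \<lambda>v. a (proj_pt v) * s i v else undefined)"
  "restr target U V s = (\<lambda>i. if i \<in> {1..n - 1} then \<lambda>v. if v \<in> \<Union>V then s i v else 0 else undefined)"
  by (simp_all add: direct_sum_def twisting_sheaf_sel[abs_def] cong: if_cong)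

lemma normal_component_linear:
  assumes q: "q \<in> proj_space 1" and v: "v \<in> q" and i: "1 \<le> i" "i < n"
    and \<delta>: "\<delta> \<in> tangent_space n (f q)" and \<epsilon>: "\<epsilon> \<in> tangent_space n (f q)"
  shows "normal_component i (\<lambda>h. \<delta> h + \<epsilon> h) v = normal_component i \<delta> v + normal_component i \<epsilon> v" "normal_component i (\<lambda>h. a * \<delta> h) v = a * normal_component i \<delta> v"
proof -
  obtain c where c: "c \<le> 1" "q \<in> chart c" using q by (rule chart_cover)
  have i': "1 \<le> chart_index c i" "chart_index c i < n" "chart_index c (chart_index c i) = i" using chart_index_interior[OF i] chart_index_involution[of i c] i by auto
  note p = normal_component_chart[OF c(2,1) v _ i'(1,2), unfolded i'(3)]
  have t: "tangent_coord c (\<lambda>h. \<delta> h + \<epsilon> h) = (\<lambda>l. tangent_coord c \<delta> l + tangent_coord c \<epsilon> l)"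
    "tangent_coord c (\<lambda>h. a * \<delta> h) = (\<lambda>l. a * tangent_coord c \<delta> l)" by (rule ext, simp add: tangent_coord_def)+
  show "normal_component i (\<lambda>h. \<delta> h + \<epsilon> h) v = normal_component i \<delta> v + normal_component i \<epsilon> v"
    unfolding p[OF \<delta>] p[OF \<epsilon>] p[OF tangent_space_add[OF \<delta> \<epsilon>]] t three_term_add by (simp add: algebra_simps)
  show "normal_component i (\<lambda>h. a * \<delta> h) v = a * normal_component i \<delta> v"
    unfolding p[OF \<delta>] p[OF tangent_space_scale[OF \<delta>]] t three_term_scale by simp
qed

lemma normal_map_hom: "omod_hom (pullback_tangent n f) target normal_map"
  unfolding omod_hom_def
proof (intro allI impI conjI ballI)
  fix U :: "'k pt set" and \<xi> assume U: "zariski_open 1 U" and \<xi>: "\<xi> \<in> sec (pullback_tangent n f) U"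
  have q: "q = proj_pt v" "q \<in> proj_space 1" if "v \<in> q" "q \<in> U" for v q
    using that zariski_open_subset[OF U] proj_space_mem(2)[of q 1 v] by auto
  note T = pullback_tangent_secD(2)
  show "normal_map U \<xi> \<in> sec target U" by (rule normal_map_sec[OF U \<xi>])
  show "normal_map U (plus_sec (pullback_tangent n f) U \<xi> \<eta>) = plus_sec target U (normal_map U \<xi>) (normal_map U \<eta>)"
    if \<eta>: "\<eta> \<in> sec (pullback_tangent n f) U" for \<eta>
  proof -
    have "normal_component i (\<lambda>h. \<xi> (proj_pt v) h + \<eta> (proj_pt v) h) v = normal_component i (\<xi> (proj_pt v)) v + normal_component i (\<eta> (proj_pt v)) v"
      if "v \<in> q" "q \<in> U" "1 \<le> i" "i < n" for v q i
      using normal_component_linear(1)[OF q(2)[OF that(1,2)] that(1,3,4) T[OF \<xi> that(2)] T[OF \<eta> that(2)]] q(1)[OF that(1,2)] by simp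
    then show ?thesis unfolding target_sel pullback_tangent_sel normal_map_def by (intro ext) (auto simp: interior)
  qed
  show "normal_map U (smult_sec (pullback_tangent n f) U a \<xi>) = smult_sec target U a (normal_map U \<xi>)" for a
  proof -
    have "normal_component i (\<lambda>h. a (proj_pt v) * \<xi> (proj_pt v) h) v = a (proj_pt v) * normal_component i (\<xi> (proj_pt v)) v"
      if "v \<in> q" "q \<in> U" "1 \<le> i" "i < n" for v q i
      using normal_component_linear(2)[OF q(2)[OF that(1,2)] that(1,3,4) T[OF \<xi> that(2)] T[OF \<xi> that(2)]] q(1)[OF that(1,2)] by simp
    then show ?thesis unfolding target_sel pullback_tangent_sel normal_map_def by (intro ext) (auto simp: interior)
  qed
  show "normal_map V (restr (pullback_tangent n f) U V \<xi>) = restr target U V (normal_map U \<xi>)"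
    if V: "zariski_open 1 V \<and> V \<subseteq> U" for V
  proof -
    have "proj_pt v \<in> V" if "v \<in> q" "q \<in> V" for v q using q(1)[of v q] V that by auto
    then show ?thesis using V unfolding target_sel pullback_tangent_sel normal_map_def by (intro ext) auto
  qed
qed

text \<open>
  Over the part of the open set in one chart, the triangular system is solved with the given section as
  right hand side; homogeneity carries the equality over to all representatives of a point.
\<close>

lemma normal_map_surj: "omod_surj (pullback_tangent n f) target normal_map"
  unfolding omod_surj_def
proof (intro allI impI ballI)
  fix U :: "'k pt set" and t p assume U: "zariski_open 1 U" and t: "t \<in> sec target U" and p: "p \<in> U"
  obtain c where c: "c \<le> 1" "p \<in> chart c" using chart_cover p zariski_open_subset[OF U] by blast
  define V where "V = U \<inter> chart c"
  have V: "zariski_open 1 V" "p \<in> V" "V \<subseteq> U" unfolding V_def using U chart_open[OF c(1)] p c by (auto intro: zariski_open_Int)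
  have t': "t i \<in> sec (twisting_sheaf (int (e + twist i))) U" if "1 \<le> i" "i < n" for i
    using t that by (simp add: direct_sum_def interior)
  define g where "g i q = t (chart_index c i) (chart_vec c q)" for i q
  define Y where "Y l q = three_term_solution n (chart_exp c) (chart_coord c q) (\<lambda>i. g i q) (n - l)" for l q
  define w where "w q l = (if l \<le> n then Y (chart_index c l) q else 0)" for q l
  define \<xi> where "\<xi> q = (if q \<in> V then dir_deriv n (lift (chart_vec c q)) (w q) else (\<lambda>h. 0))" for q
  have g: "regular_at 1 q (g i)" if "1 \<le> i" "i < n" "q \<in> V" for i q
    unfolding g_def using chart_index_interior[OF that(1,2)] that(3) c
    by (intro twist_sec_regular[OF U t']) (auto simp: V_def)
  have Y: "regular_at 1 q (Y l)" if "q \<in> V" for l q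
    unfolding Y_def using that c
    by (intro three_term_solution_regular chart_coord_regular g chart_exp_dec) (auto simp: V_def)
  have w: "\<forall>l>n. w q l = 0" "w q (chart_index c n) = 0" for q
    by (simp_all add: w_def Y_def chart_index_involution)
  have T: "\<xi> q \<in> tangent_space n (f q)" "\<And>l. l \<le> n \<Longrightarrow> tangent_coord c (\<xi> q) l = Y l q" if "q \<in> V" for q
    using dir_deriv_chart[OF _ c(1) w(1)[of q] w(2)[of q], of q] that
    by (auto simp: \<xi>_def V_def) (simp add: w_def chart_index_le chart_index_involution)
  have \<xi>: "\<xi> \<in> sec (pullback_tangent n f) V"
  proof (rule pullback_tangent_secI)
    show "\<xi> q = (\<lambda>h. 0)" if "q \<notin> V" for q using that by (simp add: \<xi>_def)
    show "\<xi> q \<in> tangent_space n (f q)" if "q \<in> V" for q using that by (rule T)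
    fix q h assume q: "q \<in> V" and h: "regular_at n (f q) h"
    have qc: "q \<in> chart c" and qs: "q \<in> proj_space 1" using q by (auto simp: V_def chart_def)
    show "regular_at 1 q (\<lambda>q'. \<xi> q' h)"
    proof (rule vector_field_regular[OF morphism qs _ lift_chart_coord[OF qc] f_chart[OF qc] chart_index_le[OF order_refl] _ _ h])
      show "near 1 q (\<lambda>q. \<xi> q \<in> tangent_space n (f q))" by (rule near_mono[OF near_open[OF V(1) q]]) (rule T)
      show "lift (chart_vec c q) (chart_index c n) \<noteq> 0" by (simp add: lift_chart_ref[OF qc c(1)])
      show "regular_at 1 q (\<lambda>q'. \<xi> q' (ratio l (chart_index c n)))" if l: "l \<le> n" for l
        by (rule regular_at_cong[OF Y[OF q, of "chart_index c l"] near_mono[OF near_open[OF V(1) q]]])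
          (use T(2)[OF _ chart_index_le[OF l, of c]] in \<open>simp add: tangent_coord_def chart_index_involution[OF l, of c]\<close>)
    qed
  qed
  have "normal_map V \<xi> i v = restr target U V t i v" for i v
  proof (cases "1 \<le> i \<and> i < n \<and> v \<in> \<Union>V")
    case True
    then obtain q where i: "1 \<le> i" "i < n" and q: "q \<in> V" "v \<in> q" by blast
    have i': "1 \<le> chart_index c i" "chart_index c i < n" "chart_index c (chart_index c i) = i" using chart_index_interior[OF i] chart_index_involution[of i c] i by auto
    have qc: "q \<in> chart c" "q \<in> U" using q by (auto simp: V_def)
    have "three_term (chart_exp c) (chart_coord c q) (tangent_coord c (\<xi> q)) (chart_index c i) = three_term (chart_exp c) (chart_coord c q) (\<lambda>l. Y l q) (chart_index c i)"
      using T(2)[OF q(1)] i' by (simp add: three_term_def)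
    also have "\<dots> = g (chart_index c i) q" unfolding Y_def by (rule three_term_solution_correct[where m = "chart_exp c", OF _ i'(1,2)]) (rule chart_exp_dec)
    finally have "normal_map V \<xi> i v = v c ^ (e + twist i) * t i (chart_vec c q)"
      using normal_map_chart[where \<xi> = \<xi> and q = q, OF V(1) T(1)[OF q(1)] qc(1) c(1) q i'(1,2)] i'(3) by (simp add: g_def)
    also have "\<dots> = t i (\<lambda>l. v c * chart_vec c q l)"
      using twist_homogeneous[OF U t'[OF i] chart_vec(1)[OF qc(1)] qc(2), of "v c"] qc(1) q(2) by (simp add: chart_def)
    also have "(\<lambda>l. v c * chart_vec c q l) = v" using chart_vec_scale[OF qc(1) q(2)] by simp
    finally show ?thesis using True unfolding target_sel interior by simp
  next
    case False
    then show ?thesis unfolding target_sel normal_map_def interior by (cases "1 \<le> i \<and> i < n") auto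
  qed
  then have "normal_map V \<xi> = restr target U V t" by (intro ext)
  then show "\<exists>V. zariski_open 1 V \<and> p \<in> V \<and> V \<subseteq> U \<and> (\<exists>s\<in>sec (pullback_tangent n f) V. normal_map V s = restr target U V t)"
    using V \<xi> by blast
qed

lemma differential_sec:
  assumes U: "zariski_open 1 U" and x: "x \<in> sec tangent_P1 U"
  shows "differential n f U x \<in> sec (pullback_tangent n f) U"
proof (rule pullback_tangent_secI)
  show "differential n f U x p = (\<lambda>h. 0)" if "p \<notin> U" for p using that by (simp add: differential_def)
  fix p assume p: "p \<in> U"
  then have ps: "p \<in> proj_space 1" using zariski_open_subset[OF U] by blast
  show "differential n f U x p \<in> tangent_space n (f p)"
    using differential_at_tangent[OF morphism ps pullback_tangent_secD(2)[OF x p]] p by (simp add: differential_def)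
  fix h assume h: "regular_at n (f p) h"
  then have "regular_at 1 p (\<lambda>q. h (f q))" using morphism ps by (simp add: proj_morphism_def)
  then have "regular_at 1 p (\<lambda>q. x q (\<lambda>q'. h (f q')))" by (rule pullback_tangent_secD(3)[OF x p])
  moreover have "near 1 p (\<lambda>q. differential n f U x q h = x q (\<lambda>q'. h (f q')))"
    by (rule near_mono[OF near_conj[OF near_open[OF U p] proj_morphism_near[OF morphism ps regular_at_near[OF h]]]])
      (simp add: differential_def differential_at_def)
  ultimately show "regular_at 1 p (\<lambda>q. differential n f U x q h)" by (rule regular_at_cong)
qed

text \<open>
  The image of a vector field on the line is tangent to the curve, so the three-term forms kill it.
\<close>

lemma normal_map_differential:
  assumes U: "zariski_open 1 U" and x: "x \<in> sec tangent_P1 U" and s: "s \<in> sec (pullback_tangent n f) U"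
  shows "normal_map U (plus_sec (pullback_tangent n f) U s (differential n f U x)) = normal_map U s"
proof (rule normal_map_eqI[OF U])
  note d = differential_sec[OF U x]
  show "s q \<in> tangent_space n (f q)" if "q \<in> U" for q using pullback_tangent_secD(2)[OF s that] .
  show "plus_sec (pullback_tangent n f) U s (differential n f U x) q \<in> tangent_space n (f q)" if "q \<in> U" for q
    unfolding pullback_tangent_sel
    by (rule tangent_space_add[OF pullback_tangent_secD(2)[OF s that] pullback_tangent_secD(2)[OF d that]])
  fix c q i assume q: "c \<le> 1" "q \<in> chart c" "q \<in> U" and i: "1 \<le> i" "i < n"
  have "three_term (chart_exp c) (chart_coord c q) (tangent_coord c (differential n f U x q)) i
      = three_term (chart_exp c) (chart_coord c q) (\<lambda>l. of_nat (chart_exp c l) * chart_coord c q ^ (chart_exp c l - 1) * x q (chart_coord c)) i"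
    using tangent_coord_differential[OF q(2,1) pullback_tangent_secD(2)[OF x q(3)]] q i
    by (simp add: three_term_def differential_def)
  also have "\<dots> = 0" using chart_exp_dec[of "i - 1" c] chart_exp_dec[of i c] i by (intro three_term_derivative) auto
  finally have "three_term (chart_exp c) (chart_coord c q) (tangent_coord c (differential n f U x q)) i = 0" .
  moreover have "tangent_coord c (plus_sec (pullback_tangent n f) U s (differential n f U x) q)
      = (\<lambda>l. tangent_coord c (s q) l + tangent_coord c (differential n f U x q) l)"
    unfolding pullback_tangent_sel by (rule ext) (simp add: tangent_coord_def)
  ultimately show "three_term (chart_exp c) (chart_coord c q) (tangent_coord c (plus_sec (pullback_tangent n f) U s (differential n f U x) q)) i
      = three_term (chart_exp c) (chart_coord c q) (tangent_coord c (s q)) i" by (simp add: three_term_add)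
qed

text \<open>
  The vector field \<open>\<mu> \<partial>/\<partial>z\<close>, where \<open>z\<close> is the coordinate of the chart \<open>c\<close>.
\<close>

definition chart_field :: "nat \<Rightarrow> 'k pt set \<Rightarrow> ('k pt \<Rightarrow> 'k) \<Rightarrow> 'k pt \<Rightarrow> 'k tvec" where
  "chart_field c V \<mu> q = (if q \<in> V
     then dir_deriv 1 (chart_vec c q) (\<lambda>l. if l = 1 - c then \<mu> q else 0) else (\<lambda>h. 0))"

lemma chart_field:
  assumes q: "q \<in> V" "q \<in> chart c" "c \<le> 1"
  shows "chart_field c V \<mu> q \<in> tangent_space 1 q" "chart_field c V \<mu> q (chart_coord c) = \<mu> q"
    "chart_field c V \<mu> q (ratio c c) = 0"
proof -
  let ?w = "\<lambda>l. if l = 1 - c then \<mu> q else 0"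
  have w: "\<forall>l>1. ?w l = 0" by auto
  have c: "c \<noteq> 1 - c" using q(3) by (cases "c = 0") (auto simp: One_nat_def le_Suc_eq)
  have x: "chart_vec c q \<in> coord_vecs 1" "proj_pt (chart_vec c q) = q" "chart_vec c q c = 1"
    using chart_vec[OF q(2)] by auto
  show "chart_field c V \<mu> q \<in> tangent_space 1 q"
    using dir_deriv_tangent[OF x(1) w] q(1) x(2) by (simp add: chart_field_def)
  show "chart_field c V \<mu> q (chart_coord c) = \<mu> q" "chart_field c V \<mu> q (ratio c c) = 0"
    using dir_deriv_ratio[OF x(1) w q(3), of "1 - c"] dir_deriv_ratio[OF x(1) w q(3), of c] q x(3) c
    by (simp_all add: chart_field_def)
qed

lemma chart_field_sec:
  assumes V: "zariski_open 1 V" "V \<subseteq> chart c" and c: "c \<le> 1" and \<mu>: "\<And>q. q \<in> V \<Longrightarrow> regular_at 1 q \<mu>"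
  shows "chart_field c V \<mu> \<in> sec tangent_P1 V"
proof (rule pullback_tangent_secI)
  show "chart_field c V \<mu> q = (\<lambda>h. 0)" if "q \<notin> V" for q using that by (simp add: chart_field_def)
  show T: "chart_field c V \<mu> q \<in> tangent_space 1 q" if "q \<in> V" for q using that V c by (intro chart_field) auto
  fix q h assume q: "q \<in> V" and h: "regular_at 1 q h"
  have qc: "q \<in> chart c" and qs: "q \<in> proj_space 1" using q V zariski_open_subset[OF V(1)] by auto
  show "regular_at 1 q (\<lambda>q'. chart_field c V \<mu> q' h)"
  proof (rule vector_field_regular[OF proj_morphism_id qs _ chart_vec(2)[OF qc] chart_vec(3)[OF qc, symmetric] c _ _ h])
    show "near 1 q (\<lambda>q. chart_field c V \<mu> q \<in> tangent_space 1 q)" by (rule near_mono[OF near_open[OF V(1) q]]) (rule T)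
    show "chart_vec c q c \<noteq> 0" using chart_vec(4)[OF qc] by simp
    show "regular_at 1 q (\<lambda>q'. chart_field c V \<mu> q' (ratio l c))" if l: "l \<le> 1" for l
    proof -
      have "l = 1 - c \<or> l = c" using l c by linarith
      then show ?thesis
      proof
        assume l: "l = 1 - c"
        show ?thesis unfolding l
          by (rule regular_at_cong[OF \<mu>[OF q] near_mono[OF near_open[OF V(1) q]]]) (use chart_field(2) V(2) c in blast)
      next
        assume l: "l = c"
        show ?thesis unfolding l
          by (rule regular_at_cong[OF regular_at_const[OF qs, of 0] near_mono[OF near_open[OF V(1) q]]])
            (use chart_field(3) V(2) c in blast)
      qed
    qed
  qed
qed

text \<open>
  Two vector fields along \<open>f\<close> with the same image differ by the image of \<open>\<mu> \<partial>/\<partial>z\<close>, where \<open>\<mu>\<close> is the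
  difference of their entries at the index \<open>n - 1\<close>: there the exponent is \<open>1\<close>, so this entry of the
  image of \<open>\<mu> \<partial>/\<partial>z\<close> is \<open>\<mu>\<close> itself.
\<close>

lemma normal_map_kernel:
  assumes U: "zariski_open 1 U" and p: "p \<in> U"
    and s: "s \<in> sec (pullback_tangent n f) U" and s': "s' \<in> sec (pullback_tangent n f) U"
    and eq: "normal_map U s = normal_map U s'"
  shows "\<exists>W. zariski_open 1 W \<and> p \<in> W \<and> W \<subseteq> U \<and> (\<exists>x\<in>sec tangent_P1 W.
    restr (pullback_tangent n f) U W s' = plus_sec (pullback_tangent n f) W (restr (pullback_tangent n f) U W s) (differential n f W x))"
proof -
  obtain c where c: "c \<le> 1" "p \<in> chart c" using chart_cover p zariski_open_subset[OF U] by blast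
  define W where "W = U \<inter> chart c"
  have W: "zariski_open 1 W" "p \<in> W" "W \<subseteq> U" "W \<subseteq> chart c"
    unfolding W_def using U chart_open[OF c(1)] p c by (auto intro: zariski_open_Int)
  define \<mu> where "\<mu> q = tangent_coord c (s' q) (n - 1) - tangent_coord c (s q) (n - 1)" for q
  define x where "x = chart_field c W \<mu>"
  have \<mu>: "regular_at 1 q \<mu>" if "q \<in> W" for q
    unfolding \<mu>_def using that c by (intro regular_at_diff tangent_coord_regular[OF s] tangent_coord_regular[OF s']) (auto simp: W_def)
  have x: "x \<in> sec tangent_P1 W" unfolding x_def by (rule chart_field_sec[OF W(1,4) c(1) \<mu>])
  have "s' q = (\<lambda>h. s q h + differential n f W x q h)" if q: "q \<in> W" for q
  proof -
    have qU: "q \<in> U" and qc: "q \<in> chart c" using q by (auto simp: W_def)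
    have xq: "x q \<in> tangent_space 1 q" "x q (chart_coord c) = \<mu> q" using chart_field[OF q qc c(1)] by (auto simp: x_def)
    have T: "s q \<in> tangent_space n (f q)" "s' q \<in> tangent_space n (f q)"
      using pullback_tangent_secD(2)[OF s qU] pullback_tangent_secD(2)[OF s' qU] by auto
    let ?y = "\<lambda>l. tangent_coord c (s' q) l - tangent_coord c (s q) l"
    have y: "?y l = of_nat (chart_exp c l) * chart_coord c q ^ (chart_exp c l - 1) * ?y (n - 1)" if l: "l \<le> n" for l
    proof (rule three_term_kernel[where m = "chart_exp c" and y = ?y and z = "chart_coord c q", OF chart_exp_dec chart_exp_ends _ _ l])
      show "?y n = 0" using tangent_coord_ref[OF qc c(1) T(1)] tangent_coord_ref[OF qc c(1) T(2)] by simp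
      fix i assume i: "1 \<le> i" "i < n"
      have v: "chart_vec c q \<in> q" "chart_vec c q c = 1" using chart_vec[OF qc] by auto
      have "normal_map U s (chart_index c i) (chart_vec c q) = normal_map U s' (chart_index c i) (chart_vec c q)" using eq by simp
      then show "three_term (chart_exp c) (chart_coord c q) ?y i = 0"
        unfolding normal_map_chart[where \<xi> = s, OF U T(1) qc c(1) qU v(1) i]
          normal_map_chart[where \<xi> = s', OF U T(2) qc c(1) qU v(1) i] by (simp add: v(2) three_term_diff)
    qed
    show ?thesis
    proof (rule tangent_coord_eqI[OF qc c(1) T(2)])
      have qs: "q \<in> proj_space 1" using qc by (simp add: chart_def)
      have D: "differential n f W x q = differential_at n f q (x q)" using q by (simp add: differential_def)
      show "(\<lambda>h. s q h + differential n f W x q h) \<in> tangent_space n (f q)"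
        unfolding D by (rule tangent_space_add[OF T(1) differential_at_tangent[OF morphism qs xq(1)]])
      fix l assume l: "l \<le> n"
      have "tangent_coord c (\<lambda>h. s q h + differential n f W x q h) l = tangent_coord c (s q) l + tangent_coord c (differential_at n f q (x q)) l"
        unfolding D by (simp add: tangent_coord_def)
      also have "tangent_coord c (differential_at n f q (x q)) l = ?y l"
        unfolding y[OF l] tangent_coord_differential[OF qc c(1) xq(1) l] xq(2) \<mu>_def ..
      finally show "tangent_coord c (s' q) l = tangent_coord c (\<lambda>h. s q h + differential n f W x q h) l" by simp
    qed
  qed
  then have "restr (pullback_tangent n f) U W s'
      = plus_sec (pullback_tangent n f) W (restr (pullback_tangent n f) U W s) (differential n f W x)"
    unfolding pullback_tangent_sel by (intro ext) (simp add: differential_def)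
  then show ?thesis using W x by blast
qed

lemma normal_bundle_iso: "omod_iso (normal_bundle n f) target"
proof -
  interpret right_exact "pullback_tangent n f" target tangent_P1 "differential n f" normal_map
  proof (intro right_exact.intro right_exact_axioms.intro)
    show "omod_presheaf (pullback_tangent n f)" by (rule omod_presheaf_pullback_tangent)
    show "omod_sheaf target" by (rule omod_sheaf_direct_sum) (rule omod_sheaf_twisting)
    show "omod_hom (pullback_tangent n f) target normal_map" by (rule normal_map_hom)
    show "omod_surj (pullback_tangent n f) target normal_map" by (rule normal_map_surj)
    show "plus_sec (pullback_tangent n f) U s (differential n f U x) \<in> sec (pullback_tangent n f) U \<and>
        normal_map U (plus_sec (pullback_tangent n f) U s (differential n f U x)) = normal_map U s"
      if "zariski_open 1 U" "x \<in> sec tangent_P1 U" "s \<in> sec (pullback_tangent n f) U" for U x s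
      using normal_map_differential[OF that]
        omod_presheaf.plus_sec[OF omod_presheaf_pullback_tangent that(1,3) differential_sec[OF that(1,2)]] by blast
  qed (rule normal_map_kernel)
  show ?thesis unfolding normal_bundle_def by (rule coker_sheaf_iso)
qed

subsection \<open>Unramifiedness\<close>

text \<open>
  On a chart every form on the line is \<open>A dz\<close> with \<open>A\<close> its value on \<open>\<partial>/\<partial>z\<close>, and \<open>dz\<close> is pulled back
  from the ratio of coordinates whose exponent is \<open>1\<close>.
\<close>

lemma unramified: "unramified n f"
  unfolding unramified_def omod_surj_def
proof (intro conjI morphism allI impI ballI)
  fix U :: "'k pt set" and \<omega> p assume U: "zariski_open 1 U" and \<omega>: "\<omega> \<in> sec cotangent_P1 U" and p: "p \<in> U"
  obtain V0 m a h where V0: "zariski_open 1 V0" "p \<in> V0" "V0 \<subseteq> U"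
    and \<omega>_eq: "\<forall>q\<in>V0. (\<forall>j<(m::nat). regular_at 1 q (a j) \<and> regular_at 1 q (h j)) \<and>
      \<omega> q = (\<lambda>\<delta>. if \<delta> \<in> tangent_space 1 q then \<Sum>j<m. a j q * \<delta> (h j) else 0)"
    using \<omega> p unfolding pullback_cotangent_def by simp blast
  obtain c where c: "c \<le> 1" "p \<in> chart c" using chart_cover p zariski_open_subset[OF U] by blast
  define V where "V = V0 \<inter> chart c"
  have V: "zariski_open 1 V" "p \<in> V" "V \<subseteq> U" "V \<subseteq> chart c" "V \<subseteq> V0"
    unfolding V_def using V0 chart_open[OF c(1)] c by (auto intro: zariski_open_Int)
  let ?D = "chart_field c V (\<lambda>q. 1)"
  have D: "?D \<in> sec tangent_P1 V"
    by (rule chart_field_sec[OF V(1,4) c(1) regular_at_const]) (use zariski_open_subset[OF V(1)] in blast)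
  define A where "A q = (\<Sum>j<m. a j q * ?D q (h j))" for q
  have A: "regular_at 1 q A" if q: "q \<in> V" for q
  proof -
    have "q \<in> V0" "q \<in> proj_space 1" using q V(5) zariski_open_subset[OF V(1)] by auto
    then show ?thesis unfolding A_def
      by (intro regular_at_sum regular_at_mult pullback_tangent_secD(3)[OF D q]) (use \<omega>_eq in auto)
  qed
  let ?r = "ratio (chart_index c (n - 1)) (chart_index c n)"
  define s where "s q = (if q \<in> V then \<lambda>\<delta>. if \<delta> \<in> tangent_space n (f q) then (\<Sum>j<1::nat. A q * \<delta> ?r) else 0 else (\<lambda>\<delta>. 0))" for q
  have "s \<in> sec (pullback_cotangent n f) V"
  proof -
    have "\<exists>V'. zariski_open 1 V' \<and> q \<in> V' \<and> V' \<subseteq> V \<and> (\<exists>(m::nat) a h. \<forall>q\<in>V'.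
        (\<forall>j<m. regular_at 1 q (a j) \<and> regular_at n (f q) (h j)) \<and>
        s q = (\<lambda>\<delta>. if \<delta> \<in> tangent_space n (f q) then \<Sum>j<m. a j q * \<delta> (h j) else 0))" if q: "q \<in> V" for q
    proof (rule exI[of _ V], intro conjI V(1) q subset_refl,
        rule exI[of _ "1::nat"], rule exI[of _ "\<lambda>_. A"], rule exI[of _ "\<lambda>_. ?r"], intro ballI conjI allI impI)
      fix q assume q: "q \<in> V"
      show "regular_at 1 q A" by (rule A[OF q])
      show "regular_at n (f q) ?r" using q V(4) c by (intro ratio_f_regular chart_index_le) auto
      show "s q = (\<lambda>\<delta>. if \<delta> \<in> tangent_space n (f q) then \<Sum>j<1::nat. A q * \<delta> ?r else 0)" using q by (simp add: s_def)
    qed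
    then show ?thesis unfolding pullback_cotangent_def by (simp add: s_def)
  qed
  moreover have "codifferential n f V s = restr cotangent_P1 U V \<omega>"
  proof (intro ext)
    fix q \<delta>
    show "codifferential n f V s q \<delta> = restr cotangent_P1 U V \<omega> q \<delta>"
    proof (cases "q \<in> V \<and> \<delta> \<in> tangent_space 1 q")
      case True
      then have q: "q \<in> V" "q \<in> chart c" "q \<in> V0" "q \<in> proj_space 1" and \<delta>: "\<delta> \<in> tangent_space 1 q"
        using V(4,5) zariski_open_subset[OF V(1)] by auto
      have \<delta>_eq: "\<delta> = (\<lambda>h. \<delta> (chart_coord c) * ?D q h)"
      proof (rule tangent_space_eqI[OF _ _ chart_vec(2)[OF q(2)] c(1)])
        note T = chart_field[OF q(1,2) c(1), of "\<lambda>q. 1"]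
        show "\<delta> \<in> tangent_space 1 (proj_pt (chart_vec c q))" using \<delta> chart_vec(3)[OF q(2)] by simp
        show "(\<lambda>h. \<delta> (chart_coord c) * ?D q h) \<in> tangent_space 1 (proj_pt (chart_vec c q))"
          using tangent_space_scale[OF T(1)] chart_vec(3)[OF q(2)] by simp
        show "chart_vec c q c \<noteq> 0" using chart_vec(4)[OF q(2)] by simp
        have "\<delta> (ratio c c) = 0"
          using tangent_ratio_self[of \<delta> 1 "chart_vec c q" c] \<delta> chart_vec[OF q(2)] c(1) by simp
        then show "\<delta> (ratio l c) = \<delta> (chart_coord c) * ?D q (ratio l c)" if "l \<le> 1" for l
        proof -
          have "l = 1 - c \<or> l = c" using that c(1) by linarith
          then show ?thesis using T(2,3) \<open>\<delta> (ratio c c) = 0\<close> by auto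
        qed
      qed
      have r: "differential_at n f q \<delta> ?r = \<delta> (chart_coord c)"
        using tangent_coord_differential[OF q(2) c(1) \<delta>, of "n - 1"] by (simp add: tangent_coord_def chart_exp_ends)
      have "codifferential n f V s q \<delta> = A q * \<delta> (chart_coord c)"
        using q(1) \<delta> r differential_at_tangent[OF morphism q(4) \<delta>] by (simp add: codifferential_def s_def)
      also have "\<dots> = (\<Sum>j<m. a j q * (\<delta> (chart_coord c) * ?D q (h j)))" by (simp add: A_def sum_distrib_left mult_ac)
      also have "\<dots> = (\<Sum>j<m. a j q * \<delta> (h j))"
        using fun_cong[OF \<delta>_eq, symmetric, of "h _"] by (simp only:)
      also have "\<dots> = \<omega> q \<delta>" using \<omega>_eq q(3) \<delta> by simp
      finally show ?thesis using q(1) by (simp add: pullback_cotangent_def)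
    next
      case False
      then have "codifferential n f V s q \<delta> = 0" by (auto simp: codifferential_def)
      moreover have "restr cotangent_P1 U V \<omega> q \<delta> = 0" using False \<omega>_eq V(5) by (auto simp: pullback_cotangent_def)
      ultimately show ?thesis by simp
    qed
  qed
  ultimately show "\<exists>V. zariski_open 1 V \<and> p \<in> V \<and> V \<subseteq> U \<and>
      (\<exists>s\<in>sec (pullback_cotangent n f) V. codifferential n f V s = restr cotangent_P1 U V \<omega>)"
    using V by blast
qed

end

theorem theorem3p2:
  fixes n e :: nat and k :: "nat \<Rightarrow> nat"
    and f :: "'k::{alg_closed_field, field_char_0} pt \<Rightarrow> 'k pt"
  assumes "n \<ge> 2"
    and "k n = 0" and "k (n - 1) = 1" and "k 1 = e - 1" and "k 0 = e"
    and "\<And>i. i < n \<Longrightarrow> k (Suc i) < k i"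
    and "f = monomial_map n e k"
  shows "unramified n f \<and>
    omod_iso (normal_bundle n f)
      (direct_sum {1..n - 1}
        (\<lambda>i. twisting_sheaf (int e + (int (k (i - 1)) - int (k (i + 1))))))"
proof -
  interpret monomial_curve n e k f using assms by unfold_locales
  have "int e + (int (k (i - 1)) - int (k (i + 1))) = int (e + twist i)" if "i \<in> {1..n - 1}" for i
    using k_interior[of i] that unfolding interior by (simp add: twist_def One_nat_def)
  then have "direct_sum {1..n - 1} (\<lambda>i. twisting_sheaf (int e + (int (k (i - 1)) - int (k (i + 1))))) = target"
    unfolding direct_sum_def by (auto simp: fun_eq_iff cong: if_cong)
  then show ?thesis using unramified normal_bundle_iso by simp
qed

end
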